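(* Let $(\mathcal C,\otimes,I,C)$ be a (strict) braided tensor category and let $H$ be a finite Hopf algebra in $\mathcal C$ with $C_{H,H}=C_{H,H}^{-1}$, with evaluation $d_H:H^*\otimes H\to I$ and coevaluation $b:I\to H\otimes H^*$. Set $A=(H^* )^{op}$ and $\tau=d_H C_{H,A}:H\otimes A\to I$. Let $D(H)=A\bowtie_\tau H$ (the Drinfeld double of $H$) and $[b]=\eta_A\otimes b\otimes\eta_H: I\to D(H)\otimes D(H)$. Then $(D(H),[b])$ is a quasi-triangular Hopf algebra in $\mathcal C$.
   Context: All categories are treated as strict; $I$ is the unit object and $C$ the braiding. Composition is written right to left. Algebras, coalgebras, bialgebras and Hopf algebras are understood in $\mathcal C$; tensor product algebras and coalgebras are formed using $C$. $\Delta^{cop}=C\Delta$, $m^{op}=mC$; $(-)^{op}$ denotes replacing the multiplication $m$ by $m^{op}$. Duals. A left dual of $V$ is an object $V^*$ with $d_V:V^*\otimes V\to I$ and $b_V:I\to V\otimes V^*$ such that $(d_V\otimes id)(id\otimes b_V)=id_{V^*}$ and $(id\otimes d_V)(b_V\otimes id)=id_V$. $V$ is finite if it has a left dual. The transpose of $f:U\to V$ is $f^*=(d\otimes id_{U^*})(id_{V^*}\otimes f\otimes id_{U^*})(id_{V^*}\otimes b):V^*\to U^*$. The left dual of $U\otimes V$ is taken to be $V^*\otimes U^*$ with evaluation $d_{U\otimes V}=d_V(id_{V^*}\otimes d_U\otimes id_V)$ and coevaluation $(id_U\otimes b_V\otimes id_{U^*})b_U$. $H^*$ is the Hopf algebra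 whose structure maps are the transposes of those of $H$: multiplication $\Delta^*:H^*\otimes H^*\to H^*$ and comultiplication $m^*:H^*\to H^*\otimes H^*$, so that $d_H(m_{H^*}\otimes id)=d_H(id\otimes d_H\otimes id)(id\otimes id\otimes\Delta_H)$ and $d_H(id\otimes m_H)=d_H(id\otimes d_H\otimes id)(\Delta_{H^*}\otimes id\otimes id)$. The double cross product $A\bowtie_\tau H$. Let $\bar\tau$ be the convolution inverse of $\tau$ in $Hom_{\mathcal C}(H\otimes A,I)$, where $H\otimes A$ is the tensor product coalgebra. Put $\alpha=(\tau\otimes id\otimes\bar\tau)(id\otimes id\otimes C_{H,A}\otimes id)(id\otimes C_{H,A}\otimes\Delta)(\Delta\otimes\Delta):H\otimes A\to A$, $\beta=(\tau\otimes id\otimes\bar\tau)(id\otimes C_{H,A}\otimes id\otimes id)(\Delta\otimes C_{H,A}\otimes id)(\Delta\otimes\Delta):H\otimes A\to H$. Then $A\bowtie_\tau H$ is the object $A\otimes H$ with unit $\eta_A\otimes\eta_H$, multiplication $(m_A\otimes m_H)(id_A\otimes\alpha\otimes\beta\otimes id_H)(id_A\otimes id_H\otimes C_{H,A}\otimes id_A\otimes id_H)(id_A\otimes\Delta_H\otimes\Delta_A\otimes id_H)$, counit $\epsilon_A\otimes\epsilon_H$, and tensor product comultiplication $(id_A\otimes C_{A,H}\otimes id_H)(\Delta_A\otimes\Delta_H)$. Quasi-triangularity. A bialgebra $K$ with a convolution-invertible $R\in Hom_{\mathcal C}(I,K\otimes K)$ and a morphism $\bar\Delta:K\to K\otimes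 K$ is a quasi-triangular bialgebra $(K,R,\bar\Delta)$ if $(K,\bar\Delta,\epsilon)$ is a coalgebra and (QT1) $(\bar\Delta\otimes id)R=(id\otimes id\otimes m)(id\otimes R\otimes id)R$; (QT2) $(id\otimes\Delta)R=(m\otimes id\otimes id)(id\otimes R\otimes id)R$; (QT3) $(m\otimes m)(id\otimes C_{K,K}\otimes id)(\bar\Delta\otimes R)=(m\otimes m)(id\otimes C_{K,K}\otimes id)(R\otimes\Delta)$. $(K,R)$ is called quasi-triangular if $(K,R,\Delta^{cop})$ is quasi-triangular; a quasi-triangular Hopf algebra is a Hopf algebra $K$ with such an $R$. *)

theory Defs
  imports Main
begin

section \<open>Strict braided tensor categories\<close>

text \<open>
  Hom sets are not required to be disjoint, so every typing is stated by membership in a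
  hom set. Composition is written right to left; \<open>\<odot>\<close> is the tensor product of objects and
  \<open>\<otimes>\<close> that of morphisms. Values outside the carriers are irrelevant.
\<close>

record ('o, 'm) btc =
  Ob :: "'o set"
  arrows :: "'o \<Rightarrow> 'o \<Rightarrow> 'm set"  (\<open>Hom\<index>\<close>)
  identity :: "'o \<Rightarrow> 'm"  (\<open>\<one>\<index>\<close>)
  compose :: "'m \<Rightarrow> 'm \<Rightarrow> 'm"  (infixr \<open>\<cdot>\<index>\<close> 65)
  unit_obj :: "'o"  (\<open>\<I>\<index>\<close>)
  tensor_obj :: "'o \<Rightarrow> 'o \<Rightarrow> 'o"  (infixr \<open>\<odot>\<index>\<close> 70)
  tensor_mor :: "'m \<Rightarrow> 'm \<Rightarrow> 'm"  (infixr \<open>\<otimes>\<index>\<close> 70)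
  braiding :: "'o \<Rightarrow> 'o \<Rightarrow> 'm"  (\<open>\<chi>\<index>\<close>)

definition inverse_morphisms :: "('o, 'm) btc \<Rightarrow> 'o \<Rightarrow> 'o \<Rightarrow> 'm \<Rightarrow> 'm \<Rightarrow> bool" where
  "inverse_morphisms \<C> X Y f g \<longleftrightarrow>
     f \<in> Hom\<^bsub>\<C>\<^esub> X Y \<and> g \<in> Hom\<^bsub>\<C>\<^esub> Y X \<and>
     g \<cdot>\<^bsub>\<C>\<^esub> f = \<one>\<^bsub>\<C>\<^esub> X \<and> f \<cdot>\<^bsub>\<C>\<^esub> g = \<one>\<^bsub>\<C>\<^esub> Y"

locale strict_tensor_category =
  fixes \<C> :: "('o, 'm) btc" (structure)
  assumes hom_ob: "f \<in> Hom X Y \<Longrightarrow> X \<in> Ob \<C> \<and> Y \<in> Ob \<C>"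
    and id_hom: "X \<in> Ob \<C> \<Longrightarrow> \<one> X \<in> Hom X X"
    and comp_hom: "f \<in> Hom X Y \<Longrightarrow> g \<in> Hom Y Z \<Longrightarrow> g \<cdot> f \<in> Hom X Z"
    and comp_id: "f \<in> Hom X Y \<Longrightarrow> f \<cdot> \<one> X = f"
    and id_comp: "f \<in> Hom X Y \<Longrightarrow> \<one> Y \<cdot> f = f"
    and comp_assoc:
      "f \<in> Hom W X \<Longrightarrow> g \<in> Hom X Y \<Longrightarrow> h \<in> Hom Y Z \<Longrightarrow> (h \<cdot> g) \<cdot> f = h \<cdot> (g \<cdot> f)"
    and unit_ob: "\<I> \<in> Ob \<C>"
    and tensor_ob: "X \<in> Ob \<C> \<Longrightarrow> Y \<in> Ob \<C> \<Longrightarrow> X \<odot> Y \<in> Ob \<C>"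
    and tensor_hom:
      "f \<in> Hom X Y \<Longrightarrow> g \<in> Hom X' Y' \<Longrightarrow> f \<otimes> g \<in> Hom (X \<odot> X') (Y \<odot> Y')"
    and tensor_id: "X \<in> Ob \<C> \<Longrightarrow> Y \<in> Ob \<C> \<Longrightarrow> \<one> X \<otimes> \<one> Y = \<one> (X \<odot> Y)"
    and interchange:
      "f \<in> Hom X Y \<Longrightarrow> g \<in> Hom Y Z \<Longrightarrow> f' \<in> Hom X' Y' \<Longrightarrow> g' \<in> Hom Y' Z' \<Longrightarrow>
       (g \<cdot> f) \<otimes> (g' \<cdot> f') = (g \<otimes> g') \<cdot> (f \<otimes> f')"
    and tensor_obj_assoc:
      "X \<in> Ob \<C> \<Longrightarrow> Y \<in> Ob \<C> \<Longrightarrow> Z \<in> Ob \<C> \<Longrightarrow> (X \<odot> Y) \<odot> Z = X \<odot> (Y \<odot> Z)"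
    and tensor_obj_unit: "X \<in> Ob \<C> \<Longrightarrow> \<I> \<odot> X = X" "X \<in> Ob \<C> \<Longrightarrow> X \<odot> \<I> = X"
    and tensor_mor_assoc:
      "f \<in> Hom X X' \<Longrightarrow> g \<in> Hom Y Y' \<Longrightarrow> h \<in> Hom Z Z' \<Longrightarrow> (f \<otimes> g) \<otimes> h = f \<otimes> (g \<otimes> h)"
    and tensor_mor_unit: "f \<in> Hom X Y \<Longrightarrow> \<one> \<I> \<otimes> f = f" "f \<in> Hom X Y \<Longrightarrow> f \<otimes> \<one> \<I> = f"

locale strict_braided_category = strict_tensor_category +
  assumes braiding_iso:
      "X \<in> Ob \<C> \<Longrightarrow> Y \<in> Ob \<C> \<Longrightarrow> \<exists>g. inverse_morphisms \<C> (X \<odot> Y) (Y \<odot> X) (\<chi> X Y) g"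
    and braiding_natural:
      "f \<in> Hom X X' \<Longrightarrow> g \<in> Hom Y Y' \<Longrightarrow> \<chi> X' Y' \<cdot> (f \<otimes> g) = (g \<otimes> f) \<cdot> \<chi> X Y"
    and hexagon_left:
      "X \<in> Ob \<C> \<Longrightarrow> Y \<in> Ob \<C> \<Longrightarrow> Z \<in> Ob \<C> \<Longrightarrow>
       \<chi> (X \<odot> Y) Z = (\<chi> X Z \<otimes> \<one> Y) \<cdot> (\<one> X \<otimes> \<chi> Y Z)"
    and hexagon_right:
      "X \<in> Ob \<C> \<Longrightarrow> Y \<in> Ob \<C> \<Longrightarrow> Z \<in> Ob \<C> \<Longrightarrow>
       \<chi> X (Y \<odot> Z) = (\<one> Y \<otimes> \<chi> X Z) \<cdot> (\<chi> X Y \<otimes> \<one> Z)"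


section \<open>Hopf algebras in a braided category\<close>

record ('o, 'm) bialg =
  carr :: 'o
  mult :: 'm
  unit :: 'm
  comult :: 'm
  counit :: 'm

context
  fixes \<C> :: "('o, 'm) btc" (structure)
begin

definition algebra :: "'o \<Rightarrow> 'm \<Rightarrow> 'm \<Rightarrow> bool" where
  "algebra X m u \<longleftrightarrow> X \<in> Ob \<C> \<and> m \<in> Hom (X \<odot> X) X \<and> u \<in> Hom \<I> X \<and>
     m \<cdot> (m \<otimes> \<one> X) = m \<cdot> (\<one> X \<otimes> m) \<and>
     m \<cdot> (u \<otimes> \<one> X) = \<one> X \<and> m \<cdot> (\<one> X \<otimes> u) = \<one> X"

definition coalgebra :: "'o \<Rightarrow> 'm \<Rightarrow> 'm \<Rightarrow> bool" where
  "coalgebra X \<Delta> \<epsilon> \<longleftrightarrow> X \<in> Ob \<C> \<and> \<Delta> \<in> Hom X (X \<odot> X) \<and> \<epsilon> \<in> Hom X \<I> \<and>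
     (\<Delta> \<otimes> \<one> X) \<cdot> \<Delta> = (\<one> X \<otimes> \<Delta>) \<cdot> \<Delta> \<and>
     (\<epsilon> \<otimes> \<one> X) \<cdot> \<Delta> = \<one> X \<and> (\<one> X \<otimes> \<epsilon>) \<cdot> \<Delta> = \<one> X"

definition tensor_mult :: "'o \<Rightarrow> 'm \<Rightarrow> 'o \<Rightarrow> 'm \<Rightarrow> 'm" where
  "tensor_mult X mX Y mY = (mX \<otimes> mY) \<cdot> (\<one> X \<otimes> \<chi> Y X \<otimes> \<one> Y)"

definition tensor_comult :: "'o \<Rightarrow> 'm \<Rightarrow> 'o \<Rightarrow> 'm \<Rightarrow> 'm" where
  "tensor_comult X \<Delta>X Y \<Delta>Y = (\<one> X \<otimes> \<chi> X Y \<otimes> \<one> Y) \<cdot> (\<Delta>X \<otimes> \<Delta>Y)"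

definition bialgebra :: "('o, 'm) bialg \<Rightarrow> bool" where
  "bialgebra K \<longleftrightarrow>
     algebra (carr K) (mult K) (unit K) \<and>
     coalgebra (carr K) (comult K) (counit K) \<and>
     comult K \<cdot> mult K =
       tensor_mult (carr K) (mult K) (carr K) (mult K) \<cdot> (comult K \<otimes> comult K) \<and>
     comult K \<cdot> unit K = unit K \<otimes> unit K \<and>
     counit K \<cdot> mult K = counit K \<otimes> counit K \<and>
     counit K \<cdot> unit K = \<one> \<I>"

definition antipode :: "('o, 'm) bialg \<Rightarrow> 'm \<Rightarrow> bool" where
  "antipode K S \<longleftrightarrow> S \<in> Hom (carr K) (carr K) \<and>
     mult K \<cdot> (S \<otimes> \<one> (carr K)) \<cdot> comult K = unit K \<cdot> counit K \<and>
     mult K \<cdot> (\<one> (carr K) \<otimes> S) \<cdot> comult K = unit K \<cdot> counit K"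

definition hopf_algebra :: "('o, 'm) bialg \<Rightarrow> bool" where
  "hopf_algebra K \<longleftrightarrow> bialgebra K \<and> (\<exists>S. antipode K S)"

definition opposite :: "('o, 'm) bialg \<Rightarrow> ('o, 'm) bialg" where
  "opposite K = K\<lparr>mult := mult K \<cdot> \<chi> (carr K) (carr K)\<rparr>"

text \<open>
  \<open>g\<close> is inverse to \<open>f\<close> in \<open>Hom X Y\<close> for the convolution given by the coalgebra
  \<open>(X, \<Delta>, \<epsilon>)\<close> and the algebra \<open>(Y, m, u)\<close>. The unit object is a coalgebra and an algebra
  with all structure maps equal to \<open>\<one> \<I>\<close>, as \<open>\<I> \<odot> \<I> = \<I>\<close>.
\<close>

definition convolution_inverse ::
  "'o \<Rightarrow> 'm \<Rightarrow> 'm \<Rightarrow> 'o \<Rightarrow> 'm \<Rightarrow> 'm \<Rightarrow> 'm \<Rightarrow> 'm \<Rightarrow> bool" where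
  "convolution_inverse X \<Delta> \<epsilon> Y m u f g \<longleftrightarrow> f \<in> Hom X Y \<and> g \<in> Hom X Y \<and>
     m \<cdot> (f \<otimes> g) \<cdot> \<Delta> = u \<cdot> \<epsilon> \<and> m \<cdot> (g \<otimes> f) \<cdot> \<Delta> = u \<cdot> \<epsilon>"


section \<open>Duals\<close>

definition left_dual :: "'o \<Rightarrow> 'o \<Rightarrow> 'm \<Rightarrow> 'm \<Rightarrow> bool" where
  "left_dual V V' d b \<longleftrightarrow> V \<in> Ob \<C> \<and> V' \<in> Ob \<C> \<and>
     d \<in> Hom (V' \<odot> V) \<I> \<and> b \<in> Hom \<I> (V \<odot> V') \<and>
     (d \<otimes> \<one> V') \<cdot> (\<one> V' \<otimes> b) = \<one> V' \<and>
     (\<one> V \<otimes> d) \<cdot> (b \<otimes> \<one> V) = \<one> V"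

text \<open>
  Transpose of \<open>f : U \<rightarrow> V\<close>, where \<open>bU\<close> is the coevaluation of the dual \<open>U'\<close> of \<open>U\<close>
  and \<open>dV\<close> the evaluation of the dual \<open>V'\<close> of \<open>V\<close>.
\<close>

definition transpose :: "'o \<Rightarrow> 'm \<Rightarrow> 'o \<Rightarrow> 'm \<Rightarrow> 'm \<Rightarrow> 'm" where
  "transpose U' bU V' dV f = (dV \<otimes> \<one> U') \<cdot> (\<one> V' \<otimes> f \<otimes> \<one> U') \<cdot> (\<one> V' \<otimes> bU)"

text \<open>Evaluation and coevaluation for \<open>V' \<odot> U'\<close> as left dual of \<open>U \<odot> V\<close>.\<close>

definition tensor_ev :: "'m \<Rightarrow> 'o \<Rightarrow> 'o \<Rightarrow> 'm \<Rightarrow> 'm" where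
  "tensor_ev dU V V' dV = dV \<cdot> (\<one> V' \<otimes> dU \<otimes> \<one> V)"

definition tensor_coev :: "'o \<Rightarrow> 'o \<Rightarrow> 'm \<Rightarrow> 'm \<Rightarrow> 'm" where
  "tensor_coev U U' bU bV = (\<one> U \<otimes> bV \<otimes> \<one> U') \<cdot> bU"

text \<open>The unit object is its own left dual, with evaluation and coevaluation \<open>\<one> \<I>\<close>.\<close>

definition dual_bialg :: "('o, 'm) bialg \<Rightarrow> 'o \<Rightarrow> 'm \<Rightarrow> 'm \<Rightarrow> ('o, 'm) bialg" where
  "dual_bialg H H' d b =
     \<lparr> carr = H',
       mult = transpose H' b (H' \<odot> H') (tensor_ev d (carr H) H' d) (comult H),
       unit = transpose H' b \<I> (\<one> \<I>) (counit H),
       comult = transpose (H' \<odot> H') (tensor_coev (carr H) H' b b) H' d (mult H),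
       counit = transpose \<I> (\<one> \<I>) H' d (unit H) \<rparr>"


section \<open>Double cross products and the Drinfeld double\<close>

definition pairing_inverse :: "('o, 'm) bialg \<Rightarrow> ('o, 'm) bialg \<Rightarrow> 'm \<Rightarrow> 'm \<Rightarrow> bool" where
  "pairing_inverse A H \<tau> \<tau>' \<longleftrightarrow>
     convolution_inverse
       (carr H \<odot> carr A) (tensor_comult (carr H) (comult H) (carr A) (comult A))
       (counit H \<otimes> counit A) \<I> (\<one> \<I>) (\<one> \<I>) \<tau> \<tau>'"

text \<open>
  Convolution inverses are unique, so \<open>THE\<close> picks the inverse of \<open>\<tau>\<close> whenever there is
  one; the double cross product is meaningful only for convolution-invertible \<open>\<tau>\<close>.
\<close>

definition double_cross_product ::
  "('o, 'm) bialg \<Rightarrow> ('o, 'm) bialg \<Rightarrow> 'm \<Rightarrow> ('o, 'm) bialg" where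
  "double_cross_product A H \<tau> =
     (let a = \<one> (carr A); h = \<one> (carr H); c = \<chi> (carr H) (carr A);
          \<tau>' = (THE \<tau>'. pairing_inverse A H \<tau> \<tau>');
          \<alpha> = (\<tau> \<otimes> a \<otimes> \<tau>') \<cdot> (h \<otimes> a \<otimes> c \<otimes> a) \<cdot> (h \<otimes> c \<otimes> comult A) \<cdot> (comult H \<otimes> comult A);
          \<beta> = (\<tau> \<otimes> h \<otimes> \<tau>') \<cdot> (h \<otimes> c \<otimes> h \<otimes> a) \<cdot> (comult H \<otimes> c \<otimes> a) \<cdot> (comult H \<otimes> comult A)
      in \<lparr> carr = carr A \<odot> carr H,
           mult = (mult A \<otimes> mult H) \<cdot> (a \<otimes> \<alpha> \<otimes> \<beta> \<otimes> h) \<cdot>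
                  (a \<otimes> h \<otimes> c \<otimes> a \<otimes> h) \<cdot> (a \<otimes> comult H \<otimes> comult A \<otimes> h),
           unit = unit A \<otimes> unit H,
           comult = tensor_comult (carr A) (comult A) (carr H) (comult H),
           counit = counit A \<otimes> counit H \<rparr>)"

definition double_pairing :: "('o, 'm) bialg \<Rightarrow> 'o \<Rightarrow> 'm \<Rightarrow> 'm" where
  "double_pairing H H' d = d \<cdot> \<chi> (carr H) H'"

definition drinfeld_double :: "('o, 'm) bialg \<Rightarrow> 'o \<Rightarrow> 'm \<Rightarrow> 'm \<Rightarrow> ('o, 'm) bialg" where
  "drinfeld_double H H' d b =
     double_cross_product (opposite (dual_bialg H H' d b)) H (double_pairing H H' d)"

definition double_R :: "('o, 'm) bialg \<Rightarrow> 'o \<Rightarrow> 'm \<Rightarrow> 'm \<Rightarrow> 'm" where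
  "double_R H H' d b = unit (opposite (dual_bialg H H' d b)) \<otimes> b \<otimes> unit H"


section \<open>Quasi-triangularity\<close>

text \<open>The argument \<open>D\<close> is the second comultiplication.\<close>

definition quasi_triangular_bialgebra :: "('o, 'm) bialg \<Rightarrow> 'm \<Rightarrow> 'm \<Rightarrow> bool" where
  "quasi_triangular_bialgebra K R D \<longleftrightarrow>
     (let X = carr K; k = \<one> X; m = mult K; mm = (m \<otimes> m) \<cdot> (k \<otimes> \<chi> X X \<otimes> k)
      in bialgebra K \<and>
         R \<in> Hom \<I> (X \<odot> X) \<and>
         (\<exists>R'. convolution_inverse \<I> (\<one> \<I>) (\<one> \<I>)
                 (X \<odot> X) (tensor_mult X m X m) (unit K \<otimes> unit K) R R') \<and>
         D \<in> Hom X (X \<odot> X) \<and>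
         coalgebra X D (counit K) \<and>
         (D \<otimes> k) \<cdot> R = (k \<otimes> k \<otimes> m) \<cdot> (k \<otimes> R \<otimes> k) \<cdot> R \<and>
         (k \<otimes> comult K) \<cdot> R = (m \<otimes> k \<otimes> k) \<cdot> (k \<otimes> R \<otimes> k) \<cdot> R \<and>
         mm \<cdot> (D \<otimes> R) = mm \<cdot> (R \<otimes> comult K))"

definition quasi_triangular :: "('o, 'm) bialg \<Rightarrow> 'm \<Rightarrow> bool" where
  "quasi_triangular K R \<longleftrightarrow>
     quasi_triangular_bialgebra K R (\<chi> (carr K) (carr K) \<cdot> comult K)"

definition quasi_triangular_hopf_algebra :: "('o, 'm) bialg \<Rightarrow> 'm \<Rightarrow> bool" where
  "quasi_triangular_hopf_algebra K R \<longleftrightarrow> hopf_algebra K \<and> quasi_triangular K R"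

end

end

theory Submission
  imports Defs
begin

text \<open>
  Write \<open>S\<close> for the antipode of \<open>H\<close>, \<open>\<Sum> e\<^sub>i \<otimes> e\<^sup>i\<close> for the coevaluation, \<open>h\<^sub>1 \<otimes> h\<^sub>2\<close> for
  a comultiplication and \<open>\<langle>x, h\<rangle>\<close> for the evaluation of \<open>x : A\<close> on \<open>h : H\<close>.

  \<^bold>\<open>Symmetry.\<close> Naturality of the braiding with respect to the evaluation shows that the braiding is
  an involution on \<open>H \<otimes> H\<^sup>*\<close> and on \<open>H\<^sup>* \<otimes> H\<^sup>*\<close> as soon as it is one on \<open>H \<otimes> H\<close>
  (\<open>dual_symmetric\<close>). On words in \<open>H\<close> and \<open>H\<^sup>*\<close> the braiding is therefore a symmetry, and the
  element notation of linear algebra becomes sound: a morphism is a network of boxes joined by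
  named wires, and neither the order of independent boxes nor the crossings of wires matter
  (\<open>sem_reordering\<close>). Rewriting a subnetwork by a known equation is then a finite, checkable
  operation, and \<open>derivation\<close> proves an equation from a list of such rewriting moves.

  \<^bold>\<open>The inverse of the antipode.\<close> In \<open>A = (H\<^sup>*)\<^sup>o\<^sup>p\<close> one has
  \<open>\<langle>xy, h\<rangle> = \<langle>x, h\<^sub>1\<rangle>\<langle>y, h\<^sub>2\<rangle>\<close> and \<open>\<langle>x, hg\<rangle> = \<langle>x\<^sub>1, g\<rangle>\<langle>x\<^sub>2, h\<rangle>\<close>, so
  \<open>\<tau>(h, x) = \<langle>x, h\<rangle>\<close> has the convolution inverse \<open>\<tau>'(h, x) = \<langle>x, S\<^sup>-\<^sup>1(h)\<rangle>\<close>, provided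
  that \<open>S\<close> is invertible. For vector spaces this is the theorem of Larson and Sweedler. Their
  argument produces an integral from the projection of the Hopf module \<open>H\<^sup>*\<close> onto its
  coinvariants. Idempotents need not split here, so that projection itself, an explicit
  endomorphism \<open>Q\<close> of \<open>H\<close>, takes the place of an integral and a cointegral together: the laws
  \<open>Q(x) S(h) = \<epsilon>(h) Q(x)\<close>, \<open>x\<^sub>1 \<otimes> Q(x\<^sub>2) = 1 \<otimes> Q(x)\<close>, \<open>Q Q = Q\<close> and \<open>tr(Q S) = 1\<close> yield
  a left inverse of \<open>S\<close> (\<open>retract_ant\<close>). The same theorem for \<open>H\<^sup>*\<close> yields a right inverse
  (\<open>antA_transpose\<close>, \<open>ant_inv\<close>).

  \<^bold>\<open>The double.\<close> The multiplication of \<open>D(H)\<close> is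
  \<open>(x \<otimes> h)(y \<otimes> g) = x X(h \<otimes> y) g\<close> with the cross map
  \<open>X(h \<otimes> x) = \<tau>(h\<^sub>1, x\<^sub>1) x\<^sub>2 \<otimes> h\<^sub>2 \<tau>'(h\<^sub>3, x\<^sub>3)\<close>. It is a morphism of coalgebras which
  is compatible with both multiplications and units (\<open>cro_mul\<close>, \<open>cro_mulA\<close>, \<open>com_cro\<close>), that is,
  a distributive law between bialgebras; this makes \<open>D(H)\<close> a bialgebra with antipode
  \<open>x \<otimes> h \<mapsto> X(S h \<otimes> S\<^sub>A x)\<close>. For the matrix \<open>\<Sum> 1 \<otimes> e\<^sub>i \<otimes> e\<^sup>i \<otimes> 1\<close> the first two axioms say
  that coevaluation turns products of \<open>A\<close> into coproducts of \<open>H\<close> and conversely, and the third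
  one is the cross relation, checked separately on \<open>H\<close> and on \<open>A\<close>
  (\<open>twist_alg\<close>, \<open>twist_dual\<close>).
\<close>

section \<open>Braidings with a dual object\<close>

context strict_braided_category
begin

lemma braiding_hom: "X \<in> Ob \<C> \<Longrightarrow> Y \<in> Ob \<C> \<Longrightarrow> \<chi> X Y \<in> Hom (X \<odot> Y) (Y \<odot> X)"
  using braiding_iso unfolding inverse_morphisms_def by blast

text \<open>
  By the hexagons the braiding with the unit object is an idempotent, and it is invertible.
\<close>

lemma braiding_unit:
  assumes X: "X \<in> Ob \<C>"
  shows "\<chi> X \<I> = \<one> X" and "\<chi> \<I> X = \<one> X"
proof -
  have *: "c = \<one> X" if c: "c \<in> Hom X X" and idem: "c \<cdot> c = c"
    and iso: "\<exists>g. inverse_morphisms \<C> X X c g" for c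
  proof -
    obtain g where g: "g \<in> Hom X X" "g \<cdot> c = \<one> X"
      using iso unfolding inverse_morphisms_def by blast
    have "c = (g \<cdot> c) \<cdot> c" using g id_comp[OF c] by simp
    also have "\<dots> = g \<cdot> c" using comp_assoc[OF c c g(1)] idem by simp
    finally show ?thesis using g by simp
  qed
  note u = tensor_obj_unit[OF X] tensor_obj_unit[OF unit_ob]
  have c: "\<chi> X \<I> \<in> Hom X X" "\<chi> \<I> X \<in> Hom X X"
    using braiding_hom[OF X unit_ob] braiding_hom[OF unit_ob X] u by simp_all
  show "\<chi> X \<I> = \<one> X"
    using hexagon_right[OF X unit_ob unit_ob] braiding_iso[OF X unit_ob]
    by (intro *) (simp_all add: u c tensor_mor_unit[OF c(1)])
  show "\<chi> \<I> X = \<one> X"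
    using hexagon_left[OF unit_ob unit_ob X] braiding_iso[OF unit_ob X]
    by (intro *) (simp_all add: u c tensor_mor_unit[OF c(2)])
qed

text \<open>
  Morphisms into \<open>X \<odot> V'\<close> correspond to morphisms \<open>Y \<odot> V \<rightarrow> X\<close>, the inverse passage being composition
  with the coevaluation.
\<close>

lemma evaluation_cancel:
  assumes dual: "left_dual \<C> V V' d b" and X: "X \<in> Ob \<C>"
    and f: "f \<in> Hom Y (X \<odot> V')" and g: "g \<in> Hom Y (X \<odot> V')"
    and eq: "(\<one> X \<otimes> d) \<cdot> (f \<otimes> \<one> V) = (\<one> X \<otimes> d) \<cdot> (g \<otimes> \<one> V)"
  shows "f = g"
proof -
  have D: "V \<in> Ob \<C>" "V' \<in> Ob \<C>" "d \<in> Hom (V' \<odot> V) \<I>" "b \<in> Hom \<I> (V \<odot> V')"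
    "(d \<otimes> \<one> V') \<cdot> (\<one> V' \<otimes> b) = \<one> V'"
    using dual unfolding left_dual_def by auto
  have Y: "Y \<in> Ob \<C>" using hom_ob[OF f] by simp
  note ids = id_hom[OF D(1)] id_hom[OF D(2)] id_hom[OF X] id_hom[OF Y]
  have "f = (((\<one> X \<otimes> d) \<cdot> (f \<otimes> \<one> V)) \<otimes> \<one> V') \<cdot> (\<one> Y \<otimes> b)" if f: "f \<in> Hom Y (X \<odot> V')" for f
  proof -
    have h: "\<one> V' \<otimes> b \<in> Hom V' (V' \<odot> V \<odot> V')" "d \<otimes> \<one> V' \<in> Hom (V' \<odot> V \<odot> V') V'"
      using tensor_hom[OF ids(2) D(4)] tensor_hom[OF D(3) ids(2)] D
      by (simp_all add: tensor_obj_unit tensor_obj_assoc)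
    have fV: "f \<otimes> \<one> V \<in> Hom (Y \<odot> V) (X \<odot> V' \<odot> V)"
      using tensor_hom[OF f ids(1)] D X by (simp add: tensor_obj_assoc)
    have Xd: "\<one> X \<otimes> d \<in> Hom (X \<odot> V' \<odot> V) X"
      using tensor_hom[OF ids(3) D(3)] X by (simp add: tensor_obj_unit)
    have Yb: "\<one> Y \<otimes> b \<in> Hom Y (Y \<odot> V \<odot> V')"
      using tensor_hom[OF ids(4) D(4)] Y by (simp add: tensor_obj_unit)
    have XdV: "\<one> X \<otimes> d \<otimes> \<one> V' \<in> Hom (X \<odot> V' \<odot> V \<odot> V') (X \<odot> V')"
      using tensor_hom[OF ids(3) h(2)] .
    have Xb: "\<one> X \<otimes> \<one> V' \<otimes> b \<in> Hom (X \<odot> V') (X \<odot> V' \<odot> V \<odot> V')"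
      using tensor_hom[OF ids(3) h(1)] .
    have fVV: "f \<otimes> \<one> V \<otimes> \<one> V' \<in> Hom (Y \<odot> V \<odot> V') (X \<odot> V' \<odot> V \<odot> V')"
      using tensor_hom[OF f tensor_hom[OF ids(1,2)]] D X by (simp add: tensor_obj_assoc tensor_ob)
    have "((\<one> X \<otimes> d) \<cdot> (f \<otimes> \<one> V)) \<otimes> \<one> V' = (\<one> X \<otimes> d \<otimes> \<one> V') \<cdot> (f \<otimes> \<one> V \<otimes> \<one> V')"
      using interchange[OF fV Xd ids(2) ids(2)] id_comp[OF ids(2)] tensor_mor_assoc[OF ids(3) D(3) ids(2)]
        tensor_mor_assoc[OF f ids(1) ids(2)] by simp
    moreover have "(f \<otimes> \<one> V \<otimes> \<one> V') \<cdot> (\<one> Y \<otimes> b) = f \<otimes> b"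
      using interchange[OF ids(4) f D(4) id_hom[OF tensor_ob[OF D(1,2)]]] comp_id[OF f] id_comp[OF D(4)]
        tensor_id[OF D(1,2)] by simp
    moreover have "f \<otimes> b = (\<one> X \<otimes> \<one> V' \<otimes> b) \<cdot> f"
      using interchange[OF f id_hom[OF tensor_ob[OF X D(2)]] id_hom[OF unit_ob] D(4)] comp_id[OF D(4)]
        id_comp[OF f] tensor_mor_unit(2)[OF f] tensor_id[OF X D(2)] tensor_mor_assoc[OF ids(3) ids(2) D(4)]
      by simp
    moreover have "(\<one> X \<otimes> d \<otimes> \<one> V') \<cdot> (\<one> X \<otimes> \<one> V' \<otimes> b) = \<one> (X \<odot> V')"
      using interchange[OF ids(3) ids(3) h] id_comp[OF ids(3)] D(5) tensor_id[OF X D(2)] by simp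
    ultimately show ?thesis
      using comp_assoc[OF Yb fVV XdV] comp_assoc[OF f Xb XdV] id_comp[OF f] by simp
  qed
  from this[OF f] this[OF g] show ?thesis using eq by simp
qed

text \<open>
  Sliding a strand \<open>X\<close> across the evaluation \<open>d\<close>, over it or under it, shows that the braiding
  \<open>\<chi> V' X\<close> and the inverse of \<open>\<chi> X V'\<close> have the same composite with \<open>d\<close>.
\<close>

lemma dual_symmetric:
  assumes dual: "left_dual \<C> V V' d b" and X: "X \<in> Ob \<C>"
    and sym: "\<chi> V X \<cdot> \<chi> X V = \<one> (X \<odot> V)"
  shows "\<chi> X V' \<cdot> \<chi> V' X = \<one> (V' \<odot> X)" and "\<chi> V' X \<cdot> \<chi> X V' = \<one> (X \<odot> V')"
proof -
  have D: "V \<in> Ob \<C>" "V' \<in> Ob \<C>" "d \<in> Hom (V' \<odot> V) \<I>"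
    using dual unfolding left_dual_def by auto
  note ids = id_hom[OF D(1)] id_hom[OF D(2)] id_hom[OF X]
  note br = braiding_hom[OF D(1) X] braiding_hom[OF X D(1)] braiding_hom[OF D(2) X] braiding_hom[OF X D(2)]
  obtain g where g: "g \<in> Hom (V' \<odot> X) (X \<odot> V')" "g \<cdot> \<chi> X V' = \<one> (X \<odot> V')" "\<chi> X V' \<cdot> g = \<one> (V' \<odot> X)"
    using braiding_iso[OF X D(2)] unfolding inverse_morphisms_def by blast
  have dX: "d \<otimes> \<one> X \<in> Hom (V' \<odot> V \<odot> X) X" and Xd: "\<one> X \<otimes> d \<in> Hom (X \<odot> V' \<odot> V) X"
    using tensor_hom[OF D(3) ids(3)] tensor_hom[OF ids(3) D(3)] D X
    by (simp_all add: tensor_obj_unit tensor_obj_assoc)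
  have c: "\<one> V' \<otimes> \<chi> V X \<in> Hom (V' \<odot> V \<odot> X) (V' \<odot> X \<odot> V)"
    "\<one> V' \<otimes> \<chi> X V \<in> Hom (V' \<odot> X \<odot> V) (V' \<odot> V \<odot> X)"
    "\<chi> V' X \<otimes> \<one> V \<in> Hom (V' \<odot> X \<odot> V) (X \<odot> V' \<odot> V)"
    "\<chi> X V' \<otimes> \<one> V \<in> Hom (X \<odot> V' \<odot> V) (V' \<odot> X \<odot> V)"
    "g \<otimes> \<one> V \<in> Hom (V' \<odot> X \<odot> V) (X \<odot> V' \<odot> V)"
    using tensor_hom[OF ids(2) br(1)] tensor_hom[OF ids(2) br(2)] tensor_hom[OF br(3) ids(1)]
      tensor_hom[OF br(4) ids(1)] tensor_hom[OF g(1) ids(1)] D X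
    by (simp_all add: tensor_obj_assoc)
  have "d \<otimes> \<one> X = (\<one> X \<otimes> d) \<cdot> ((\<chi> V' X \<otimes> \<one> V) \<cdot> (\<one> V' \<otimes> \<chi> V X))"
    using braiding_natural[OF D(3) ids(3)] braiding_unit(2)[OF X] id_comp[OF dX] hexagon_left[OF D(2,1) X]
    by simp
  moreover have "(\<one> V' \<otimes> \<chi> V X) \<cdot> (\<one> V' \<otimes> \<chi> X V) = \<one> (V' \<odot> X \<odot> V)"
    using interchange[OF ids(2) ids(2) br(2,1)] sym id_comp[OF ids(2)] tensor_id[OF D(2) tensor_ob[OF X D(1)]]
    by simp
  ultimately have "(d \<otimes> \<one> X) \<cdot> (\<one> V' \<otimes> \<chi> X V) = (\<one> X \<otimes> d) \<cdot> (\<chi> V' X \<otimes> \<one> V)"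
    using comp_assoc[OF c(2) comp_hom[OF c(1,3)] Xd] comp_assoc[OF c(2,1,3)] comp_id[OF c(3)] by simp
  moreover have "(d \<otimes> \<one> X) \<cdot> (\<one> V' \<otimes> \<chi> X V) = (\<one> X \<otimes> d) \<cdot> (g \<otimes> \<one> V)"
  proof -
    have "\<one> X \<otimes> d = (d \<otimes> \<one> X) \<cdot> ((\<one> V' \<otimes> \<chi> X V) \<cdot> (\<chi> X V' \<otimes> \<one> V))"
      using braiding_natural[OF ids(3) D(3)] braiding_unit(1)[OF X] id_comp[OF Xd] hexagon_right[OF X D(2,1)]
      by simp
    moreover have "(\<chi> X V' \<otimes> \<one> V) \<cdot> (g \<otimes> \<one> V) = \<one> (V' \<odot> X \<odot> V)"
      using interchange[OF g(1) br(4) ids(1) ids(1)] g(3) id_comp[OF ids(1)]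
        tensor_id[OF tensor_ob[OF D(2) X] D(1)] D X by (simp add: tensor_obj_assoc)
    ultimately show ?thesis
      using comp_assoc[OF c(5) comp_hom[OF c(4,2)] dX] comp_assoc[OF c(5,4,2)] comp_id[OF c(2)] by simp
  qed
  ultimately have "\<chi> V' X = g" using evaluation_cancel[OF dual X br(3) g(1)] by simp
  then show "\<chi> X V' \<cdot> \<chi> V' X = \<one> (V' \<odot> X)" "\<chi> V' X \<cdot> \<chi> X V' = \<one> (X \<odot> V')" using g by simp_all
qed

end
section \<open>Uniqueness of convolution inverses\<close>

context strict_tensor_category
begin

text \<open>
  The usual computation \<open>g = g * (f * g') = (g * f) * g' = g'\<close>.
\<close>

lemma convolution_inverse_unique:
  assumes coalg: "coalgebra \<C> X \<Delta> \<epsilon>"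
    and g: "convolution_inverse \<C> X \<Delta> \<epsilon> \<I> (\<one> \<I>) (\<one> \<I>) f g"
    and g': "convolution_inverse \<C> X \<Delta> \<epsilon> \<I> (\<one> \<I>) (\<one> \<I>) f g'"
  shows "g = g'"
proof -
  have X: "X \<in> Ob \<C>" and \<Delta>: "\<Delta> \<in> Hom X (X \<odot> X)" and \<epsilon>: "\<epsilon> \<in> Hom X \<I>"
    and c: "(\<Delta> \<otimes> \<one> X) \<cdot> \<Delta> = (\<one> X \<otimes> \<Delta>) \<cdot> \<Delta>"
      "(\<epsilon> \<otimes> \<one> X) \<cdot> \<Delta> = \<one> X" "(\<one> X \<otimes> \<epsilon>) \<cdot> \<Delta> = \<one> X"
    using coalg unfolding coalgebra_def by auto
  have h: "f \<in> Hom X \<I>" "g \<in> Hom X \<I>" "g' \<in> Hom X \<I>"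
    using g g' unfolding convolution_inverse_def by auto
  note i = id_hom[OF X] and u = tensor_obj_unit[OF unit_ob]
  have p: "k \<otimes> l \<in> Hom (X \<odot> X) \<I>" if "k \<in> Hom X \<I>" "l \<in> Hom X \<I>" for k l
    using tensor_hom[OF that] u by simp
  have fg: "(f \<otimes> g') \<cdot> \<Delta> = \<epsilon>" "(g \<otimes> f) \<cdot> \<Delta> = \<epsilon>"
    using g g' id_comp[OF comp_hom[OF \<Delta> p]] id_comp[OF \<epsilon>] h
    unfolding convolution_inverse_def by auto
  have t: "\<one> X \<otimes> \<Delta> \<in> Hom (X \<odot> X) (X \<odot> X \<odot> X)" "\<Delta> \<otimes> \<one> X \<in> Hom (X \<odot> X) (X \<odot> X \<odot> X)"
    "g \<otimes> f \<otimes> g' \<in> Hom (X \<odot> X \<odot> X) \<I>"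
    "\<one> X \<otimes> \<epsilon> \<in> Hom (X \<odot> X) X" "\<epsilon> \<otimes> \<one> X \<in> Hom (X \<odot> X) X"
    using tensor_hom[OF i \<Delta>] tensor_hom[OF \<Delta> i] tensor_hom[OF h(2) p[OF h(1,3)]]
      tensor_hom[OF i \<epsilon>] tensor_hom[OF \<epsilon> i] X
    by (simp_all add: u tensor_obj_unit tensor_obj_assoc)
  have "g = (g \<cdot> (\<one> X \<otimes> \<epsilon>)) \<cdot> \<Delta>"
    using comp_assoc[OF \<Delta> t(4) h(2)] c(3) comp_id[OF h(2)] by simp
  also have "g \<cdot> (\<one> X \<otimes> \<epsilon>) = g \<otimes> ((f \<otimes> g') \<cdot> \<Delta>)"
    using interchange[OF i h(2) \<epsilon> id_hom[OF unit_ob]] tensor_mor_unit(2)[OF h(2)] comp_id[OF h(2)]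
      id_comp[OF \<epsilon>] fg by simp
  also have "\<dots> = (g \<otimes> f \<otimes> g') \<cdot> (\<one> X \<otimes> \<Delta>)"
    using interchange[OF i h(2) \<Delta> p[OF h(1,3)]] comp_id[OF h(2)] by simp
  also have "((g \<otimes> f \<otimes> g') \<cdot> (\<one> X \<otimes> \<Delta>)) \<cdot> \<Delta> = ((g \<otimes> f \<otimes> g') \<cdot> (\<Delta> \<otimes> \<one> X)) \<cdot> \<Delta>"
    using comp_assoc[OF \<Delta> t(1,3)] comp_assoc[OF \<Delta> t(2,3)] c(1) by simp
  also have "(g \<otimes> f \<otimes> g') \<cdot> (\<Delta> \<otimes> \<one> X) = ((g \<otimes> f) \<cdot> \<Delta>) \<otimes> g'"
    using interchange[OF \<Delta> p[OF h(2,1)] i h(3)] comp_id[OF h(3)] tensor_mor_assoc[OF h(2,1,3)] by simp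
  also have "\<dots> = g' \<cdot> (\<epsilon> \<otimes> \<one> X)"
    using interchange[OF \<epsilon> id_hom[OF unit_ob] i h(3)] tensor_mor_unit(1)[OF h(3)] comp_id[OF h(3)]
      id_comp[OF \<epsilon>] fg by simp
  also have "(g' \<cdot> (\<epsilon> \<otimes> \<one> X)) \<cdot> \<Delta> = g'"
    using comp_assoc[OF \<Delta> t(5) h(3)] c(2) comp_id[OF h(3)] by simp
  finally show ?thesis .
qed

end

section \<open>Coherence of permutations\<close>

primrec word :: "('o, 'm) btc \<Rightarrow> ('s \<Rightarrow> 'o) \<Rightarrow> 's list \<Rightarrow> 'o" where
  "word C obj [] = unit_obj C"
| "word C obj (s # ss) = tensor_obj C (obj s) (word C obj ss)"

lemma word_map: "word C obj (map f ss) = word C (\<lambda>x. obj (f x)) ss"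
  by (induction ss) auto

locale symmetric_words = strict_braided_category \<C>
  for \<C> :: "('o, 'm) btc" (structure) +
  fixes obj :: "'s \<Rightarrow> 'o"
  assumes obj: "obj s \<in> Ob \<C>"
    and symmetric: "\<chi> (obj t) (obj s) \<cdot> \<chi> (obj s) (obj t) = \<one> (obj s \<odot> obj t)"
begin

abbreviation W :: "'s list \<Rightarrow> 'o" where "W \<equiv> word \<C> obj"
abbreviation ident :: "'s list \<Rightarrow> 'm" where "ident ss \<equiv> \<one> (W ss)"
abbreviation swap :: "'s list \<Rightarrow> 's list \<Rightarrow> 'm" where "swap ss ts \<equiv> \<chi> (W ss) (W ts)"

lemma W_ob [simp]: "W ss \<in> Ob \<C>"
  by (induction ss) (auto simp: unit_ob tensor_ob obj)

lemma W_append: "W (ss @ ts) = W ss \<odot> W ts"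
  by (induction ss) (auto simp: tensor_obj_unit tensor_obj_assoc obj)

lemma W_single [simp]: "obj s \<odot> \<I> = obj s"
  by (simp add: tensor_obj_unit obj)

definition arr :: "'m \<Rightarrow> 's list \<Rightarrow> 's list \<Rightarrow> bool" where
  "arr f ss ts \<longleftrightarrow> f \<in> Hom (W ss) (W ts)"

lemma arr_ident: "arr (ident ss) ss ss"
  by (simp add: arr_def id_hom)

lemma arr_comp: "arr f ss ts \<Longrightarrow> arr g ts us \<Longrightarrow> arr (g \<cdot> f) ss us"
  unfolding arr_def by (rule comp_hom)

lemma arr_tensor: "arr f ss ts \<Longrightarrow> arr g ss' ts' \<Longrightarrow> arr (f \<otimes> g) (ss @ ss') (ts @ ts')"
  unfolding arr_def W_append by (rule tensor_hom)

lemma arr_swap: "arr (swap ss ts) (ss @ ts) (ts @ ss)"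
  unfolding arr_def W_append using braiding_iso[OF W_ob W_ob]
  unfolding inverse_morphisms_def by blast

lemma ident_comp: "arr f ss ts \<Longrightarrow> ident ts \<cdot> f = f"
  and comp_ident: "arr f ss ts \<Longrightarrow> f \<cdot> ident ss = f"
  unfolding arr_def by (auto intro: id_comp comp_id)

lemma assoc:
  "arr f ss ts \<Longrightarrow> arr g ts us \<Longrightarrow> arr h us vs \<Longrightarrow> (h \<cdot> g) \<cdot> f = h \<cdot> (g \<cdot> f)"
  unfolding arr_def by (rule comp_assoc)

lemma tensor_assoc:
  "arr f ss ss' \<Longrightarrow> arr g ts ts' \<Longrightarrow> arr h us us' \<Longrightarrow> (f \<otimes> g) \<otimes> h = f \<otimes> (g \<otimes> h)"
  unfolding arr_def by (rule tensor_mor_assoc)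

lemma tensor_comp:
  "arr f ss ts \<Longrightarrow> arr g ts us \<Longrightarrow> arr f' ss' ts' \<Longrightarrow> arr g' ts' us' \<Longrightarrow>
   (g \<otimes> g') \<cdot> (f \<otimes> f') = (g \<cdot> f) \<otimes> (g' \<cdot> f')"
  unfolding arr_def by (rule interchange[symmetric])

lemma ident_append: "ident (ss @ ts) = ident ss \<otimes> ident ts"
  by (simp add: W_append tensor_id)

lemma ident_Cons: "ident (s # ts) = ident [s] \<otimes> ident ts"
  using ident_append[of "[s]" ts] by simp

lemma tensor_unit: "arr f ss ts \<Longrightarrow> \<one> \<I> \<otimes> f = f" "arr f ss ts \<Longrightarrow> f \<otimes> \<one> \<I> = f"
  unfolding arr_def by (auto intro: tensor_mor_unit)

lemma swap_natural:
  "arr f ss ss' \<Longrightarrow> arr g ts ts' \<Longrightarrow> swap ss' ts' \<cdot> (f \<otimes> g) = (g \<otimes> f) \<cdot> swap ss ts"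
  unfolding arr_def by (rule braiding_natural)

lemma swap_append_left:
  "swap (ss @ ts) us = (swap ss us \<otimes> ident ts) \<cdot> (ident ss \<otimes> swap ts us)"
  by (simp add: W_append hexagon_left)

lemma swap_append_right:
  "swap ss (ts @ us) = (ident ts \<otimes> swap ss us) \<cdot> (swap ss ts \<otimes> ident us)"
  by (simp add: W_append hexagon_right)

lemma whisker_left:
  "arr f ts us \<Longrightarrow> arr g us vs \<Longrightarrow>
   (ident ss \<otimes> g) \<cdot> (ident ss \<otimes> f) = ident ss \<otimes> (g \<cdot> f)"
  using tensor_comp[OF arr_ident arr_ident, of f ts us g vs ss] ident_comp[OF arr_ident] by simp

lemma whisker_right:
  "arr f ts us \<Longrightarrow> arr g us vs \<Longrightarrow>
   (g \<otimes> ident ss) \<cdot> (f \<otimes> ident ss) = (g \<cdot> f) \<otimes> ident ss"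
  using tensor_comp[OF _ _ arr_ident arr_ident, of f ts us g vs ss] ident_comp[OF arr_ident] by simp

lemma slide:
  assumes "arr f ss ts" "arr g us vs"
  shows "(ident ts \<otimes> g) \<cdot> (f \<otimes> ident us) = f \<otimes> g"
    and "(f \<otimes> ident vs) \<cdot> (ident ss \<otimes> g) = f \<otimes> g"
  using tensor_comp[OF assms(1) arr_ident arr_ident assms(2)]
    tensor_comp[OF arr_ident assms(1) assms(2) arr_ident]
    ident_comp[OF assms(1)] comp_ident[OF assms(1)] ident_comp[OF assms(2)] comp_ident[OF assms(2)]
  by simp_all

lemma swap_nil_right: "swap ss [] = ident ss"
  and swap_nil_left: "swap [] ss = ident ss"
  using braiding_unit[of "W ss"] by simp_all

lemma swap_swap_letters: "swap [t] [s] \<cdot> swap [s] [t] = ident [s, t]"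
  using symmetric[of t s] by simp

abbreviation cross :: "'s \<Rightarrow> 's \<Rightarrow> 's list \<Rightarrow> 'm" where
  "cross x y zs \<equiv> swap [x] [y] \<otimes> ident zs"

abbreviation beside :: "'s \<Rightarrow> 'm \<Rightarrow> 'm" where
  "beside x f \<equiv> ident [x] \<otimes> f"

lemma arr_cross: "arr (cross x y zs) (x # y # zs) (y # x # zs)"
  using arr_tensor[OF arr_swap[of "[x]" "[y]"] arr_ident[of zs]] by simp

lemma arr_beside: "arr f ss ts \<Longrightarrow> arr (beside x f) (x # ss) (x # ts)"
  using arr_tensor[OF arr_ident[of "[x]"]] by fastforce

lemma cross_natural:
  assumes "arr f ss ts"
  shows "beside y (beside x f) \<cdot> cross x y ss = cross x y ts \<cdot> beside x (beside y f)"
  using slide[OF arr_swap[of "[x]" "[y]"] assms]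
    tensor_assoc[OF arr_ident[of "[x]"] arr_ident[of "[y]"] assms]
    tensor_assoc[OF arr_ident[of "[y]"] arr_ident[of "[x]"] assms]
    ident_append[of "[x]" "[y]"] ident_append[of "[y]" "[x]"] by simp

lemma cross_cross: "cross y x zs \<cdot> cross x y zs = ident (x # y # zs)"
  using whisker_right[of "swap [x] [y]" "[x, y]" "[y, x]" "swap [y] [x]" "[x, y]" zs]
    arr_swap[of "[x]" "[y]"] arr_swap[of "[y]" "[x]"] swap_swap_letters ident_append[of "[x, y]" zs]
  by simp

lemma braid_relation:
  "cross y z (x # zs) \<cdot> (beside y (cross x z zs) \<cdot> cross x y (z # zs)) =
   beside z (cross x y zs) \<cdot> (cross x z (y # zs) \<cdot> beside x (cross y z zs))"
proof -
  let ?xy = "swap [x] [y]" and ?xz = "swap [x] [z]" and ?yz = "swap [y] [z]"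
  note sw = arr_swap[of "[x]" "[y]", simplified append.simps]
    arr_swap[of "[x]" "[z]", simplified append.simps] arr_swap[of "[y]" "[z]", simplified append.simps]
  have a: "arr (?yz \<otimes> ident [x]) [y, z, x] [z, y, x]" "arr (?xy \<otimes> ident [z]) [x, y, z] [y, x, z]"
    "arr (?xz \<otimes> ident [y]) [x, z, y] [z, x, y]" "arr (beside y ?xz) [y, x, z] [y, z, x]"
    "arr (beside z ?xy) [z, x, y] [z, y, x]" "arr (beside x ?yz) [x, y, z] [x, z, y]"
    using arr_cross[of y z "[x]"] arr_cross[of x y "[z]"] arr_cross[of x z "[y]"] sw[THEN arr_beside]
    by simp_all
  have "beside z ?xy \<cdot> ((?xz \<otimes> ident [y]) \<cdot> beside x ?yz)
      = (?yz \<otimes> ident [x]) \<cdot> (beside y ?xz \<cdot> (?xy \<otimes> ident [z]))"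
    using swap_natural[OF arr_ident[of "[x]"] arr_swap[of "[y]" "[z]"]]
      swap_append_right[of "[x]" "[z]" "[y]"] swap_append_right[of "[x]" "[y]" "[z]"] assoc[OF a(6,3,5)]
    by simp
  moreover have "cross p q (t # zs) = (swap [p] [q] \<otimes> ident [t]) \<otimes> ident zs"
    "beside t (cross p q zs) = beside t (swap [p] [q]) \<otimes> ident zs" for p q t
    using tensor_assoc[OF arr_swap[of "[p]" "[q]"] arr_ident[of "[t]"] arr_ident[of zs]] ident_Cons[of t zs]
      tensor_assoc[OF arr_ident[of "[t]"] arr_swap[of "[p]" "[q]"] arr_ident[of zs]] by simp_all
  ultimately show ?thesis
    using whisker_right[OF a(2,4), of zs] whisker_right[OF arr_comp[OF a(2,4)] a(1), of zs]
      whisker_right[OF a(6,3), of zs] whisker_right[OF arr_comp[OF a(6,3)] a(5), of zs] by simp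
qed

text \<open>
  Moves the first occurrence of \<open>y\<close> in a word to its front.
\<close>

primrec move :: "'s \<Rightarrow> 's list \<Rightarrow> 'm" where
  "move y [] = \<one> \<I>"
| "move y (x # xs) = (if x = y then ident (x # xs)
     else cross x y (remove1 y xs) \<cdot> beside x (move y xs))"

lemma arr_move: "y \<in> set xs \<Longrightarrow> arr (move y xs) xs (y # remove1 y xs)"
proof (induction xs)
  case (Cons x xs)
  then show ?case
    using arr_ident[of "x # xs"] arr_comp[OF arr_beside[OF Cons.IH, of x] arr_cross[of x y "remove1 y xs"]]
    by auto
qed simp

text \<open>
  Moving first \<open>y\<close> and then \<open>z\<close> to the front agrees, up to a swap, with the opposite order. When both lie
  behind the head of the word this is the braid relation.
\<close>

lemma move_move:
  assumes "y \<noteq> z" "y \<in> set xs" "z \<in> set xs"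
  shows "cross y z (remove1 z (remove1 y xs)) \<cdot> (beside y (move z (remove1 y xs)) \<cdot> move y xs)
       = beside z (move y (remove1 z xs)) \<cdot> move z xs"
  using assms
proof (induction xs)
  case (Cons x xs)
  consider "x = y" | "x = z" | "x \<noteq> y" "x \<noteq> z" by blast
  then show ?case
  proof cases
    case 1
    then have m: "arr (beside y (move z xs)) (y # xs) (y # z # remove1 z xs)"
      using Cons.prems arr_beside[OF arr_move[of z xs], of y] by simp
    have "beside z (ident (y # remove1 z xs)) = ident (z # y # remove1 z xs)"
      using ident_Cons by metis
    then show ?thesis
      using 1 Cons.prems comp_ident[OF m] ident_comp[OF arr_comp[OF m arr_cross]] by simp
  next
    case 2
    then have m: "arr (beside z (move y xs)) (z # xs) (z # y # remove1 y xs)"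
      using Cons.prems arr_beside[OF arr_move[of y xs], of z] by simp
    have "beside y (ident (z # remove1 y xs)) = ident (y # z # remove1 y xs)"
      using ident_Cons by metis
    then show ?thesis
      using 2 Cons.prems comp_ident[OF m] ident_comp[OF m] ident_comp[OF arr_comp[OF m arr_cross]]
        assoc[OF m arr_cross arr_cross] cross_cross[of y z "remove1 y xs"] by simp
  next
    case 3
    let ?y = "remove1 y xs" and ?z = "remove1 z xs" and ?r = "remove1 z (remove1 y xs)"
    have mem: "y \<in> set xs" "z \<in> set xs" "z \<in> set ?y" "y \<in> set ?z"
      using 3 Cons by auto
    have com: "remove1 y ?z = ?r" by (rule remove1_commute)
    note my = arr_move[OF mem(1)] and mz = arr_move[OF mem(2)]
    note mz' = arr_move[OF mem(3)] and my' = arr_move[OF mem(4), unfolded com]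
    let ?u = "beside y (move z ?y) \<cdot> move y xs" and ?v = "beside z (move y ?z) \<cdot> move z xs"
    note u = arr_comp[OF my arr_beside[OF mz', of y]] and v = arr_comp[OF mz arr_beside[OF my', of z]]
    note xu = arr_beside[OF u, of x] and xv = arr_beside[OF v, of x]
    have IH: "cross y z ?r \<cdot> ?u = ?v" using Cons mem by auto
    \<comment> \<open>Both sides become a braid on three strands after \<open>y\<close> and \<open>z\<close> have left \<open>xs\<close>.\<close>
    have left: "beside y (cross x z ?r \<cdot> beside x (move z ?y)) \<cdot> (cross x y ?y \<cdot> beside x (move y xs))
      = (beside y (cross x z ?r) \<cdot> cross x y (z # ?r)) \<cdot> beside x ?u"
      using whisker_left[OF arr_beside[OF mz', of x] arr_cross, of "[y]"] cross_natural[OF mz', of y x]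
        whisker_left[OF my arr_beside[OF mz'], of "[x]"]
        assoc[OF arr_beside[OF my, of x] arr_cross arr_beside[OF arr_beside[OF mz']]]
        assoc[OF arr_beside[OF my, of x] arr_beside[OF arr_beside[OF mz']] arr_cross]
        assoc[OF arr_comp[OF arr_beside[OF my, of x] arr_cross] arr_beside[OF arr_beside[OF mz']]
          arr_beside[OF arr_cross]]
        assoc[OF xu arr_cross arr_beside[OF arr_cross]] by simp
    have right: "beside z (cross x y ?r \<cdot> beside x (move y ?z)) \<cdot> (cross x z ?z \<cdot> beside x (move z xs))
      = (beside z (cross x y ?r) \<cdot> cross x z (y # ?r)) \<cdot> beside x ?v"
      using whisker_left[OF arr_beside[OF my', of x] arr_cross, of "[z]"] cross_natural[OF my', of z x]
        whisker_left[OF mz arr_beside[OF my'], of "[x]"]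
        assoc[OF arr_beside[OF mz, of x] arr_cross arr_beside[OF arr_beside[OF my']]]
        assoc[OF arr_beside[OF mz, of x] arr_beside[OF arr_beside[OF my']] arr_cross]
        assoc[OF arr_comp[OF arr_beside[OF mz, of x] arr_cross] arr_beside[OF arr_beside[OF my']]
          arr_beside[OF arr_cross]]
        assoc[OF xv arr_cross arr_beside[OF arr_cross]] by simp
    have "cross y z (x # ?r) \<cdot> ((beside y (cross x z ?r) \<cdot> cross x y (z # ?r)) \<cdot> beside x ?u)
      = (beside z (cross x y ?r) \<cdot> (cross x z (y # ?r) \<cdot> beside x (cross y z ?r))) \<cdot> beside x ?u"
      using assoc[OF xu arr_comp[OF arr_cross arr_beside[OF arr_cross]] arr_cross]
        braid_relation[of y z x ?r] by simp
    also have "\<dots> = (beside z (cross x y ?r) \<cdot> cross x z (y # ?r)) \<cdot> beside x ?v"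
      using assoc[OF xu arr_comp[OF arr_beside[OF arr_cross] arr_cross] arr_beside[OF arr_cross]]
        assoc[OF xu arr_beside[OF arr_cross] arr_cross] whisker_left[OF u arr_cross, of "[x]"] IH
        assoc[OF xv arr_cross arr_beside[OF arr_cross]] by simp
    finally show ?thesis using left right 3 com by simp
  qed
qed simp

end

section \<open>Networks of boxes on named wires\<close>

text \<open>
  A box \<open>(p, is, os)\<close> consumes the wires \<open>is\<close> and creates the wires \<open>os\<close>. Every name is created at most once, by
  a box or as an input of the network, and consumed at most once.
\<close>

type_synonym ('p, 'w) box = "'p \<times> 'w list \<times> 'w list"

definition without :: "'w list \<Rightarrow> 'w list \<Rightarrow> 'w list" (infixl "\<ominus>" 75) where
  "xs \<ominus> ys = filter (\<lambda>x. x \<notin> set ys) xs"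

fun outs :: "('p, 'w) box list \<Rightarrow> 'w list" where
  "outs [] = []"
| "outs ((p, is, os) # N) = os @ outs N"

lemma outs_append [simp]: "outs (M @ N) = outs M @ outs N"
  by (induction M rule: outs.induct) auto

fun ren :: "('w \<Rightarrow> 'w) \<Rightarrow> ('p, 'w) box \<Rightarrow> ('p, 'w) box" where
  "ren f (p, is, os) = (p, map f is, map f os)"

definition rearr :: "'w list \<Rightarrow> 'w list \<Rightarrow> bool" where
  "rearr xs ys \<longleftrightarrow> distinct xs \<and> distinct ys \<and> set xs = set ys"

lemma set_without [simp]: "set (xs \<ominus> ys) = set xs - set ys"
  by (auto simp: without_def)

lemma distinct_without [simp]: "distinct xs \<Longrightarrow> distinct (xs \<ominus> ys)"
  by (simp add: without_def)

lemma append_without: "(xs @ ys) \<ominus> zs = (xs \<ominus> zs) @ (ys \<ominus> zs)"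
  by (simp add: without_def)

lemma without_disjoint: "set xs \<inter> set ys = {} \<Longrightarrow> xs \<ominus> ys = xs"
  by (auto simp: without_def filter_id_conv)

lemma without_self: "set xs \<subseteq> set ys \<Longrightarrow> xs \<ominus> ys = []"
  by (auto simp: without_def filter_empty_conv)

context symmetric_words
begin

text \<open>
  On words without repetition, \<open>perm xs ys\<close> is the symmetry that rearranges \<open>xs\<close> into \<open>ys\<close>. Letters are
  names, so source and target determine the permutation; coherence is \<open>perm_perm\<close>.
\<close>

primrec perm :: "'s list \<Rightarrow> 's list \<Rightarrow> 'm" where
  "perm xs [] = \<one> \<I>"
| "perm xs (y # ys) = (ident [y] \<otimes> perm (remove1 y xs) ys) \<cdot> move y xs"

lemma rearr_remove1: "rearr xs ys \<Longrightarrow> rearr (remove1 z xs) (remove1 z ys)"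
  by (auto simp: rearr_def distinct_remove1)

lemma rearr_Cons: "rearr xs (y # ys) \<Longrightarrow> rearr (remove1 y xs) ys"
  using rearr_remove1[of xs "y # ys" y] by simp

lemma arr_perm: "rearr xs ys \<Longrightarrow> arr (perm xs ys) xs ys"
proof (induction ys arbitrary: xs)
  case Nil then show ?case using arr_ident[of "[]"] by (simp add: rearr_def)
next
  case (Cons y ys)
  have "arr (ident [y] \<otimes> perm (remove1 y xs) ys) (y # remove1 y xs) (y # ys)"
    using arr_tensor[OF arr_ident[of "[y]"] Cons.IH[OF rearr_Cons[OF Cons.prems]]] by simp
  moreover have "y \<in> set xs" using Cons.prems by (simp add: rearr_def)
  ultimately show ?case using arr_comp[OF arr_move] by simp
qed

lemma move_perm:
  "rearr xs ys \<Longrightarrow> z \<in> set ys \<Longrightarrow>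
   move z ys \<cdot> perm xs ys = (ident [z] \<otimes> perm (remove1 z xs) (remove1 z ys)) \<cdot> move z xs"
proof (induction ys arbitrary: xs)
  case (Cons y ys)
  have r: "rearr (remove1 y xs) ys" using rearr_Cons[OF Cons.prems(1)] .
  have mem: "y \<in> set xs" "z \<in> set xs" using Cons.prems by (auto simp: rearr_def)
  show ?case
  proof (cases "y = z")
    case True
    then show ?thesis using ident_comp[OF arr_perm[OF Cons.prems(1)]] by simp
  next
    case False
    then have z: "z \<in> set ys" using Cons.prems by simp
    let ?xs = "remove1 y xs" and ?x = "remove1 z (remove1 y xs)" and ?y = "remove1 z ys"
    have rr: "rearr ?x ?y" using rearr_remove1[OF r] .
    have zx: "z \<in> set ?xs" using mem False by auto
    note p = arr_perm[OF r] and q = arr_perm[OF rr] and m = arr_move[OF z] and m' = arr_move[OF zx]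
    note y = arr_move[OF mem(1)]
    note a = arr_beside[OF p, of y] and b = arr_beside[OF m, of y] and d = arr_beside[OF m', of y]
    note qq = arr_beside[OF arr_beside[OF q]]
    have yx: "arr (move y (remove1 z xs)) (remove1 z xs) (y # ?x)"
      using arr_move[of y "remove1 z xs"] mem False by (simp add: remove1_commute)
    have "move z (y # ys) \<cdot> perm xs (y # ys) =
        cross y z ?y \<cdot> (beside y (move z ys \<cdot> perm ?xs ys) \<cdot> move y xs)"
      using False assoc[OF arr_comp[OF y a] b arr_cross] assoc[OF y a b] whisker_left[OF p m, of "[y]"]
      by simp
    also have "\<dots> = cross y z ?y \<cdot> (beside y (beside z (perm ?x ?y)) \<cdot> (beside y (move z ?xs) \<cdot> move y xs))"
      using Cons.IH[OF r z] whisker_left[OF m' arr_beside[OF q], of "[y]"] assoc[OF y d qq] by simp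
    also have "\<dots> = beside z (beside y (perm ?x ?y)) \<cdot> (cross y z ?x \<cdot> (beside y (move z ?xs) \<cdot> move y xs))"
      using cross_natural[OF q, of z y] assoc[OF arr_comp[OF y d] qq arr_cross]
        assoc[OF arr_comp[OF y d] arr_cross qq] by simp
    also have "\<dots> = beside z (beside y (perm ?x ?y)) \<cdot> (beside z (move y (remove1 z xs)) \<cdot> move z xs)"
      using move_move[OF False mem] by simp
    also have "\<dots> = (ident [z] \<otimes> perm (remove1 z xs) (remove1 z (y # ys))) \<cdot> move z xs"
      using False assoc[OF arr_move[OF mem(2)] arr_beside[OF yx] qq] whisker_left[OF yx arr_beside[OF q], of "[z]"]
      by (simp add: remove1_commute)
    finally show ?thesis .
  qed
qed simp

lemma perm_perm: "rearr xs ys \<Longrightarrow> rearr ys zs \<Longrightarrow> perm ys zs \<cdot> perm xs ys = perm xs zs"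
proof (induction zs arbitrary: xs ys)
  case Nil then show ?case using ident_comp[OF arr_ident[of "[]"]] by (simp add: rearr_def)
next
  case (Cons z zs)
  have z: "z \<in> set ys" "z \<in> set xs" using Cons.prems by (auto simp: rearr_def)
  note r = rearr_remove1[OF Cons.prems(1), of z] and s = rearr_Cons[OF Cons.prems(2)]
  have a: "arr (ident [z] \<otimes> perm (remove1 z ys) zs) (z # remove1 z ys) (z # zs)"
    using arr_tensor[OF arr_ident[of "[z]"] arr_perm[OF s]] by simp
  have b: "arr (ident [z] \<otimes> perm (remove1 z xs) (remove1 z ys)) (z # remove1 z xs) (z # remove1 z ys)"
    using arr_tensor[OF arr_ident[of "[z]"] arr_perm[OF r]] by simp
  show ?case
    using assoc[OF arr_perm[OF Cons.prems(1)] arr_move[OF z(1)] a] move_perm[OF Cons.prems(1) z(1)]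
      assoc[OF arr_move[OF z(2)] b a] whisker_left[OF arr_perm[OF r] arr_perm[OF s], of "[z]"]
      Cons.IH[OF r s] by simp
qed

lemma perm_append_left: "perm (zs @ xs) (zs @ ys) = ident zs \<otimes> perm xs ys" if "rearr xs ys"
proof (induction zs)
  case Nil then show ?case using tensor_unit[OF arr_perm[OF that]] by simp
next
  case (Cons z zs)
  have "arr (ident [z] \<otimes> (ident zs \<otimes> perm xs ys)) (z # zs @ xs) (z # zs @ ys)"
    using arr_tensor[OF arr_ident[of "[z]"] arr_tensor[OF arr_ident[of zs] arr_perm[OF that]]] by simp
  then show ?case
    using Cons comp_ident tensor_assoc[OF arr_ident[of "[z]"] arr_ident[of zs] arr_perm[OF that]]
      ident_Cons[of z zs] by fastforce
qed

lemma perm_self: "distinct xs \<Longrightarrow> perm xs xs = ident xs"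
proof -
  have "arr (ident xs \<otimes> \<one> \<I>) xs xs" using arr_tensor[OF arr_ident[of xs] arr_ident[of "[]"]] by simp
  then show ?thesis
    using perm_append_left[of "[]" "[]" xs] tensor_unit(2)[OF arr_ident[of xs]] by (simp add: rearr_def)
qed

lemma move_append: "y \<in> set xs \<Longrightarrow> move y (xs @ zs) = move y xs \<otimes> ident zs"
proof (induction xs)
  case (Cons x xs)
  show ?case
  proof (cases "x = y")
    case True then show ?thesis using ident_append[of "x # xs" zs] by simp
  next
    case False
    then have y: "y \<in> set xs" using Cons by simp
    let ?r = "remove1 y xs"
    note m = arr_move[OF y]
    have a: "arr (ident [x] \<otimes> move y xs) (x # xs) (x # y # ?r)"
      using arr_tensor[OF arr_ident[of "[x]"] m] by simp
    have b: "arr (swap [x] [y] \<otimes> ident ?r) (x # y # ?r) (y # x # ?r)"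
      using arr_tensor[OF arr_swap[of "[x]" "[y]"] arr_ident[of ?r]] by simp
    show ?thesis
      using False y Cons.IH[OF y] whisker_right[OF a b, of zs] ident_append[of ?r zs]
        tensor_assoc[OF arr_ident[of "[x]"] m arr_ident[of zs]]
        tensor_assoc[OF arr_swap[of "[x]" "[y]"] arr_ident[of ?r] arr_ident[of zs]]
      by (simp add: remove1_append)
  qed
qed simp

lemma perm_append_right:
  "rearr xs ys \<Longrightarrow> distinct zs \<Longrightarrow> set xs \<inter> set zs = {} \<Longrightarrow> perm (xs @ zs) (ys @ zs) = perm xs ys \<otimes> ident zs"
proof (induction ys arbitrary: xs)
  case Nil then show ?case using perm_self tensor_unit[OF arr_ident[of zs]] by (simp add: rearr_def)
next
  case (Cons y ys)
  have y: "y \<in> set xs" using Cons.prems by (simp add: rearr_def)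
  note r = rearr_Cons[OF Cons.prems(1)]
  have a: "arr (ident [y] \<otimes> perm (remove1 y xs) ys) (y # remove1 y xs) (y # ys)"
    using arr_tensor[OF arr_ident[of "[y]"] arr_perm[OF r]] by simp
  have "perm (remove1 y (xs @ zs)) (ys @ zs) = perm (remove1 y xs) ys \<otimes> ident zs"
    using Cons.IH[OF r] Cons.prems y by (auto simp: remove1_append rearr_def)
  then show ?case
    using y move_append[OF y, of zs] whisker_right[OF arr_move[OF y] a, of zs]
      tensor_assoc[OF arr_ident[of "[y]"] arr_perm[OF r] arr_ident[of zs]] by simp
qed

lemma move_past: "y \<notin> set xs \<Longrightarrow> move y (xs @ y # ys) = swap xs [y] \<otimes> ident ys"
proof (induction xs)
  case Nil then show ?case using swap_nil_left[of "[y]"] ident_Cons[of y ys] by simp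
next
  case (Cons x xs)
  have s: "arr (swap xs [y]) (xs @ [y]) (y # xs)" using arr_swap[of xs "[y]"] by simp
  have a: "arr (ident [x] \<otimes> swap xs [y]) (x # xs @ [y]) (x # y # xs)"
    using arr_tensor[OF arr_ident[of "[x]"] s] by simp
  have b: "arr (swap [x] [y] \<otimes> ident xs) (x # y # xs) (y # x # xs)"
    using arr_tensor[OF arr_swap[of "[x]" "[y]"] arr_ident[of xs]] by simp
  have "x \<noteq> y" "y \<notin> set xs" using Cons.prems by auto
  moreover have "swap (x # xs) [y] = (swap [x] [y] \<otimes> ident xs) \<cdot> (ident [x] \<otimes> swap xs [y])"
    using swap_append_left[of "[x]" xs "[y]"] by simp
  ultimately show ?case
    using Cons.IH whisker_right[OF a b, of ys] tensor_assoc[OF arr_ident[of "[x]"] s arr_ident[of ys]]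
      tensor_assoc[OF arr_swap[of "[x]" "[y]"] arr_ident[of xs] arr_ident[of ys]] ident_append[of xs ys]
    by (simp add: remove1_append)
qed

lemma perm_swap: "distinct (xs @ ys) \<Longrightarrow> perm (xs @ ys) (ys @ xs) = swap xs ys"
proof (induction ys)
  case Nil then show ?case using swap_nil_right perm_self by simp
next
  case (Cons y ys)
  then have IH: "perm (xs @ ys) (ys @ xs) = swap xs ys" and y: "y \<notin> set xs" by auto
  have "swap xs (y # ys) = (ident [y] \<otimes> swap xs ys) \<cdot> (swap xs [y] \<otimes> ident ys)"
    using swap_append_right[of xs "[y]" ys] by simp
  then show ?case using IH y move_past[OF y, of ys] by (simp add: remove1_append)
qed

lemma swap_swap: "distinct (xs @ ys) \<Longrightarrow> swap ys xs \<cdot> swap xs ys = ident (xs @ ys)"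
  using perm_perm[of "xs @ ys" "ys @ xs" "xs @ ys"] perm_swap[of xs ys] perm_swap[of ys xs]
    perm_self[of "xs @ ys"] by (auto simp: rearr_def)

lemma move_map:
  "inj_on f (insert y (set xs)) \<Longrightarrow> (\<And>x. x \<in> insert y (set xs) \<Longrightarrow> obj (f x) = obj x) \<Longrightarrow>
   move (f y) (map f xs) = move y xs"
proof (induction xs)
  case (Cons x xs)
  have W: "W (map f zs) = W zs" if "set zs \<subseteq> set (x # xs)" for zs
    using that Cons.prems(2) by (induction zs) auto
  have "remove1 (f y) (map f xs) = map f (remove1 y xs)"
    using Cons.prems(1) by (induction xs) (auto simp: inj_on_def)
  moreover have "move (f y) (map f xs) = move y xs"
    using Cons.prems by (intro Cons.IH) (auto simp: inj_on_def)
  moreover have "f x = f y \<longleftrightarrow> x = y" using Cons.prems(1) by (auto simp: inj_on_def)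
  moreover have "obj (f x) = obj x" "obj (f y) = obj y" using Cons.prems(2) by auto
  moreover have "W (map f (remove1 y xs)) = W (remove1 y xs)" "W (map f xs) = W xs"
    using W set_remove1_subset[of y xs] by (auto intro!: W)
  ultimately show ?case by simp
qed simp

lemma perm_map:
  "rearr xs ys \<Longrightarrow> inj_on f (set xs) \<Longrightarrow> (\<And>x. x \<in> set xs \<Longrightarrow> obj (f x) = obj x) \<Longrightarrow>
   perm (map f xs) (map f ys) = perm xs ys"
proof (induction ys arbitrary: xs)
  case (Cons y ys)
  have y: "y \<in> set xs" using Cons.prems by (simp add: rearr_def)
  have "remove1 (f y) (map f xs) = map f (remove1 y xs)"
    using Cons.prems(2) y
  proof (induction xs)
    case (Cons x xs) then show ?case
      by (cases "y \<in> set xs") (auto simp: inj_on_def remove1_idem)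
  qed simp
  moreover have "perm (map f (remove1 y xs)) (map f ys) = perm (remove1 y xs) ys"
    using Cons.prems set_remove1_subset[of y xs]
    by (intro Cons.IH rearr_Cons) (auto simp: inj_on_def)
  moreover have "move (f y) (map f xs) = move y xs"
    using Cons.prems y by (intro move_map) (auto simp: insert_absorb)
  ultimately show ?case using Cons.prems(3) y by simp
qed simp

end

locale networks = symmetric_words \<C> obj
  for \<C> :: "('o, 'm) btc" (structure) and obj :: "'w \<Rightarrow> 'o" +
  fixes mor :: "'p \<Rightarrow> 'm"
begin

text \<open>
  The boxes fire one after the other on a list \<open>xs\<close> of wires. Before a box fires, its inputs are moved to the
  front of the current list; the remaining wires pass by. At the end the wires are arranged as \<open>ys\<close>.
\<close>

fun ok :: "'w list \<Rightarrow> ('p, 'w) box list \<Rightarrow> 'w list \<Rightarrow> bool" where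
  "ok xs [] ys \<longleftrightarrow> rearr xs ys"
| "ok xs ((p, is, os) # N) ys \<longleftrightarrow> distinct xs \<and> distinct is \<and> set is \<subseteq> set xs \<and>
     arr (mor p) is os \<and> ok (os @ xs \<ominus> is) N ys"

fun sem :: "'w list \<Rightarrow> ('p, 'w) box list \<Rightarrow> 'w list \<Rightarrow> 'm" where
  "sem xs [] ys = perm xs ys"
| "sem xs ((p, is, os) # N) ys =
     sem (os @ xs \<ominus> is) N ys \<cdot> ((mor p \<otimes> ident (xs \<ominus> is)) \<cdot> perm xs (is @ xs \<ominus> is))"

lemma ok_distinct: "ok xs N ys \<Longrightarrow> distinct xs \<and> distinct ys"
  by (induction xs N ys rule: ok.induct) (auto simp: rearr_def)

lemma rearr_without: "distinct xs \<Longrightarrow> distinct is \<Longrightarrow> set is \<subseteq> set xs \<Longrightarrow> rearr xs (is @ xs \<ominus> is)"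
  by (auto simp: rearr_def)

lemma arr_box: 
  assumes "distinct xs" "distinct is" "set is \<subseteq> set xs" "arr (mor p) is os"
  shows "arr (mor p \<otimes> ident (xs \<ominus> is)) (is @ xs \<ominus> is) (os @ xs \<ominus> is)"
    and "arr ((mor p \<otimes> ident (xs \<ominus> is)) \<cdot> perm xs (is @ xs \<ominus> is)) xs (os @ xs \<ominus> is)"
proof -
  show *: "arr (mor p \<otimes> ident (xs \<ominus> is)) (is @ xs \<ominus> is) (os @ xs \<ominus> is)"
    using assms(4) arr_ident by (rule arr_tensor)
  show "arr ((mor p \<otimes> ident (xs \<ominus> is)) \<cdot> perm xs (is @ xs \<ominus> is)) xs (os @ xs \<ominus> is)"
    using arr_perm[OF rearr_without[OF assms(1-3)]] * by (rule arr_comp)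
qed

lemma arr_sem: "ok xs N ys \<Longrightarrow> arr (sem xs N ys) xs ys"
proof (induction xs N ys rule: ok.induct)
  case (2 xs p "is" os N ys)
  then show ?case using arr_comp[OF arr_box(2)[of xs "is" p os]] by simp
qed (simp add: arr_perm)

lemma ok_rearr: "ok xs N ys \<Longrightarrow> rearr xs' xs \<Longrightarrow> ok xs' N ys"
proof (induction xs N ys arbitrary: xs' rule: ok.induct)
  case (1 xs ys) then show ?case by (auto simp: rearr_def)
next
  case (2 xs p "is" os N ys)
  have "distinct (os @ xs \<ominus> is)" using 2 ok_distinct by fastforce
  then have "rearr (os @ xs' \<ominus> is) (os @ xs \<ominus> is)" using 2 by (auto simp: rearr_def)
  then show ?case using 2 by (auto simp: rearr_def)
qed

text \<open>
  The arrangement of the incoming wires does not matter.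
\<close>

lemma sem_rearr: "ok xs N ys \<Longrightarrow> rearr xs' xs \<Longrightarrow> sem xs N ys \<cdot> perm xs' xs = sem xs' N ys"
proof (induction xs N ys arbitrary: xs' rule: ok.induct)
  case (1 xs ys) then show ?case using perm_perm by simp
next
  case (2 xs p "is" os N ys)
  let ?r = "xs \<ominus> is" and ?r' = "xs' \<ominus> is"
  have d: "distinct (os @ ?r)" using 2 ok_distinct by fastforce
  have rr: "rearr ?r' ?r" and ro: "rearr (os @ ?r') (os @ ?r)" using 2 d by (auto simp: rearr_def)
  have ok': "ok (os @ ?r) N ys" and p: "arr (mor p) is os" using 2 by auto
  have x: "rearr xs (is @ ?r)" "rearr xs' (is @ ?r')" "rearr (is @ ?r') (is @ ?r)"
    using 2 rearr_without by (auto simp: rearr_def)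
  have x': "rearr xs' xs" using 2 by simp
  have b: "arr (mor p \<otimes> ident ?r) (is @ ?r) (os @ ?r)"
    "arr (mor p \<otimes> ident ?r') (is @ ?r') (os @ ?r')"
    using arr_tensor[OF p arr_ident] by auto
  have e: "(mor p \<otimes> ident ?r) \<cdot> perm (is @ ?r') (is @ ?r) = perm (os @ ?r') (os @ ?r) \<cdot> (mor p \<otimes> ident ?r')"
    using perm_append_left[OF rr] slide[OF p arr_perm[OF rr]] by simp
  have "((mor p \<otimes> ident ?r) \<cdot> perm xs (is @ ?r)) \<cdot> perm xs' xs
      = (mor p \<otimes> ident ?r) \<cdot> (perm (is @ ?r') (is @ ?r) \<cdot> perm xs' (is @ ?r'))"
    using assoc[OF arr_perm[OF x'] arr_perm[OF x(1)] b(1)] perm_perm[OF x' x(1)] perm_perm[OF x(2,3)]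
    by simp
  also have "\<dots> = perm (os @ ?r') (os @ ?r) \<cdot> ((mor p \<otimes> ident ?r') \<cdot> perm xs' (is @ ?r'))"
    using assoc[OF arr_perm[OF x(2)] arr_perm[OF x(3)] b(1)] e
      assoc[OF arr_perm[OF x(2)] b(2) arr_perm[OF ro]] by simp
  finally show ?case
    using 2(1)[OF ok' ro] arr_sem[OF ok']
      assoc[OF arr_perm[OF x'] arr_comp[OF arr_perm[OF x(1)] b(1)] arr_sem[OF ok']]
      assoc[OF arr_comp[OF arr_perm[OF x(2)] b(2)] arr_perm[OF ro] arr_sem[OF ok']] by simp
qed

lemma ok_frame:
  "ok xs N ys \<Longrightarrow> distinct zs \<Longrightarrow> set zs \<inter> (set xs \<union> set (outs N)) = {} \<Longrightarrow> ok (xs @ zs) N (ys @ zs)"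
proof (induction xs N ys rule: ok.induct)
  case (1 xs ys) then show ?case by (auto simp: rearr_def)
next
  case (2 xs p "is" os N ys)
  then have "zs \<ominus> is = zs" using without_disjoint[of zs "is"] by auto
  with 2 show ?case by (auto simp: append_without)
qed

text \<open>
  Wires unknown to a network pass by it on the right.
\<close>

lemma sem_frame:
  "ok xs N ys \<Longrightarrow> distinct zs \<Longrightarrow> set zs \<inter> (set xs \<union> set (outs N)) = {} \<Longrightarrow>
   sem (xs @ zs) N (ys @ zs) = sem xs N ys \<otimes> ident zs"
proof (induction xs N ys rule: ok.induct)
  case (1 xs ys) then show ?case using perm_append_right[of xs ys zs] by auto
next
  case (2 xs p "is" os N ys)
  let ?r = "xs \<ominus> is"
  have z: "(xs @ zs) \<ominus> is = ?r @ zs" using 2 without_disjoint[of zs "is"] by (auto simp: append_without)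
  have x: "rearr xs (is @ ?r)" using 2 rearr_without by auto
  have b: "arr (mor p \<otimes> ident ?r) (is @ ?r) (os @ ?r)"
    using arr_tensor[of "mor p" "is" os, OF _ arr_ident] 2 by auto
  have ok': "ok (os @ ?r) N ys" and p: "arr (mor p) is os" using 2 by auto
  have IH: "sem (os @ ?r @ zs) N (ys @ zs) = sem (os @ ?r) N ys \<otimes> ident zs"
    using 2(1)[OF ok' 2(3)] 2(4) by auto
  have i: "mor p \<otimes> ident (?r @ zs) = (mor p \<otimes> ident ?r) \<otimes> ident zs"
    using tensor_assoc[OF p arr_ident[of ?r] arr_ident[of zs]] ident_append[of ?r zs] by simp
  have q: "perm (xs @ zs) (is @ ?r @ zs) = perm xs (is @ ?r) \<otimes> ident zs"
    using perm_append_right[OF x 2(3)] 2(4) by auto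
  show ?case
    using z IH i q whisker_right[OF arr_perm[OF x] b, of zs]
      whisker_right[OF arr_comp[OF arr_perm[OF x] b] arr_sem[OF ok'], of zs] by simp
qed

lemma ok_append: "ok xs M zs \<Longrightarrow> ok zs N ys \<Longrightarrow> ok xs (M @ N) ys"
  by (induction xs M zs rule: ok.induct) (auto intro: ok_rearr)

lemma sem_append: "ok xs M zs \<Longrightarrow> ok zs N ys \<Longrightarrow> sem xs (M @ N) ys = sem zs N ys \<cdot> sem xs M zs"
proof (induction xs M zs rule: ok.induct)
  case (1 xs zs) then show ?case using sem_rearr by simp
next
  case (2 xs p "is" os M zs)
  then show ?case
    using assoc[OF arr_box(2)[of xs "is" p os] arr_sem[of "os @ xs \<ominus> is" M zs] arr_sem[OF 2(3)]]
    by simp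
qed

lemma ok_left:
  assumes "ok xs N ys" "distinct zs" "set zs \<inter> (set xs \<union> set (outs N) \<union> set ys) = {}"
  shows "ok (zs @ xs) N (zs @ ys)"
proof -
  have "ok (zs @ xs) N (ys @ zs)"
    using assms ok_distinct[OF assms(1)]
    by (intro ok_rearr[OF ok_frame[OF assms(1,2)]]) (auto simp: rearr_def)
  then have "ok (zs @ xs) (N @ []) (zs @ ys)"
    using assms ok_distinct[OF assms(1)] by (elim ok_append) (auto simp: rearr_def)
  then show ?thesis by simp
qed

text \<open>
  By naturality of the symmetry they may as well pass by on the left.
\<close>

lemma sem_left:
  assumes "ok xs N ys" "distinct zs" "set zs \<inter> (set xs \<union> set (outs N) \<union> set ys) = {}"
  shows "sem (zs @ xs) N (zs @ ys) = ident zs \<otimes> sem xs N ys"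
proof -
  note d = ok_distinct[OF assms(1)]
  have f: "ok (xs @ zs) N (ys @ zs)" using assms by (intro ok_frame) auto
  have r: "rearr (zs @ xs) (xs @ zs)" and r': "rearr (ys @ zs) (zs @ ys)"
    using assms d by (auto simp: rearr_def)
  have s: "arr (sem xs N ys \<otimes> ident zs) (xs @ zs) (ys @ zs)"
    using arr_tensor[OF arr_sem[OF assms(1)] arr_ident] .
  have t: "arr (ident zs \<otimes> sem xs N ys) (zs @ xs) (zs @ ys)"
    using arr_tensor[OF arr_ident arr_sem[OF assms(1)]] .
  have dis: "set zs \<inter> (set xs \<union> set (outs N)) = {}" "distinct (zs @ xs)" "distinct (ys @ zs)"
    using assms d by auto
  have "sem (zs @ xs) N (zs @ ys) = perm (ys @ zs) (zs @ ys) \<cdot> sem (zs @ xs) N (ys @ zs)"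
    using sem_append[OF ok_rearr[OF f r], of "[]" "zs @ ys"] r' by simp
  also have "\<dots> = swap ys zs \<cdot> ((sem xs N ys \<otimes> ident zs) \<cdot> swap zs xs)"
    using sem_rearr[OF f r] sem_frame[OF assms(1,2) dis(1)] perm_swap[OF dis(2)] perm_swap[OF dis(3)]
    by simp
  also have "\<dots> = (ident zs \<otimes> sem xs N ys) \<cdot> (swap xs zs \<cdot> swap zs xs)"
    using swap_natural[OF arr_sem[OF assms(1)] arr_ident[of zs]]
      assoc[OF arr_swap s arr_swap] assoc[OF arr_swap arr_swap t] by simp
  also have "\<dots> = ident zs \<otimes> sem xs N ys"
    using swap_swap[OF dis(2)] comp_ident[OF t] by simp
  finally show ?thesis .
qed

lemma sem_par:
  assumes "ok xs M ys" "ok xs' N ys'" "set (xs @ outs M @ ys) \<inter> set (xs' @ outs N @ ys') = {}"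
  shows "ok (xs @ xs') (M @ N) (ys @ ys')"
    and "sem (xs @ xs') (M @ N) (ys @ ys') = sem xs M ys \<otimes> sem xs' N ys'"
proof -
  note d = ok_distinct[OF assms(1)] ok_distinct[OF assms(2)]
  have a: "ok (xs @ xs') M (ys @ xs')" using assms d by (intro ok_frame) auto
  have b: "ok (ys @ xs') N (ys @ ys')" using assms d by (intro ok_left) auto
  show "ok (xs @ xs') (M @ N) (ys @ ys')" using ok_append[OF a b] .
  have "sem (xs @ xs') M (ys @ xs') = sem xs M ys \<otimes> ident xs'"
    "sem (ys @ xs') N (ys @ ys') = ident ys \<otimes> sem xs' N ys'"
    using assms d by (auto intro!: sem_frame sem_left)
  then show "sem (xs @ xs') (M @ N) (ys @ ys') = sem xs M ys \<otimes> sem xs' N ys'"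
    using sem_append[OF a b] slide[OF arr_sem[OF assms(1)] arr_sem[OF assms(2)]] by simp
qed

lemma sem_single:
  assumes "distinct xs" "distinct ys" "arr (mor p) xs ys"
  shows "ok xs [(p, xs, ys)] ys" "sem xs [(p, xs, ys)] ys = mor p"
  using assms perm_self[of xs] perm_self[of ys] without_self[of xs xs] tensor_unit[OF assms(3)]
    comp_ident[OF assms(3)] ident_comp[OF assms(3)]
  by (auto simp: rearr_def)

lemma sem_middle:
  assumes "distinct (ls @ is @ rs)" "distinct (ls @ os @ rs)" "arr (mor p) is os"
  shows "ok (ls @ is @ rs) [(p, is, os)] (ls @ os @ rs)"
    and "sem (ls @ is @ rs) [(p, is, os)] (ls @ os @ rs) = ident ls \<otimes> (mor p \<otimes> ident rs)"
proof -
  have s: "ok is [(p, is, os)] os" "sem is [(p, is, os)] os = mor p"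
    using assms sem_single by auto
  have f: "ok (is @ rs) [(p, is, os)] (os @ rs)" "sem (is @ rs) [(p, is, os)] (os @ rs) = mor p \<otimes> ident rs"
    using assms s ok_frame[OF s(1), of rs] sem_frame[OF s(1), of rs] by auto
  show "ok (ls @ is @ rs) [(p, is, os)] (ls @ os @ rs)"
    "sem (ls @ is @ rs) [(p, is, os)] (ls @ os @ rs) = ident ls \<otimes> (mor p \<otimes> ident rs)"
    using assms f(2) ok_left[OF f(1), of ls] sem_left[OF f(1), of ls]
    by (auto simp del: ok.simps sem.simps)
qed

text \<open>Boxes that are both ready to fire may fire in either order.\<close>

lemma sem_exchange:
  assumes "ok xs ((p, is, os) # (q, js, ps) # N) ys" and d: "distinct (xs @ os @ ps)" and "set js \<subseteq> set xs"
  shows "ok xs ((q, js, ps) # (p, is, os) # N) ys \<and>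
    sem xs ((p, is, os) # (q, js, ps) # N) ys = sem xs ((q, js, ps) # (p, is, os) # N) ys"
proof -
  let ?r = "xs \<ominus> is \<ominus> js"
  let ?P = "[(p, is, os)]" and ?Q = "[(q, js, ps)]"
  let ?x = "is @ js @ ?r" and ?y = "os @ ps @ ?r"
  have a: "distinct is" "distinct js" "set is \<subseteq> set xs" "set is \<inter> set js = {}"
     "arr (mor p) is os" "arr (mor q) js ps"
    using assms by auto
  have x: "rearr xs ?x" using a assms d by (auto simp: rearr_def)
  have dd: "distinct ?x" "distinct ?y" "distinct (is @ ps @ ?r)" "distinct (os @ js @ ?r)"
    using a d assms by auto
  have M: "ok ?x ?P (os @ js @ ?r)" "sem ?x ?P (os @ js @ ?r) = mor p \<otimes> ident (js @ ?r)"
    "ok (is @ ps @ ?r) ?P ?y" "sem (is @ ps @ ?r) ?P ?y = mor p \<otimes> ident (ps @ ?r)"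
    using sem_middle[of "[]" "is" "js @ ?r" os p] sem_middle[of "[]" "is" "ps @ ?r" os p] dd a
      tensor_unit[OF arr_tensor[OF a(5) arr_ident]] by auto
  have L: "ok (os @ js @ ?r) ?Q ?y" "sem (os @ js @ ?r) ?Q ?y = ident os \<otimes> (mor q \<otimes> ident ?r)"
    "ok ?x ?Q (is @ ps @ ?r)" "sem ?x ?Q (is @ ps @ ?r) = ident is \<otimes> (mor q \<otimes> ident ?r)"
    using sem_middle[of os js ?r ps q] sem_middle[of "is" js ?r ps q] dd a by auto
  have q: "arr (mor q \<otimes> ident ?r) (js @ ?r) (ps @ ?r)" using arr_tensor[OF a(6) arr_ident] .
  have PQ: "ok ?x (?P @ ?Q) ?y" "ok ?x (?Q @ ?P) ?y" "sem ?x (?P @ ?Q) ?y = sem ?x (?Q @ ?P) ?y"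
    using ok_append[OF M(1) L(1)] ok_append[OF L(3) M(3)] sem_append[OF M(1) L(1)]
      sem_append[OF L(3) M(3)] M L slide[OF a(5) q] by auto
  have y: "ok ?y N ys"
  proof (rule ok_rearr)
    show "ok (ps @ (os @ xs \<ominus> is) \<ominus> js) N ys" using assms(1) by simp
    show "rearr ?y (ps @ (os @ xs \<ominus> is) \<ominus> js)" using dd a d assms by (auto simp: rearr_def)
  qed
  have xs: "ok xs (?P @ ?Q) ?y" "ok xs (?Q @ ?P) ?y" "sem xs (?P @ ?Q) ?y = sem xs (?Q @ ?P) ?y"
    using ok_rearr[OF PQ(1) x] ok_rearr[OF PQ(2) x] sem_rearr[OF PQ(1) x] sem_rearr[OF PQ(2) x] PQ(3)
    by auto
  show ?thesis
    using ok_append[OF xs(2) y] sem_append[OF xs(1) y] sem_append[OF xs(2) y] xs(3) by simp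
qed

lemma ok_inputs:
  "ok xs (P @ (q, js, ps) # Q) ys \<Longrightarrow> set js \<subseteq> set xs \<union> set (outs P)"
proof (induction P arbitrary: xs)
  case (Cons B P)
  obtain p "is" os where B: "B = (p, is, os)" by (cases B) auto
  with Cons have "set js \<subseteq> set (os @ xs \<ominus> is) \<union> set (outs P)" by (intro Cons.IH) simp
  with B show ?case by auto
qed auto

lemma sem_bubble:
  "ok xs (P @ (q, js, ps) # Q) ys \<Longrightarrow> distinct (xs @ outs (P @ (q, js, ps) # Q)) \<Longrightarrow> set js \<subseteq> set xs \<Longrightarrow>
   ok xs ((q, js, ps) # P @ Q) ys \<and> sem xs (P @ (q, js, ps) # Q) ys = sem xs ((q, js, ps) # P @ Q) ys"
proof (induction P arbitrary: xs)
  case (Cons B P)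
  obtain p "is" os where B: "B = (p, is, os)" by (cases B) auto
  let ?x = "os @ xs \<ominus> is"
  have o: "ok ?x (P @ (q, js, ps) # Q) ys" using Cons.prems B by simp
  have "set js \<subseteq> set ?x \<union> set (outs P)" using ok_inputs[OF o] .
  then have js: "set js \<subseteq> set ?x" using Cons.prems B by auto
  have "distinct (?x @ outs (P @ (q, js, ps) # Q))" using Cons.prems B by auto
  from Cons.IH[OF o this js]
  have IH: "ok ?x ((q, js, ps) # P @ Q) ys" "sem ?x (P @ (q, js, ps) # Q) ys = sem ?x ((q, js, ps) # P @ Q) ys"
    by auto
  have "ok xs ((p, is, os) # (q, js, ps) # P @ Q) ys" using IH(1) Cons.prems B by simp
  moreover have "distinct (xs @ os @ ps)" using Cons.prems B by auto
  ultimately have "ok xs ((q, js, ps) # B # P @ Q) ys"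
      "sem xs (B # (q, js, ps) # P @ Q) ys = sem xs ((q, js, ps) # B # P @ Q) ys"
    using sem_exchange[of xs p "is" os q js ps "P @ Q" ys] Cons.prems(3) B by blast+
  moreover have "sem xs (B # P @ (q, js, ps) # Q) ys = sem xs (B # (q, js, ps) # P @ Q) ys"
    using IH(2) B by simp
  ultimately show ?case by simp
qed auto

end

fun reordering :: "'a list \<Rightarrow> 'a list \<Rightarrow> bool" where
  "reordering [] M \<longleftrightarrow> M = []"
| "reordering (B # N) M \<longleftrightarrow> B \<in> set M \<and> reordering N (remove1 B M)"

lemma reordering_outs: "reordering N M \<Longrightarrow> distinct (outs N) \<longleftrightarrow> distinct (outs M)"
  and reordering_outs_set: "reordering N M \<Longrightarrow> set (outs N) = set (outs M)"
proof -
  have *: "reordering N M \<Longrightarrow> (distinct (outs N) \<longleftrightarrow> distinct (outs M)) \<and> set (outs N) = set (outs M)"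
  proof (induction N arbitrary: M)
    case (Cons B N)
    obtain p "is" os where B: "B = (p, is, os)" by (cases B) auto
    obtain P Q where M: "M = P @ B # Q" "B \<notin> set P" using Cons.prems by (metis reordering.simps(2) split_list_first)
    then have "reordering N (P @ Q)" using Cons.prems by (simp add: remove1_append)
    from Cons.IH[OF this] show ?case using M B by auto
  qed simp
  show "reordering N M \<Longrightarrow> distinct (outs N) \<longleftrightarrow> distinct (outs M)"
    "reordering N M \<Longrightarrow> set (outs N) = set (outs M)" using * by auto
qed

context networks
begin

text \<open>
  Two firing orders of the same boxes have the same value: the first box of one order can fire at once, so in the
  other order it can be exchanged with everything before it.
\<close>

theorem sem_reordering:
  "reordering N M \<Longrightarrow> ok xs N ys \<Longrightarrow> ok xs M ys \<Longrightarrow> distinct (xs @ outs M) \<Longrightarrow> sem xs N ys = sem xs M ys"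
proof (induction N arbitrary: M xs)
  case (Cons B N)
  obtain p "is" os where B: "B = (p, is, os)" by (cases B) auto
  obtain P Q where M: "M = P @ B # Q" "B \<notin> set P" using Cons.prems by (metis reordering.simps(2) split_list_first)
  have N: "reordering N (P @ Q)" using Cons.prems M by (simp add: remove1_append)
  have "ok xs (B # P @ Q) ys \<and> sem xs M ys = sem xs (B # P @ Q) ys"
    unfolding M B using Cons.prems M B by (intro sem_bubble) auto
  moreover from this have "ok (os @ xs \<ominus> is) (P @ Q) ys" "ok (os @ xs \<ominus> is) N ys"
    using B Cons.prems by auto
  then have "sem (os @ xs \<ominus> is) N ys = sem (os @ xs \<ominus> is) (P @ Q) ys"
    using Cons.prems B M by (intro Cons.IH[OF N]) auto
  ultimately show ?case by (simp add: B)
qed auto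

lemma W_map: "(\<And>x. x \<in> set xs \<Longrightarrow> obj (f x) = obj x) \<Longrightarrow> W (map f xs) = W xs"
  by (induction xs) auto

text \<open>
  Names of wires are immaterial as long as their objects are kept.
\<close>

lemma sem_ren:
  assumes "ok xs N ys" "inj_on f (set xs \<union> set (outs N))" "\<And>x. x \<in> set xs \<union> set (outs N) \<Longrightarrow> obj (f x) = obj x"
  shows "ok (map f xs) (map (ren f) N) (map f ys) \<and>
    sem (map f xs) (map (ren f) N) (map f ys) = sem xs N ys"
  using assms
proof (induction xs N ys rule: ok.induct)
  case (1 xs ys)
  then show ?case using perm_map[of xs ys f] by (auto simp: rearr_def distinct_map)
next
  case (2 xs p "is" os N ys)
  let ?r = "xs \<ominus> is" and ?X = "set xs \<union> set os \<union> set (outs N)"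
  have i: "set is \<subseteq> set xs" using 2 by auto
  have inj: "inj_on f ?X" using 2(3) by (simp add: Un_assoc)
  have r: "map f xs \<ominus> map f is = map f ?r"
  proof -
    have "f x \<in> f ` set is \<longleftrightarrow> x \<in> set is" if "x \<in> set xs" for x
      using i that inj by (auto simp: inj_on_def)
    then show ?thesis by (auto simp: without_def filter_map intro!: arg_cong[where f = "map f"] filter_cong)
  qed
  have o: "obj (f x) = obj x" if "x \<in> ?X" for x using 2(4) that by auto
  have W: "W (map f is) = W is" "W (map f os) = W os" "W (map f ?r) = W ?r"
    using i o by (auto intro!: W_map)
  have IH: "ok (map f (os @ ?r)) (map (ren f) N) (map f ys) \<and>
      sem (map f (os @ ?r)) (map (ren f) N) (map f ys) = sem (os @ ?r) N ys"
    using 2 o by (intro 2(1)) (auto intro: inj_on_subset[OF inj])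
  have p: "perm (map f xs) (map f (is @ ?r)) = perm xs (is @ ?r)"
    using 2 o by (intro perm_map rearr_without) (auto intro: inj_on_subset[OF inj])
  have d: "distinct (map f xs)" "distinct (map f is)"
    using 2 i by (auto simp: distinct_map intro: inj_on_subset[OF inj])
  show ?case using IH p W r d i 2 by (auto simp: arr_def)
qed

end

section \<open>Diagrams and certified rewriting\<close>

type_synonym 's wire = "'s \<times> int"
type_synonym ('s, 'p) wbox = "('p, 's wire) box"

text \<open>
  Syntax for morphisms built from named operations. The sorts name objects, and an arity \<open>ar\<close> gives source and
  target words of the operations. \<open>Swap\<close> stands for the symmetry of two words; composition \<open>\<bullet>\<close> is written right
  to left.
\<close>

datatype ('s, 'p) diagram =
    Op 'p
  | Idt "'s list"
  | Swap "'s list" "'s list"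
  | Seq "('s, 'p) diagram" "('s, 'p) diagram" (infixr "\<bullet>" 60)
  | Par "('s, 'p) diagram" "('s, 'p) diagram" (infixr "\<parallel>" 65)

primrec src :: "('p \<Rightarrow> 's list \<times> 's list) \<Rightarrow> ('s, 'p) diagram \<Rightarrow> 's list" where
  "src ar (Op p) = fst (ar p)"
| "src ar (Idt ss) = ss"
| "src ar (Swap ss ts) = ss @ ts"
| "src ar (g \<bullet> f) = src ar f"
| "src ar (f \<parallel> g) = src ar f @ src ar g"

primrec tgt :: "('p \<Rightarrow> 's list \<times> 's list) \<Rightarrow> ('s, 'p) diagram \<Rightarrow> 's list" where
  "tgt ar (Op p) = snd (ar p)"
| "tgt ar (Idt ss) = ss"
| "tgt ar (Swap ss ts) = ts @ ss"
| "tgt ar (g \<bullet> f) = tgt ar g"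
| "tgt ar (f \<parallel> g) = tgt ar f @ tgt ar g"

primrec well_typed :: "('p \<Rightarrow> 's list \<times> 's list) \<Rightarrow> ('s, 'p) diagram \<Rightarrow> bool" where
  "well_typed ar (Op p) \<longleftrightarrow> True"
| "well_typed ar (Idt ss) \<longleftrightarrow> True"
| "well_typed ar (Swap ss ts) \<longleftrightarrow> True"
| "well_typed ar (g \<bullet> f) \<longleftrightarrow> well_typed ar f \<and> well_typed ar g \<and> tgt ar f = src ar g"
| "well_typed ar (f \<parallel> g) \<longleftrightarrow> well_typed ar f \<and> well_typed ar g"

primrec fresh :: "('p \<Rightarrow> 's list \<times> 's list) \<Rightarrow> ('s, 'p) diagram \<Rightarrow> nat" where
  "fresh ar (Op p) = length (snd (ar p))"
| "fresh ar (Idt ss) = 0"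
| "fresh ar (Swap ss ts) = 0"
| "fresh ar (g \<bullet> f) = fresh ar f + fresh ar g"
| "fresh ar (f \<parallel> g) = fresh ar f + fresh ar g"

text \<open>
  The network of a diagram on input wires \<open>xs\<close>: the boxes, the output wires and the unused part of the supply
  \<open>ns\<close> of fresh names. Identities and swaps draw no boxes.
\<close>

primrec draw :: "('p \<Rightarrow> 's list \<times> 's list) \<Rightarrow> ('s, 'p) diagram \<Rightarrow> 's wire list \<Rightarrow> int list
    \<Rightarrow> ('s, 'p) wbox list \<times> 's wire list \<times> int list" where
  "draw ar (Op p) xs ns = (let ys = zip (snd (ar p)) ns in ([(p, xs, ys)], ys, drop (length ys) ns))"
| "draw ar (Idt ss) xs ns = ([], xs, ns)"
| "draw ar (Swap ss ts) xs ns = ([], drop (length ss) xs @ take (length ss) xs, ns)"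
| "draw ar (g \<bullet> f) xs ns = (case draw ar f xs ns of (M, ys, ns') \<Rightarrow>
     (case draw ar g ys ns' of (N, zs, ns'') \<Rightarrow> (M @ N, zs, ns'')))"
| "draw ar (f \<parallel> g) xs ns = (case draw ar f (take (length (src ar f)) xs) ns of (M, ys, ns') \<Rightarrow>
     (case draw ar g (drop (length (src ar f)) xs) ns' of (N, zs, ns'') \<Rightarrow> (M @ N, ys @ zs, ns'')))"

fun runs :: "'w list \<Rightarrow> ('p, 'w) box list \<Rightarrow> 'w list option" where
  "runs xs [] = Some xs"
| "runs xs ((p, is, os) # N) = (if list_all (\<lambda>x. x \<in> set xs) is then runs (os @ xs \<ominus> is) N else None)"

text \<open>
  Splits a network around an occurrence of the subnetwork \<open>L\<close>: the boxes that depend on an output of \<open>L\<close>, or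
  on a wire in \<open>D\<close>, come after it, and all others before it. The result is a candidate that \<open>step\<close> checks.
\<close>

fun excise :: "('p, 'w) box list \<Rightarrow> 'w list \<Rightarrow> ('p, 'w) box list \<Rightarrow> ('p, 'w) box list \<times> ('p, 'w) box list" where
  "excise L D [] = ([], [])"
| "excise L D ((p, is, os) # N) =
    (if (p, is, os) \<in> set L then excise (remove1 (p, is, os) L) (os @ D) N
     else if list_ex (\<lambda>x. x \<in> set D) is
       then (case excise L (os @ D) N of (P, Q) \<Rightarrow> (P, (p, is, os) # Q))
     else (case excise L D N of (P, Q) \<Rightarrow> ((p, is, os) # P, Q)))"

definition subst :: "('w \<times> 'w) list \<Rightarrow> 'w \<Rightarrow> 'w" where
  "subst \<sigma> x = (case map_of \<sigma> x of None \<Rightarrow> x | Some y \<Rightarrow> y)"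

abbreviation fw :: bool where "fw \<equiv> False"
abbreviation bw :: bool where "bw \<equiv> True"

text \<open>
  A move \<open>(i, flip, is, ns, ms)\<close> applies the \<open>i\<close>-th law, from right to left if \<open>flip\<close> is set, to the occurrence
  of its first side with input wires \<open>is\<close> and created wires \<open>ns\<close>; the wires created by the other side are called
  \<open>ms\<close>. The outputs of the occurrence are renamed in the later boxes, since one of the sides may simply let a wire
  pass. A wire that passes through the first side has to count as an output of it, so that its consumer comes later.
\<close>

type_synonym move = "nat \<times> bool \<times> int list \<times> int list \<times> int list"

fun step where
  "step ar laws xs (N, ys) (i, flip, is, ns, ms) =
    (let (l, r) = (if flip then prod.swap (laws ! i) else laws ! i);
         I = zip (src ar l) is;
         (L, os, _) = draw ar l I ns;
         (R, os', _) = draw ar r I ms;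
         (P, Q) = excise L (filter (\<lambda>x. x \<in> set I) os) N;
         f = subst (zip os os')
     in if length is = length (src ar l) \<and> distinct (is @ ns) \<and> distinct (is @ ms) \<and>
           length ns = fresh ar l \<and> length ms = fresh ar r \<and> reordering N (P @ L @ Q) \<and>
           list_all (\<lambda>x. x \<notin> set xs \<and> x \<notin> set (outs P) \<and> x \<notin> set (outs Q)) (outs R) \<and>
           (case runs xs P of None \<Rightarrow> False | Some st \<Rightarrow> list_all (\<lambda>x. x \<in> set st) I \<and>
             (case runs st (L @ Q) of None \<Rightarrow> False | Some zs \<Rightarrow>
                list_all (\<lambda>z. z \<in> set ys) zs \<and> list_all (\<lambda>y. y \<in> set zs) ys))
        then Some (P @ R @ map (ren f) Q, map f ys) else None)"

fun steps where
  "steps ar laws xs S [] = Some S"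
| "steps ar laws xs S (c # cs) =
     (case step ar laws xs S c of None \<Rightarrow> None | Some S' \<Rightarrow> steps ar laws xs S' cs)"

text \<open>
  The certificate \<open>cs\<close> rewrites the network of \<open>t\<close>, with names counted upwards from \<open>0\<close>, into the network of \<open>u\<close>
  drawn with the names \<open>ms\<close>.
\<close>

definition check where
  "check ar laws t u ms cs \<longleftrightarrow>
     (let k = int (length (src ar t)); is = [0..k - 1]; xs = zip (src ar t) is;
          n = int (fresh ar t);
          (N, ys, _) = draw ar t xs [k..k + n - 1];
          (M, zs, _) = draw ar u xs ms
      in well_typed ar t \<and> well_typed ar u \<and> src ar t = src ar u \<and> tgt ar t = tgt ar u \<and>
         distinct ms \<and> list_all (\<lambda>m. k \<le> m) ms \<and> length ms = fresh ar u \<and>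
         list_all (\<lambda>c. fst c < length laws) cs \<and>
         (case steps ar laws xs (N, ys) cs of None \<Rightarrow> False
          | Some (N', ys') \<Rightarrow> ys' = zs \<and> reordering N' M))"

locale string_diagrams = strict_braided_category \<C>
  for \<C> :: "('o, 'm) btc" (structure) +
  fixes obj :: "'s \<Rightarrow> 'o" and ar :: "'p \<Rightarrow> 's list \<times> 's list" and mor :: "'p \<Rightarrow> 'm"
  assumes obj: "obj s \<in> Ob \<C>"
    and symmetric: "\<chi> (obj t) (obj s) \<cdot> \<chi> (obj s) (obj t) = \<one> (obj s \<odot> obj t)"
    and mor: "mor p \<in> Hom (word \<C> obj (fst (ar p))) (word \<C> obj (snd (ar p)))"
begin

sublocale sorts: symmetric_words \<C> obj
  by unfold_locales (rule obj, rule symmetric)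

sublocale wires: networks \<C> "\<lambda>x :: 's wire. obj (fst x)" mor
  by unfold_locales (rule obj, rule symmetric)

primrec eval :: "('s, 'p) diagram \<Rightarrow> 'm" where
  "eval (Op p) = mor p"
| "eval (Idt ss) = \<one> (word \<C> obj ss)"
| "eval (Swap ss ts) = \<chi> (word \<C> obj ss) (word \<C> obj ts)"
| "eval (g \<bullet> f) = eval g \<cdot> eval f"
| "eval (f \<parallel> g) = eval f \<otimes> eval g"

definition equation :: "('s, 'p) diagram \<Rightarrow> ('s, 'p) diagram \<Rightarrow> bool" (infix "\<simeq>" 50) where
  "t \<simeq> u \<longleftrightarrow> well_typed ar t \<and> well_typed ar u \<and> src ar t = src ar u \<and> tgt ar t = tgt ar u \<and>
     eval t = eval u"

lemma wires_word: "wires.W xs = word \<C> obj (map fst xs)"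
  by (simp add: word_map)

lemma arr_eval: "well_typed ar t \<Longrightarrow> eval t \<in> Hom (word \<C> obj (src ar t)) (word \<C> obj (tgt ar t))"
proof (induction t)
  case (Op p) then show ?case using mor by simp
next
  case (Idt ss) then show ?case using sorts.arr_ident by (simp add: sorts.arr_def)
next
  case (Swap ss ts) then show ?case using sorts.arr_swap by (simp add: sorts.arr_def)
next
  case (Seq t1 t2) then show ?case by (auto intro: comp_hom)
next
  case (Par t1 t2) then show ?case by (auto simp: sorts.W_append intro: tensor_hom)
qed

lemma draw_sound:
  "draw ar t xs ns = (N, ys, ns') \<Longrightarrow> well_typed ar t \<Longrightarrow> map fst xs = src ar t \<Longrightarrow> distinct xs \<Longrightarrow>
   distinct ns \<Longrightarrow> snd ` set xs \<inter> set ns = {} \<Longrightarrow> fresh ar t \<le> length ns \<Longrightarrow>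
   wires.ok xs N ys \<and> wires.sem xs N ys = eval t \<and> map fst ys = tgt ar t \<and>
   ns = map snd (outs N) @ ns' \<and> length (outs N) = fresh ar t \<and> set ys \<subseteq> set xs \<union> set (outs N)"
proof (induction t arbitrary: xs ns N ys ns')
  case (Op p)
  let ?c = "snd (ar p)"
  have N: "N = [(p, xs, ys)]" "ys = zip ?c ns" "ns' = drop (length ys) ns"
    using Op by (auto simp: Let_def)
  have l: "length ?c \<le> length ns" using Op by simp
  have fst: "map fst ys = ?c" and snd: "map snd ys = take (length ?c) ns"
    using l N(2) by (simp_all add: map_fst_zip_take map_snd_zip_take min_def)
  have "distinct ys" using N(2) Op.prems by (simp add: distinct_zipI2)
  moreover have "wires.arr (mor p) xs ys"
    unfolding wires.arr_def wires_word using mor[of p] Op.prems fst by simp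
  ultimately show ?case
    using N fst snd l wires.sem_single[of xs ys p] Op.prems by (simp add: min_def)
next
  case (Idt ss)
  then show ?case using wires.perm_self[of xs] by (auto simp: rearr_def wires_word)
next
  case (Swap ss ts)
  let ?a = "take (length ss) xs" and ?b = "drop (length ss) xs"
  have ab: "?a @ ?b = xs" by simp
  have "map fst ?a = ss" "map fst ?b = ts" using Swap.prems by (simp_all add: take_map[symmetric] drop_map[symmetric])
  moreover have "distinct (?a @ ?b)" using Swap.prems by simp
  moreover have s: "set xs = set ?a \<union> set ?b" by (metis ab set_append)
  moreover have "N = []" "ys = ?b @ ?a" "ns' = ns" using Swap.prems by auto
  ultimately show ?case
    using wires.perm_swap[of ?a ?b] by (auto simp: rearr_def wires_word simp del: append_take_drop_id)
      (simp_all add: Swap.prems)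
next
  case (Seq g f)
  obtain M zs ms where f: "draw ar f xs ns = (M, zs, ms)" by (metis prod_cases3)
  obtain K where g: "draw ar g zs ms = (K, ys, ns')" "N = M @ K" using Seq.prems(1) f by (auto split: prod.splits)
  from Seq.IH(2)[OF f] Seq.prems
  have F: "wires.ok xs M zs" "wires.sem xs M zs = eval f" "map fst zs = tgt ar f"
     "ns = map snd (outs M) @ ms" "length (outs M) = fresh ar f" "set zs \<subseteq> set xs \<union> set (outs M)" by auto
  have "wires.ok zs K ys \<and> wires.sem zs K ys = eval g \<and> map fst ys = tgt ar g \<and>
     ms = map snd (outs K) @ ns' \<and> length (outs K) = fresh ar g \<and> set ys \<subseteq> set zs \<union> set (outs K)"
  proof (rule Seq.IH(1)[OF g(1)])
    show "distinct zs" using F wires.ok_distinct by blast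
    have "snd ` set zs \<subseteq> snd ` set xs \<union> set (map snd (outs M))" using F(6) by auto
    moreover have "set ms \<inter> (snd ` set xs \<union> set (map snd (outs M))) = {}"
      using F(4) Seq.prems(5,6) by auto
    ultimately show "snd ` set zs \<inter> set ms = {}" by blast
  qed (use F Seq.prems in auto)
  then show ?case using F g wires.ok_append[OF F(1)] wires.sem_append[OF F(1)] by auto
next
  case (Par f g)
  let ?n = "length (src ar f)"
  let ?a = "take ?n xs" and ?b = "drop ?n xs"
  obtain M zs ms where f: "draw ar f ?a ns = (M, zs, ms)" by (metis prod_cases3)
  obtain K ws where g: "draw ar g ?b ms = (K, ws, ns')" "N = M @ K" "ys = zs @ ws"
    using Par.prems(1) f by (auto split: prod.splits)
  have ab: "?a @ ?b = xs" by simp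
  have d: "distinct (?a @ ?b)" using Par.prems by simp
  have s: "set xs = set ?a \<union> set ?b" by (metis ab set_append)
  have "wires.ok ?a M zs \<and> wires.sem ?a M zs = eval f \<and> map fst zs = tgt ar f \<and>
     ns = map snd (outs M) @ ms \<and> length (outs M) = fresh ar f \<and> set zs \<subseteq> set ?a \<union> set (outs M)"
    using Par.prems s by (intro Par.IH(1)[OF f]) (auto simp: take_map[symmetric])
  then have F: "wires.ok ?a M zs" "wires.sem ?a M zs = eval f" "map fst zs = tgt ar f"
     "ns = map snd (outs M) @ ms" "length (outs M) = fresh ar f" "set zs \<subseteq> set ?a \<union> set (outs M)" by auto
  have "wires.ok ?b K ws \<and> wires.sem ?b K ws = eval g \<and> map fst ws = tgt ar g \<and>
     ms = map snd (outs K) @ ns' \<and> length (outs K) = fresh ar g \<and> set ws \<subseteq> set ?b \<union> set (outs K)"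
    using Par.prems s F by (intro Par.IH(2)[OF g(1)]) (auto simp: drop_map[symmetric])
  then have G: "wires.ok ?b K ws" "wires.sem ?b K ws = eval g" "map fst ws = tgt ar g"
     "ms = map snd (outs K) @ ns'" "length (outs K) = fresh ar g" "set ws \<subseteq> set ?b \<union> set (outs K)" by auto
  have nm: "snd ` set ?a \<inter> set (map snd (outs K)) = {}" "snd ` set ?b \<inter> set (map snd (outs M)) = {}"
    "set (map snd (outs M)) \<inter> set (map snd (outs K)) = {}"
    using F(4) G(4) Par.prems s by auto
  have inj: "A \<inter> B = {}" if "snd ` A \<inter> snd ` B = {}" for A B :: "'s wire set"
    using that image_Int_subset[of snd A B] by (metis image_is_empty subset_empty)
  have "set ?a \<inter> set ?b = {}" using d by (simp only: distinct_append)
  moreover have "set ?a \<inter> set (outs K) = {}" "set ?b \<inter> set (outs M) = {}" "set (outs M) \<inter> set (outs K) = {}"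
    using nm by (simp_all add: inj)
  ultimately have dis: "set (?a @ outs M @ zs) \<inter> set (?b @ outs K @ ws) = {}"
    using F(6) G(6) unfolding set_append by blast
  from wires.sem_par[OF F(1) G(1) dis] show ?case
    using F G g s unfolding ab by auto
qed

lemma ok_boxes: "wires.ok xs N ys \<Longrightarrow> (p, is, os) \<in> set N \<Longrightarrow> distinct is \<and> wires.arr (mor p) is os"
  by (induction xs N ys rule: wires.ok.induct) auto

lemma ok_outputs: "wires.ok xs N ys \<Longrightarrow> set ys \<subseteq> set xs \<union> set (outs N)"
  by (induction xs N ys rule: wires.ok.induct) (auto simp: rearr_def)

lemma ok_rest: "wires.ok xs M zs \<Longrightarrow> wires.ok xs (M @ N) ys \<Longrightarrow> wires.ok zs N ys"
proof (induction xs M zs rule: wires.ok.induct)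
  case (1 xs zs) then show ?case by (auto intro: wires.ok_rearr simp: rearr_def)
qed auto

lemma ok_runs:
  "runs xs N = Some zs \<Longrightarrow> distinct (xs @ outs N) \<Longrightarrow>
   (\<And>p is os. (p, is, os) \<in> set N \<Longrightarrow> distinct is \<and> wires.arr (mor p) is os) \<Longrightarrow> wires.ok xs N zs"
proof (induction xs N rule: runs.induct)
  case (2 xs p "is" os N)
  then have i: "set is \<subseteq> set xs" by (auto simp: list_all_iff split: if_splits)
  have "wires.ok (os @ xs \<ominus> is) N zs"
    using 2 by (intro "2.IH") (auto split: if_splits)
  then show ?case using i 2 by auto
qed (auto simp: rearr_def)

end

lemma reordering_set: "reordering N M \<Longrightarrow> set N = set M"
proof (induction N arbitrary: M)
  case (Cons B N)
  obtain P Q where M: "M = P @ B # Q" "B \<notin> set P" using Cons.prems by (metis reordering.simps(2) split_list_first)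
  then have "reordering N (P @ Q)" using Cons.prems by (simp add: remove1_append)
  from Cons.IH[OF this] M show ?case by auto
qed simp

lemma subst_notin: "x \<notin> fst ` set \<sigma> \<Longrightarrow> subst \<sigma> x = x"
  by (auto simp: subst_def map_of_eq_None_iff[symmetric])

lemma map_subst_zip: "distinct xs \<Longrightarrow> length xs = length ys \<Longrightarrow> map (subst (zip xs ys)) xs = ys"
  by (rule nth_equalityI) (auto simp: subst_def map_of_zip_nth)

context string_diagrams
begin

text \<open>
  A subnetwork may be replaced by one of equal value: let the wires that pass by it be its frame.
\<close>

lemma replace_sound:
  assumes ok: "wires.ok xs (P @ L @ Q) ys" and d: "distinct (xs @ outs (P @ L @ Q))"
    and P: "wires.ok xs P st" and I: "set I \<subseteq> set st"
    and L: "wires.ok I L os" and R: "wires.ok I R os'" and LR: "wires.sem I L os = wires.sem I R os'"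
    and ty: "map fst os = map fst os'"
    and f: "f = subst (zip os os')"
    and fr: "distinct (outs R)" "set (outs R) \<inter> set (xs @ outs P @ outs Q) = {}"
  shows "wires.ok xs (P @ R @ map (ren f) Q) (map f ys) \<and>
    distinct (xs @ outs (P @ R @ map (ren f) Q)) \<and>
    wires.sem xs (P @ R @ map (ren f) Q) (map f ys) = wires.sem xs (P @ L @ Q) ys"
proof -
  let ?r = "st \<ominus> I"
  note dist = wires.ok_distinct[OF P] wires.ok_distinct[OF L] wires.ok_distinct[OF R]
  have st: "rearr st (I @ ?r)" using dist I by (intro wires.rearr_without) auto
  have stx: "set st \<subseteq> set xs \<union> set (outs P)" using ok_outputs[OF P] .
  have osx: "set os \<subseteq> set I \<union> set (outs L)" "set os' \<subseteq> set I \<union> set (outs R)"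
    using ok_outputs[OF L] ok_outputs[OF R] by auto
  have rL: "set ?r \<inter> (set I \<union> set (outs L)) = {}" using stx d by auto
  have rR: "set ?r \<inter> (set I \<union> set (outs R)) = {}" using stx fr by auto
  have dr: "distinct ?r" using dist by simp
  note okL = wires.ok_frame[OF L dr rL] and okR = wires.ok_frame[OF R dr rR]
  note semL = wires.sem_frame[OF L dr rL] and semR = wires.sem_frame[OF R dr rR]
  have stL: "wires.ok st L (os @ ?r)" and stR: "wires.ok st R (os' @ ?r)"
    using wires.ok_rearr[OF okL st] wires.ok_rearr[OF okR st] by auto
  have eq: "wires.sem st L (os @ ?r) = wires.sem st R (os' @ ?r)"
    using wires.sem_rearr[OF okL st] wires.sem_rearr[OF okR st] semL semR LR by simp
  have Q: "wires.ok (os @ ?r) Q ys" using ok_rest[OF stL ok_rest[OF P ok]] .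
  have len: "length os = length os'" using ty by (metis length_map)
  have fos: "map f os = os'" using map_subst_zip[of os os'] dist len f by simp
  have fid: "f x = x" if "x \<notin> set os" for x
    using that f subst_notin[of x "zip os os'"] len by (metis map_fst_zip set_map)
  have "f x = x" if "x \<in> set ?r" for x using that rL osx by (intro fid) blast
  then have fr': "map f ?r = ?r" by (intro map_idI)
  have "f x = x" if "x \<in> set (outs Q)" for x
  proof (rule fid)
    have "set (outs Q) \<inter> (set xs \<union> set (outs P) \<union> set (outs L)) = {}" using d by auto
    then show "x \<notin> set os" using that osx(1) I stx by blast
  qed
  then have fQ: "map f (outs Q) = outs Q" by (intro map_idI)
  have dos: "distinct (os' @ ?r)" using wires.ok_distinct[OF stR] by simp
  have oQ: "set (os' @ ?r) \<inter> set (outs Q) = {}"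
  proof -
    have "set (outs Q) \<inter> (set xs \<union> set (outs P) \<union> set (outs R)) = {}" using d fr by auto
    then show ?thesis using osx(2) I stx by fastforce
  qed
  have inj: "inj_on f (set (os @ ?r) \<union> set (outs Q))"
  proof (rule inj_onI)
    have "inj_on f (set os)" using fos dist by (metis distinct_map)
    moreover have *: "f x = x \<and> x \<notin> set os'" if "x \<in> set ?r \<union> set (outs Q)" "x \<notin> set os" for x
      using that fid[OF that(2)] dos oQ by auto
    moreover have "f x \<in> set os'" if "x \<in> set os" for x using that fos by (metis imageI set_map)
    ultimately show "x = y" if "x \<in> set (os @ ?r) \<union> set (outs Q)" "y \<in> set (os @ ?r) \<union> set (outs Q)" "f x = f y" for x y
      using that by (metis UnE Un_iff inj_onD set_append)
  qed
  have ob: "obj (fst (f x)) = obj (fst x)" for x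
  proof (cases "x \<in> set os")
    case True
    then obtain i where i: "i < length os" "os ! i = x" by (metis in_set_conv_nth)
    then have "f x = os' ! i" using fos by (metis nth_map)
    moreover have "fst (os ! i) = fst (os' ! i)" using ty i len by (metis nth_map)
    ultimately show ?thesis using i by simp
  qed (simp add: fid)
  have ren: "wires.ok (os' @ ?r) (map (ren f) Q) (map f ys)"
    "wires.sem (os' @ ?r) (map (ren f) Q) (map f ys) = wires.sem (os @ ?r) Q ys"
    using wires.sem_ren[OF Q inj ob] fos fr' by auto
  have outsQ: "outs (map (ren f) Q) = outs Q"
  proof -
    have "outs (map (ren f) N) = map f (outs N)" for N :: "('s, 'p) wbox list"
      by (induction N rule: outs.induct) auto
    then show ?thesis using fQ by simp
  qed
  have "wires.sem xs (P @ L @ Q) ys = wires.sem xs (P @ R @ map (ren f) Q) (map f ys)"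
    using wires.sem_append[OF P wires.ok_append[OF stL Q]] wires.sem_append[OF stL Q]
      wires.sem_append[OF P wires.ok_append[OF stR ren(1)]] wires.sem_append[OF stR ren(1)] eq ren(2)
    by simp
  then show ?thesis
    using wires.ok_append[OF P wires.ok_append[OF stR ren(1)]] outsQ d fr by auto
qed

definition valid :: "'s wire list \<Rightarrow> ('s, 'p) wbox list \<times> 's wire list \<Rightarrow> bool" where
  "valid xs S \<longleftrightarrow> wires.ok xs (fst S) (snd S) \<and> distinct (xs @ outs (fst S))"

lemma draw_law:
  assumes "draw ar l (zip (src ar l) is) ns = (L, os, k)" "well_typed ar l" "length is = length (src ar l)"
    "distinct (is @ ns)" "length ns = fresh ar l"
  shows "wires.ok (zip (src ar l) is) L os" "wires.sem (zip (src ar l) is) L os = eval l"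
    "map fst os = tgt ar l" "distinct (outs L)"
proof -
  have 1: "map fst (zip (src ar l) is) = src ar l" "map snd (zip (src ar l) is) = is" using assms(3) by simp_all
  then have 2: "distinct (zip (src ar l) is)" "snd ` set (zip (src ar l) is) \<inter> set ns = {}"
    using assms(4) by (auto simp: distinct_zipI2 dest: set_zip_rightD)
  have "distinct ns" "fresh ar l \<le> length ns" using assms(4,5) by simp_all
  note D = draw_sound[OF assms(1,2) 1(1) 2(1) this(1) 2(2) this(2)]
  then show "wires.ok (zip (src ar l) is) L os" "wires.sem (zip (src ar l) is) L os = eval l"
    "map fst os = tgt ar l" by blast+
  have "distinct (map snd (outs L) @ k)" using D \<open>distinct ns\<close> by metis
  then show "distinct (outs L)" by (simp add: distinct_map)
qed

lemma step_sound:
  assumes "step ar laws xs S c = Some S'" and v: "valid xs S"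
    and laws: "list_all (\<lambda>(l, r). l \<simeq> r) laws" and i: "fst c < length laws"
  shows "valid xs S' \<and> wires.sem xs (fst S') (snd S') = wires.sem xs (fst S) (snd S)"
proof -
  obtain N ys where S: "S = (N, ys)" by (cases S)
  obtain i flip "is" ns ms where c: "c = (i, flip, is, ns, ms)" by (cases c) auto
  obtain l r where lr: "(l, r) = (if flip then prod.swap (laws ! i) else laws ! i)" by (metis surj_pair)
  define I where "I = zip (src ar l) is"
  obtain L os k where L: "draw ar l I ns = (L, os, k)" by (metis prod_cases3)
  obtain R os' k' where R: "draw ar r I ms = (R, os', k')" by (metis prod_cases3)
  obtain P Q where PQ: "excise L (filter (\<lambda>x. x \<in> set I) os) N = (P, Q)" by (metis surj_pair)
  define f where "f = subst (zip os os')"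
  have "(case laws ! i of (l, r) \<Rightarrow> l \<simeq> r)" using laws i c by (auto simp: list_all_length)
  then have eq: "well_typed ar l" "well_typed ar r" "src ar l = src ar r" "tgt ar l = tgt ar r" "eval l = eval r"
    using lr by (auto simp: equation_def split: if_splits prod.splits)
  have "(if length is = length (src ar l) \<and> distinct (is @ ns) \<and> distinct (is @ ms) \<and>
           length ns = fresh ar l \<and> length ms = fresh ar r \<and> reordering N (P @ L @ Q) \<and>
           list_all (\<lambda>x. x \<notin> set xs \<and> x \<notin> set (outs P) \<and> x \<notin> set (outs Q)) (outs R) \<and>
           (case runs xs P of None \<Rightarrow> False | Some st \<Rightarrow> list_all (\<lambda>x. x \<in> set st) I \<and>
             (case runs st (L @ Q) of None \<Rightarrow> False | Some zs \<Rightarrow>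
                list_all (\<lambda>z. z \<in> set ys) zs \<and> list_all (\<lambda>y. y \<in> set zs) ys))
        then Some (P @ R @ map (ren f) Q, map f ys) else None) = Some S'"
    using assms(1) unfolding S c step.simps lr[symmetric] Let_def prod.case I_def[symmetric] L R PQ f_def[symmetric]
    by simp
  then obtain st zs where
    b: "length is = length (src ar l)" "distinct (is @ ns)" "distinct (is @ ms)"
       "length ns = fresh ar l" "length ms = fresh ar r" and ro: "reordering N (P @ L @ Q)"
    and new: "\<forall>x\<in>set (outs R). x \<notin> set xs \<and> x \<notin> set (outs P) \<and> x \<notin> set (outs Q)"
    and run: "runs xs P = Some st" "\<forall>x\<in>set I. x \<in> set st" "runs st (L @ Q) = Some zs"
      "\<forall>z\<in>set zs. z \<in> set ys" "\<forall>y\<in>set ys. y \<in> set zs"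
    and S': "S' = (P @ R @ map (ren f) Q, map f ys)"
    by (auto simp: list_all_iff split: if_splits option.splits)
  have fr: "set (outs R) \<inter> set (xs @ outs P @ outs Q) = {}" using new by auto
  have st: "runs xs P = Some st" "set I \<subseteq> set st" "runs st (L @ Q) = Some zs" "set zs = set ys"
    using run by auto
  note dl = draw_law[OF L[unfolded I_def] eq(1) b(1,2,4), folded I_def]
  note dr = draw_law[of r "is" ms, folded eq(3), folded I_def, OF R eq(2) b(1,3,5)]
  have okN: "wires.ok xs N ys" and dN: "distinct (xs @ outs N)" using v S by (auto simp: valid_def)
  have d: "distinct (xs @ outs (P @ L @ Q))"
    using dN reordering_outs[OF ro] reordering_outs_set[OF ro] by (simp del: outs_append)
  have bx: "distinct is \<and> wires.arr (mor p) is os" if "(p, is, os) \<in> set (P @ L @ Q)" for p "is" os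
    using that ok_boxes[OF okN] reordering_set[OF ro] by blast
  have P: "wires.ok xs P st" using d bx by (intro ok_runs[OF st(1)]) auto
  have "distinct (st @ outs (L @ Q))" using ok_outputs[OF P] wires.ok_distinct[OF P] d by auto
  then have LQ: "wires.ok st (L @ Q) zs" using bx by (intro ok_runs[OF st(3)]) auto
  have "rearr zs ys" using st(4) wires.ok_distinct[OF LQ] wires.ok_distinct[OF okN] by (simp add: rearr_def)
  then have "wires.ok xs (P @ L @ Q) ys"
    using wires.ok_append[OF wires.ok_append[OF P LQ], of "[]" ys] by simp
  note res = replace_sound[OF this d P st(2) dl(1) dr(1) _ _ f_def dr(4) fr]
  have "wires.sem xs N ys = wires.sem xs (P @ L @ Q) ys"
    using wires.sem_reordering[OF ro okN _ d] \<open>wires.ok xs (P @ L @ Q) ys\<close> by simp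
  then show ?thesis using res dl dr eq S S' by (simp add: valid_def)
qed

lemma steps_sound:
  "steps ar laws xs S cs = Some S' \<Longrightarrow> valid xs S \<Longrightarrow> list_all (\<lambda>(l, r). l \<simeq> r) laws \<Longrightarrow>
   list_all (\<lambda>c. fst c < length laws) cs \<Longrightarrow>
   valid xs S' \<and> wires.sem xs (fst S') (snd S') = wires.sem xs (fst S) (snd S)"
proof (induction cs arbitrary: S)
  case (Cons c cs)
  obtain S1 where S1: "step ar laws xs S c = Some S1" "steps ar laws xs S1 cs = Some S'"
    using Cons.prems(1) by (auto split: option.splits)
  have c: "fst c < length laws" and cs: "list_all (\<lambda>c. fst c < length laws) cs"
    using Cons.prems(4) by simp_all
  note v1 = step_sound[OF S1(1) Cons.prems(2,3) c]
  show ?case using Cons.IH[OF S1(2) conjunct1[OF v1] Cons.prems(3) cs] v1 by simp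
qed auto

theorem derivation:
  assumes "list_all (\<lambda>(l, r). l \<simeq> r) laws" and "check ar laws t u ms cs"
  shows "t \<simeq> u"
proof -
  define k where "k = int (length (src ar t))"
  define xs where "xs = zip (src ar t) [0..k - 1]"
  obtain N ys n where N: "draw ar t xs [k..k + int (fresh ar t) - 1] = (N, ys, n)" by (metis prod_cases3)
  obtain M zs m where M: "draw ar u xs ms = (M, zs, m)" by (metis prod_cases3)
  have ch: "well_typed ar t \<and> well_typed ar u \<and> src ar t = src ar u \<and> tgt ar t = tgt ar u \<and>
         distinct ms \<and> list_all (\<lambda>m. k \<le> m) ms \<and> length ms = fresh ar u \<and>
         list_all (\<lambda>c. fst c < length laws) cs \<and>
         (case steps ar laws xs (N, ys) cs of None \<Rightarrow> False
          | Some (N', ys') \<Rightarrow> ys' = zs \<and> reordering N' M)"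
    using assms(2) unfolding check_def Let_def k_def[symmetric] xs_def[symmetric] N M prod.case .
  then have ty: "well_typed ar t" "well_typed ar u" "src ar t = src ar u" "tgt ar t = tgt ar u"
    and ms: "distinct ms" "\<forall>m\<in>set ms. k \<le> m" "length ms = fresh ar u"
    and ix: "list_all (\<lambda>c. fst c < length laws) cs"
    by (simp_all add: list_all_iff)
  obtain N' where st: "steps ar laws xs (N, ys) cs = Some (N', zs)" and ro: "reordering N' M"
    using ch by (cases "steps ar laws xs (N, ys) cs") (simp_all split: prod.splits)
  have len: "length [0..k - 1] = length (src ar t)" by (simp add: k_def)
  have "distinct ([0..k - 1] @ [k..k + int (fresh ar t) - 1])" by auto
  note dt = draw_law[OF N[unfolded xs_def] ty(1) len this, folded xs_def]
  have "distinct ([0..k - 1] @ ms)" using ms by force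
  note du = draw_law[of u "[0..k - 1]" ms, folded ty(3), folded xs_def, OF M ty(2) len this ms(3)]
  have fresh: "set xs \<inter> set (outs K) = {}"
    if "draw ar v xs js = (K, us, r)" "well_typed ar v" "src ar v = src ar t" "distinct js"
       "\<forall>m\<in>set js. k \<le> m" "length js = fresh ar v" for v js K us r
  proof -
    have x: "map fst xs = src ar v" "distinct xs" using that(3) len by (simp_all add: xs_def distinct_zipI2)
    have s: "snd ` set xs \<subseteq> {0..k - 1}" by (auto simp: xs_def dest: set_zip_rightD)
    then have "snd ` set xs \<inter> set js = {}" using that(5) by force
    from draw_sound[OF that(1,2) x that(4) this] that(6) have "set js \<supseteq> snd ` set (outs K)" by auto
    then show ?thesis using s that(5) by force
  qed
  have xd: "distinct xs" by (simp add: xs_def distinct_zipI2)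
  have "valid xs (N, ys)"
    using dt fresh[OF N ty(1) refl] xd by (auto simp: valid_def)
  from steps_sound[OF st this assms(1) ix] dt
  have N': "wires.ok xs N' zs" "wires.sem xs N' zs = eval t" by (auto simp: valid_def)
  have "distinct (xs @ outs M)" using du fresh[OF M ty(2) ty(3)[symmetric] ms] xd by auto
  from wires.sem_reordering[OF ro N'(1) du(1) this] show ?thesis
    using ty du N'(2) by (simp add: equation_def)
qed

lemma equation_trans [trans]: "t \<simeq> u \<Longrightarrow> u \<simeq> v \<Longrightarrow> t \<simeq> v"
  by (simp add: equation_def)

lemma laws_Nil: "list_all (\<lambda>(l, r). l \<simeq> r) []"
  and laws_Cons: "l \<simeq> r \<Longrightarrow> list_all (\<lambda>(l, r). l \<simeq> r) laws \<Longrightarrow> list_all (\<lambda>(l, r). l \<simeq> r) ((l, r) # laws)"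
  by simp_all

lemmas laws_1 = laws_Cons[OF _ laws_Nil]
lemmas laws_2 = laws_Cons[OF _ laws_1]
lemmas laws_3 = laws_Cons[OF _ laws_2]
lemmas laws_4 = laws_Cons[OF _ laws_3]
lemmas laws_5 = laws_Cons[OF _ laws_4]
lemmas laws_6 = laws_Cons[OF _ laws_5]
lemmas laws_7 = laws_Cons[OF _ laws_6]
lemmas laws_8 = laws_Cons[OF _ laws_7]
lemmas laws_9 = laws_Cons[OF _ laws_8]
lemmas laws_10 = laws_Cons[OF _ laws_9]
lemmas laws_11 = laws_Cons[OF _ laws_10]
lemmas laws_12 = laws_Cons[OF _ laws_11]
lemmas laws_13 = laws_Cons[OF _ laws_12]

end

section \<open>A finite Hopf algebra and its dual as diagrams\<close>

datatype strand = Alg | Dua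

text \<open>
  The operations of \<open>H\<close> (\<open>Mul\<close> to \<open>Ant\<close>), a left inverse \<open>Inv\<close> of the antipode, evaluation and coevaluation, the
  operations of \<open>A = (H\<^sup>*)\<^sup>o\<^sup>p\<close>, the pairing \<open>\<tau>\<close> with its inverse \<open>\<tau>'\<close>, and the cross map \<open>X\<close>.
\<close>

datatype operation = Mul | Uni | Com | Cou | Ant | Inv | Eva | Coe
  | MulA | UniA | ComA | CouA | AntA | Pai | PaiInv | Cro

primrec arity :: "operation \<Rightarrow> strand list \<times> strand list" where
  "arity Mul = ([Alg, Alg], [Alg])"
| "arity Uni = ([], [Alg])"
| "arity Com = ([Alg], [Alg, Alg])"
| "arity Cou = ([Alg], [])"
| "arity Ant = ([Alg], [Alg])"
| "arity Inv = ([Alg], [Alg])"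
| "arity Eva = ([Dua, Alg], [])"
| "arity Coe = ([], [Alg, Dua])"
| "arity MulA = ([Dua, Dua], [Dua])"
| "arity UniA = ([], [Dua])"
| "arity ComA = ([Dua], [Dua, Dua])"
| "arity CouA = ([Dua], [])"
| "arity AntA = ([Dua], [Dua])"
| "arity Pai = ([Alg, Dua], [])"
| "arity PaiInv = ([Alg, Dua], [])"
| "arity Cro = ([Alg, Dua], [Dua, Alg])"

type_synonym picture = "(strand, operation) diagram"

abbreviation idH :: picture where "idH \<equiv> Idt [Alg]"
abbreviation idA :: picture where "idA \<equiv> Idt [Dua]"
abbreviation swapHH :: picture where "swapHH \<equiv> Swap [Alg] [Alg]"
abbreviation swapAA :: picture where "swapAA \<equiv> Swap [Dua] [Dua]"
abbreviation swapHA :: picture where "swapHA \<equiv> Swap [Alg] [Dua]"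
abbreviation swapAH :: picture where "swapAH \<equiv> Swap [Dua] [Alg]"

abbreviation unitD :: picture where
  "unitD \<equiv> Op UniA \<parallel> Op Uni"

abbreviation counitD :: picture where
  "counitD \<equiv> Op CouA \<parallel> Op Cou"

abbreviation idD :: picture where
  "idD \<equiv> Idt [Dua, Alg]"

abbreviation swapD :: picture where
  "swapD \<equiv> Swap [Dua, Alg] [Dua, Alg]"

text \<open>
  The two actions of \<open>H\<close> and \<open>A\<close> on each other that define the double cross product.
\<close>

abbreviation alpha :: picture where
  "alpha \<equiv> (Op Pai \<parallel> idA \<parallel> Op PaiInv) \<bullet> (idH \<parallel> idA \<parallel> swapHA \<parallel> idA) \<bullet>
    (idH \<parallel> swapHA \<parallel> Op ComA) \<bullet> (Op Com \<parallel> Op ComA)"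

abbreviation beta :: picture where
  "beta \<equiv> (Op Pai \<parallel> idH \<parallel> Op PaiInv) \<bullet> (idH \<parallel> swapHA \<parallel> idH \<parallel> idA) \<bullet>
    (Op Com \<parallel> swapHA \<parallel> idA) \<bullet> (Op Com \<parallel> Op ComA)"

text \<open>
  The multiplication of \<open>H\<^sup>*\<close>; that of \<open>A\<close> is its opposite.
\<close>

abbreviation mulStar :: picture where
  "mulStar \<equiv> Op MulA \<bullet> swapAA"

definition ant_transpose :: picture where
  "ant_transpose = (Op Eva \<parallel> idA) \<bullet> (idA \<parallel> Op Ant \<parallel> idA) \<bullet> (idA \<parallel> Op Coe)"

text \<open>
  \<open>Q(x) = \<Sum> \<langle>e\<^sup>i, w\<^sub>1\<rangle> w\<^sub>2\<close> with \<open>w = x S\<^sup>2(e\<^sub>i)\<close>. The dual \<open>H\<^sup>*\<close> is a Hopf module over \<open>H\<close> with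
  action \<open>(\<phi> \<cdot> h)(x) = \<phi>(x S(h))\<close> and with the coaction dual to left multiplication. Its projection
  onto coinvariants, \<open>\<phi> \<mapsto> \<phi>\<^sub>0 \<cdot> S(\<phi>\<^sub>1)\<close>, is \<open>\<phi> \<mapsto> \<phi> \<circ> Q\<close>.
\<close>

definition projection :: picture where
  "projection = (Op Eva \<parallel> idH) \<bullet> (idA \<parallel> Op Com) \<bullet> (idA \<parallel> Op Mul) \<bullet>
    (idA \<parallel> idH \<parallel> (Op Ant \<bullet> Op Ant)) \<bullet> Swap [Alg, Alg] [Dua] \<bullet> (idH \<parallel> Op Coe)"

text \<open>
  \<open>y \<mapsto> \<Sum> r\<^sub>1 \<langle>e\<^sup>i, Q(r\<^sub>2 y)\<rangle>\<close> with \<open>r = Q(S(e\<^sub>i))\<close>. For vector spaces \<open>Q\<close> is \<open>r \<otimes> \<lambda>\<close> for a suitable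
  integral \<open>r\<close> and cointegral \<open>\<lambda>\<close> with \<open>\<lambda>(S(r)) = 1\<close>, and this is the map
  \<open>y \<mapsto> r\<^sub>1 \<lambda>(r\<^sub>2 y)\<close>.
\<close>

definition retract :: picture where
  "retract = (idH \<parallel> Op Eva) \<bullet> (idH \<parallel> idA \<parallel> projection) \<bullet> (idH \<parallel> idA \<parallel> Op Mul) \<bullet>
    (idH \<parallel> Swap [Alg, Alg] [Dua]) \<bullet> (Op Com \<parallel> swapAH) \<bullet> (projection \<parallel> idA \<parallel> idH) \<bullet>
    (Op Ant \<parallel> idA \<parallel> idH) \<bullet> (Op Coe \<parallel> idH)"

definition comHA :: picture where
  "comHA = (idH \<parallel> swapHA \<parallel> idA) \<bullet> (Op Com \<parallel> Op ComA)"

definition mulD :: picture where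
  "mulD = (Op MulA \<parallel> Op Mul) \<bullet> (idA \<parallel> Op Cro \<parallel> idH)"

text \<open>
  The multiplication of the tensor square of the double.
\<close>

abbreviation mulDD :: picture where
  "mulDD \<equiv> (mulD \<parallel> mulD) \<bullet> (idD \<parallel> swapD \<parallel> idD)"

definition comD :: picture where
  "comD = (idA \<parallel> swapAH \<parallel> idH) \<bullet> (Op ComA \<parallel> Op Com)"

abbreviation copD :: picture where
  "copD \<equiv> swapD \<bullet> comD"

definition antD :: picture where
  "antD = Op Cro \<bullet> (Op Ant \<parallel> Op AntA) \<bullet> swapAH"

definition matrixD :: picture where
  "matrixD = Op UniA \<parallel> Op Coe \<parallel> Op Uni"

definition matrixD_inv :: picture where
  "matrixD_inv = Op UniA \<parallel> ((Op Ant \<parallel> idA) \<bullet> Op Coe) \<parallel> Op Uni"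

text \<open>
  A left inverse of \<open>f\<close> if there is one. The choice gives meaning to the diagrams with \<open>Inv\<close> and \<open>AntA\<close> before left
  inverses are known to exist.
\<close>

definition retraction :: "('o, 'm) btc \<Rightarrow> 'o \<Rightarrow> 'm \<Rightarrow> 'm" where
  "retraction C X f = (SOME g. g \<in> arrows C X X \<and>
     ((\<exists>k\<in>arrows C X X. compose C k f = identity C X) \<longrightarrow> compose C g f = identity C X))"

text \<open>
  The Hopf algebra \<open>H\<close> of the introduction is called \<open>K\<close>, and \<open>K'\<close> is the object \<open>H\<^sup>*\<close>.
\<close>

locale finite_hopf = strict_braided_category \<C>
  for \<C> :: "('o, 'm) btc" (structure) +
  fixes K :: "('o, 'm) bialg" and K' :: 'o and d b S :: 'm
  assumes K: "bialgebra \<C> K" and S: "antipode \<C> K S"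
    and dual: "left_dual \<C> (carr K) K' d b"
    and involutive: "\<chi> (carr K) (carr K) \<cdot> \<chi> (carr K) (carr K) = \<one> (carr K \<odot> carr K)"
begin

primrec obj :: "strand \<Rightarrow> 'o" where
  "obj Alg = carr K"
| "obj Dua = K'"

abbreviation A :: "('o, 'm) bialg" where "A \<equiv> opposite \<C> (dual_bialg \<C> K K' d b)"

definition S_dual :: 'm where
  "S_dual = (d \<otimes> \<one> K') \<cdot> (\<one> K' \<otimes> S \<otimes> \<one> K') \<cdot> (\<one> K' \<otimes> b)"

primrec mor :: "operation \<Rightarrow> 'm" where
  "mor Mul = mult K"
| "mor Uni = unit K"
| "mor Com = comult K"
| "mor Cou = counit K"
| "mor Ant = S"
| "mor Inv = retraction \<C> (carr K) S"
| "mor Eva = d"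
| "mor Coe = b"
| "mor MulA = mult A"
| "mor UniA = unit A"
| "mor ComA = comult A"
| "mor CouA = counit A"
| "mor AntA = retraction \<C> K' S_dual"
| "mor Pai = double_pairing \<C> K K' d"
| "mor PaiInv = double_pairing \<C> K K' d \<cdot> (retraction \<C> (carr K) S \<otimes> \<one> K')"
| "mor Cro =
    (double_pairing \<C> K K' d \<otimes> \<one> K' \<otimes> \<one> (carr K) \<otimes>
      (double_pairing \<C> K K' d \<cdot> (retraction \<C> (carr K) S \<otimes> \<one> K'))) \<cdot>
    (\<one> (carr K) \<otimes> \<chi> (carr K \<odot> carr K) (K' \<odot> K') \<otimes> \<one> K') \<cdot>
    (((\<one> (carr K) \<otimes> comult K) \<cdot> comult K) \<otimes> ((\<one> K' \<otimes> comult A) \<cdot> comult A))"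

lemma K_ob: "carr K \<in> Ob \<C>" "K' \<in> Ob \<C>"
  using dual unfolding left_dual_def by auto

lemma structure_hom:
  "mult K \<in> Hom (carr K \<odot> carr K) (carr K)" "unit K \<in> Hom \<I> (carr K)"
  "comult K \<in> Hom (carr K) (carr K \<odot> carr K)" "counit K \<in> Hom (carr K) \<I>"
  "S \<in> Hom (carr K) (carr K)" "d \<in> Hom (K' \<odot> carr K) \<I>" "b \<in> Hom \<I> (carr K \<odot> K')"
  using K S dual unfolding bialgebra_def algebra_def coalgebra_def antipode_def left_dual_def by auto

lemma obj_ob: "obj s \<in> Ob \<C>"
  by (cases s) (simp_all add: K_ob)

text \<open>
  The symmetry spreads from \<open>H\<close> to \<open>H\<^sup>*\<close> by two applications of \<open>dual_symmetric\<close>.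
\<close>

lemma symmetric: "\<chi> (obj t) (obj s) \<cdot> \<chi> (obj s) (obj t) = \<one> (obj s \<odot> obj t)"
proof -
  note KK = involutive
  note KD = dual_symmetric[OF dual K_ob(1) KK]
  note DD = dual_symmetric[OF dual K_ob(2) KD(1)]
  show ?thesis using KK KD DD by (cases s; cases t) simp_all
qed

interpretation words: symmetric_words \<C> obj
  by unfold_locales (rule obj_ob, rule symmetric)

lemmas unit_simps = tensor_obj_unit[OF K_ob(1)] tensor_obj_unit[OF K_ob(2)] tensor_obj_unit[OF unit_ob]

lemma words_arr:
  "words.arr (mult K) [Alg, Alg] [Alg]" "words.arr (unit K) [] [Alg]"
  "words.arr (comult K) [Alg] [Alg, Alg]" "words.arr (counit K) [Alg] []"
  "words.arr S [Alg] [Alg]" "words.arr d [Dua, Alg] []" "words.arr b [] [Alg, Dua]"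
  "words.arr (\<chi> K' K') [Dua, Dua] [Dua, Dua]" "words.arr (\<chi> (carr K) K') [Alg, Dua] [Dua, Alg]"
  using structure_hom braiding_hom K_ob by (simp_all add: words.arr_def unit_simps)

lemma arr_A:
  "words.arr (mult A) [Dua, Dua] [Dua]" "words.arr (unit A) [] [Dua]"
  "words.arr (comult A) [Dua] [Dua, Dua]" "words.arr (counit A) [Dua] []"
  "words.arr (mult (dual_bialg \<C> K K' d b)) [Dua, Dua] [Dua]"
proof -
  note T = words.arr_tensor and I = words.arr_ident and C = words.arr_comp
  have dA: "words.arr (d \<otimes> \<one> K') [Dua, Alg, Dua] [Dua]"
    using T[OF words_arr(6) I[of "[Dua]"]] by (simp add: unit_simps)
  have Ab: "words.arr (\<one> K' \<otimes> b) [Dua] [Dua, Alg, Dua]"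
    using T[OF I[of "[Dua]"] words_arr(7)] by (simp add: unit_simps)
  have AAb: "words.arr (\<one> (K' \<odot> K') \<otimes> b) [Dua, Dua] [Dua, Dua, Alg, Dua]"
    using T[OF I[of "[Dua, Dua]"] words_arr(7)] by (simp add: unit_simps)
  have AAcA: "words.arr (\<one> (K' \<odot> K') \<otimes> comult K \<otimes> \<one> K') [Dua, Dua, Alg, Dua] [Dua, Dua, Alg, Alg, Dua]"
    using T[OF I[of "[Dua, Dua]"] T[OF words_arr(3) I[of "[Dua]"]]] by (simp add: unit_simps)
  have AdH: "words.arr (\<one> K' \<otimes> d \<otimes> \<one> (carr K)) [Dua, Dua, Alg, Alg] [Dua, Alg]"
    using T[OF I[of "[Dua]"] T[OF words_arr(6) I[of "[Alg]"]]] by (simp add: unit_simps)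
  have tev: "words.arr (tensor_ev \<C> d (carr K) K' d \<otimes> \<one> K') [Dua, Dua, Alg, Alg, Dua] [Dua]"
    using T[OF C[OF AdH words_arr(6)] I[of "[Dua]"]] by (simp add: tensor_ev_def unit_simps)
  show star: "words.arr (mult (dual_bialg \<C> K K' d b)) [Dua, Dua] [Dua]"
    unfolding dual_bialg_def transpose_def using C[OF C[OF AAb AAcA] tev] by simp
  show "words.arr (mult A) [Dua, Dua] [Dua]"
    using C[OF words_arr(8) star] by (simp add: opposite_def dual_bialg_def)
  have "words.arr (counit K \<otimes> \<one> K') [Alg, Dua] [Dua]"
    using T[OF words_arr(4) I[of "[Dua]"]] by (simp add: unit_simps)
  from C[OF words_arr(7) this] show "words.arr (unit A) [] [Dua]"
    unfolding opposite_def dual_bialg_def transpose_def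
    using words.tensor_unit[OF C[OF words_arr(7) \<open>words.arr (counit K \<otimes> \<one> K') [Alg, Dua] [Dua]\<close>]]
      words.tensor_unit[OF words_arr(7)] words.tensor_unit[OF \<open>words.arr (counit K \<otimes> \<one> K') [Alg, Dua] [Dua]\<close>]
      words.tensor_unit[OF I[of "[Dua]"]] words.ident_comp[OF C[OF words_arr(7) \<open>words.arr (counit K \<otimes> \<one> K') [Alg, Dua] [Dua]\<close>]]
    by (simp add: unit_simps)
  have "words.arr (\<one> (carr K) \<otimes> b \<otimes> \<one> K') [Alg, Dua] [Alg, Alg, Dua, Dua]"
    using T[OF I[of "[Alg]"] T[OF words_arr(7) I[of "[Dua]"]]] by (simp add: unit_simps)
  from T[OF I[of "[Dua]"] C[OF words_arr(7) this]]
  have x: "words.arr (\<one> K' \<otimes> tensor_coev \<C> (carr K) K' b b) [Dua] [Dua, Alg, Alg, Dua, Dua]"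
    by (simp add: tensor_coev_def unit_simps)
  have y: "words.arr (\<one> K' \<otimes> mult K \<otimes> \<one> (K' \<odot> K')) [Dua, Alg, Alg, Dua, Dua] [Dua, Alg, Dua, Dua]"
    using T[OF I[of "[Dua]"] T[OF words_arr(1) I[of "[Dua, Dua]"]]] by (simp add: unit_simps)
  have z: "words.arr (d \<otimes> \<one> (K' \<odot> K')) [Dua, Alg, Dua, Dua] [Dua, Dua]"
    using T[OF words_arr(6) I[of "[Dua, Dua]"]] by (simp add: unit_simps)
  show "words.arr (comult A) [Dua] [Dua, Dua]"
    unfolding opposite_def dual_bialg_def transpose_def using C[OF C[OF x y] z] by simp
  have u: "words.arr (\<one> K' \<otimes> unit K) [Dua] [Dua, Alg]"
    using T[OF I[of "[Dua]"] words_arr(2)] by (simp add: unit_simps)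
  show "words.arr (counit A) [Dua] []"
    unfolding opposite_def dual_bialg_def transpose_def
    using words.tensor_unit[OF u] words.tensor_unit[OF words_arr(2)] words.tensor_unit[OF words_arr(6)]
      words.tensor_unit[OF I[of "[Dua]"]] words.comp_ident[OF u] C[OF u words_arr(6)]
    by (simp add: unit_simps)
qed

lemma retraction_hom:
  assumes "X \<in> Ob \<C>"
  shows "retraction \<C> X f \<in> Hom X X"
    and "g \<in> Hom X X \<Longrightarrow> g \<cdot> f = \<one> X \<Longrightarrow> retraction \<C> X f \<cdot> f = \<one> X"
proof -
  have "\<exists>g. g \<in> Hom X X \<and> ((\<exists>k\<in>Hom X X. k \<cdot> f = \<one> X) \<longrightarrow> g \<cdot> f = \<one> X)"
    using id_hom[OF assms] by blast
  note some = someI_ex[OF this, folded retraction_def]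
  show "retraction \<C> X f \<in> Hom X X" using some by blast
  show "g \<in> Hom X X \<Longrightarrow> g \<cdot> f = \<one> X \<Longrightarrow> retraction \<C> X f \<cdot> f = \<one> X" using some by blast
qed

lemma arr_pairing: "words.arr (double_pairing \<C> K K' d) [Alg, Dua] []"
  unfolding double_pairing_def using words.arr_comp[OF words_arr(9,6)] .

lemma arr_pairing_inverse:
  "words.arr (double_pairing \<C> K K' d \<cdot> (retraction \<C> (carr K) S \<otimes> \<one> K')) [Alg, Dua] []"
proof -
  have "words.arr (retraction \<C> (carr K) S) [Alg] [Alg]"
    using retraction_hom(1)[OF K_ob(1)] by (simp add: words.arr_def unit_simps)
  from words.arr_tensor[OF this words.arr_ident[of "[Dua]"]] show ?thesis
    using words.arr_comp[OF _ arr_pairing] by (simp add: unit_simps)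
qed

lemma arr_mor: "words.arr (mor p) (fst (arity p)) (snd (arity p))"
proof (cases p)
  case Inv
  then show ?thesis using retraction_hom(1)[OF K_ob(1)] by (simp add: words.arr_def unit_simps)
next
  case AntA
  then show ?thesis using retraction_hom(1)[OF K_ob(2)] by (simp add: words.arr_def unit_simps)
next
  case Cro
  note T = words.arr_tensor and I = words.arr_ident and C = words.arr_comp
  have "words.arr ((\<one> (carr K) \<otimes> comult K) \<cdot> comult K) [Alg] [Alg, Alg, Alg]"
    using C[OF words_arr(3), of "\<one> (carr K) \<otimes> comult K"] T[OF I[of "[Alg]"] words_arr(3)]
    by (simp add: unit_simps)
  moreover have "words.arr ((\<one> K' \<otimes> comult A) \<cdot> comult A) [Dua] [Dua, Dua, Dua]"
    using C[OF arr_A(3), of "\<one> K' \<otimes> comult A"] T[OF I[of "[Dua]"] arr_A(3)]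
    by (simp add: unit_simps)
  ultimately have 1: "words.arr (((\<one> (carr K) \<otimes> comult K) \<cdot> comult K) \<otimes> ((\<one> K' \<otimes> comult A) \<cdot> comult A))
      [Alg, Dua] [Alg, Alg, Alg, Dua, Dua, Dua]"
    using T by fastforce
  have 2: "words.arr (\<one> (carr K) \<otimes> \<chi> (carr K \<odot> carr K) (K' \<odot> K') \<otimes> \<one> K')
      [Alg, Alg, Alg, Dua, Dua, Dua] [Alg, Dua, Dua, Alg, Alg, Dua]"
    using T[OF I[of "[Alg]"] T[OF words.arr_swap[of "[Alg, Alg]" "[Dua, Dua]"] I[of "[Dua]"]]]
    by (simp add: unit_simps)
  have 3: "words.arr (double_pairing \<C> K K' d \<otimes> \<one> K' \<otimes> \<one> (carr K) \<otimes>
      (double_pairing \<C> K K' d \<cdot> (retraction \<C> (carr K) S \<otimes> \<one> K')))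
      [Alg, Dua, Dua, Alg, Alg, Dua] [Dua, Alg]"
    using T[OF arr_pairing T[OF I[of "[Dua]"] T[OF I[of "[Alg]"] arr_pairing_inverse]]]
    by (simp add: unit_simps)
  show ?thesis using C[OF C[OF 1 2] 3] Cro by simp
qed (use words_arr arr_A arr_pairing arr_pairing_inverse in simp_all)

sublocale string_diagrams \<C> obj arity mor
  by unfold_locales (use obj_ob symmetric arr_mor in \<open>simp_all add: words.arr_def\<close>)

notation equation (infix "\<simeq>" 50)

lemmas eval_simps = equation_def tensor_id K_ob tensor_ob unit_simps tensor_mor_unit(1)[OF id_hom[OF unit_ob]]

lemma equationD: "t \<simeq> u \<Longrightarrow> eval t = eval u"
  by (simp add: equation_def)

lemma mul_assoc: "Op Mul \<bullet> (Op Mul \<parallel> idH) \<simeq> Op Mul \<bullet> (idH \<parallel> Op Mul)"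
  and mul_unit_left: "Op Mul \<bullet> (Op Uni \<parallel> idH) \<simeq> idH"
  and mul_unit_right: "Op Mul \<bullet> (idH \<parallel> Op Uni) \<simeq> idH"
  and com_assoc: "(Op Com \<parallel> idH) \<bullet> Op Com \<simeq> (idH \<parallel> Op Com) \<bullet> Op Com"
  and com_counit_left: "(Op Cou \<parallel> idH) \<bullet> Op Com \<simeq> idH"
  and com_counit_right: "(idH \<parallel> Op Cou) \<bullet> Op Com \<simeq> idH"
  and com_unit: "Op Com \<bullet> Op Uni \<simeq> Op Uni \<parallel> Op Uni"
  and counit_mul: "Op Cou \<bullet> Op Mul \<simeq> Op Cou \<parallel> Op Cou"
  and counit_unit: "Op Cou \<bullet> Op Uni \<simeq> Idt []"
  using K unfolding bialgebra_def algebra_def coalgebra_def by (simp_all add: eval_simps)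

text \<open>
  Diagrams that differ only in bracketing draw the same network, so the empty certificate relates them.
\<close>

lemma com_mul: "Op Com \<bullet> Op Mul \<simeq>
    (Op Mul \<parallel> Op Mul) \<bullet> (idH \<parallel> Swap [Alg] [Alg] \<parallel> idH) \<bullet> (Op Com \<parallel> Op Com)"
proof (rule equation_trans)
  show "Op Com \<bullet> Op Mul \<simeq>
    ((Op Mul \<parallel> Op Mul) \<bullet> (idH \<parallel> Swap [Alg] [Alg] \<parallel> idH)) \<bullet> (Op Com \<parallel> Op Com)"
    using K unfolding bialgebra_def tensor_mult_def by (simp add: eval_simps)
qed (rule derivation[OF laws_Nil, where ms = "[2,3,4,5,6,7]" and cs = "[]"], code_simp)

lemma ant_left: "Op Mul \<bullet> (Op Ant \<parallel> idH) \<bullet> Op Com \<simeq> Op Uni \<bullet> Op Cou"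
  and ant_right: "Op Mul \<bullet> (idH \<parallel> Op Ant) \<bullet> Op Com \<simeq> Op Uni \<bullet> Op Cou"
  using S unfolding antipode_def by (simp_all add: eval_simps)

lemma snake_dual: "(Op Eva \<parallel> idA) \<bullet> (idA \<parallel> Op Coe) \<simeq> idA"
  and snake: "(idH \<parallel> Op Eva) \<bullet> (Op Coe \<parallel> idH) \<simeq> idH"
  using dual unfolding left_dual_def by (simp_all add: eval_simps)

lemma mulA_def: "Op MulA \<simeq> ((Op Eva \<bullet> (idA \<parallel> Op Eva \<parallel> idH)) \<parallel> idA) \<bullet>
    (idA \<parallel> idA \<parallel> Op Com \<parallel> idA) \<bullet> (idA \<parallel> idA \<parallel> Op Coe) \<bullet> Swap [Dua] [Dua]"
  (is "_ \<simeq> ?t \<bullet> ?u \<bullet> ?v \<bullet> ?w")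
proof (rule equation_trans)
  show "Op MulA \<simeq> (?t \<bullet> (Idt [Dua, Dua] \<parallel> Op Com \<parallel> idA) \<bullet> (Idt [Dua, Dua] \<parallel> Op Coe)) \<bullet> ?w"
    by (simp add: eval_simps opposite_def dual_bialg_def transpose_def tensor_ev_def)
qed (rule derivation[OF laws_Nil, where ms = "[2,3,4,5]" and cs = "[]"], code_simp)

lemma unitA_def: "Op UniA \<simeq> (Op Cou \<parallel> idA) \<bullet> Op Coe"
proof (rule equation_trans)
  show "Op UniA \<simeq> (Idt [] \<parallel> idA) \<bullet> (Idt [] \<parallel> Op Cou \<parallel> idA) \<bullet> (Idt [] \<parallel> Op Coe)"
    by (simp add: eval_simps opposite_def dual_bialg_def transpose_def)
qed (rule derivation[OF laws_Nil, where ms = "[0,1]" and cs = "[]"], code_simp)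

lemma comA_def: "Op ComA \<simeq> (Op Eva \<parallel> idA \<parallel> idA) \<bullet> (idA \<parallel> Op Mul \<parallel> idA \<parallel> idA) \<bullet>
    (idA \<parallel> ((idH \<parallel> Op Coe \<parallel> idA) \<bullet> Op Coe))"
proof (rule equation_trans)
  show "Op ComA \<simeq> (Op Eva \<parallel> Idt [Dua, Dua]) \<bullet> (idA \<parallel> Op Mul \<parallel> Idt [Dua, Dua]) \<bullet>
    (idA \<parallel> ((idH \<parallel> Op Coe \<parallel> idA) \<bullet> Op Coe))"
    by (simp add: eval_simps opposite_def dual_bialg_def transpose_def tensor_coev_def)
qed (rule derivation[OF laws_Nil, where ms = "[1,2,3,4,5]" and cs = "[]"], code_simp)

lemma counitA_def: "Op CouA \<simeq> Op Eva \<bullet> (idA \<parallel> Op Uni)"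
proof (rule equation_trans)
  show "Op CouA \<simeq> (Op Eva \<parallel> Idt []) \<bullet> (idA \<parallel> Op Uni \<parallel> Idt []) \<bullet> (idA \<parallel> Idt [])"
    by (simp add: eval_simps opposite_def dual_bialg_def transpose_def)
qed (rule derivation[OF laws_Nil, where ms = "[1]" and cs = "[]"], code_simp)

section \<open>The antipode reverses products and coproducts\<close>

text \<open>
  Products and coproducts are nested to the right in normal forms. There \<open>h\<^sub>1 S(h\<^sub>2)\<close> may be followed by a
  further factor, or \<open>h\<^sub>2\<close> by a further part of the same coproduct; in both cases the two boxes at
  the core of the axiom are no longer adjacent, so these cases are laws of their own.
\<close>

lemma ant_right_mul:
  "Op Mul \<bullet> (idH \<parallel> Op Mul) \<bullet> (((idH \<parallel> Op Ant) \<bullet> Op Com) \<parallel> idH) \<simeq> Op Cou \<parallel> idH"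
  by (rule derivation[OF laws_3[OF mul_assoc ant_right mul_unit_left],
      where ms = "[]" and
      cs = "[(0,bw,[2,4,1],[5,6],[7,8]), (1,fw,[0],[2,3,4,7],[5]), (2,fw,[1],[5,8],[])]"])
        code_simp

lemma ant_right_com:
  "((Op Mul \<bullet> (idH \<parallel> Op Ant)) \<parallel> idH) \<bullet> (idH \<parallel> Op Com) \<bullet> Op Com \<simeq> Op Uni \<parallel> idH"
  by (rule derivation[OF laws_3[OF com_assoc ant_right com_counit_left],
      where ms = "[1]" and
      cs = "[(0,bw,[0],[1,2,3,4],[7,8,9,10]), (1,fw,[7],[9,10,5,6],[1]), (2,fw,[0],[7,8],[])]"])
        code_simp

text \<open>
  \<open>S(1) = S(1) 1 = \<epsilon>(1) 1\<close>.
\<close>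

lemma ant_unit:
  "Op Ant \<bullet> Op Uni \<simeq> Op Uni"
  by (rule derivation[OF laws_4[OF mul_unit_right com_unit ant_left counit_unit],
      where ms = "[0]" and
      cs = "[(0,bw,[0],[],[2,3]), (0,fw,[0],[2,3],[]), (0,bw,[1],[],[2,3]),
        (1,bw,[],[0,2],[4,5,6]), (2,fw,[4],[5,6,1,3],[0]), (3,fw,[],[4],[])]"]) code_simp

lemma counit_ant:
  "Op Cou \<bullet> Op Ant \<simeq> Op Cou"
  by (rule derivation[OF laws_4[OF com_counit_right counit_mul ant_left counit_unit],
      where ms = "[]" and
      cs = "[(0,bw,[0],[],[2,3]), (1,bw,[1,3],[],[4]), (2,fw,[0],[2,3,1,4],[5]),
        (3,fw,[],[5],[])]"]) code_simp

text \<open>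
  Both sides are convolution inverse to the multiplication. Concretely,
  \<open>S(h\<^sub>1 g\<^sub>1) (h\<^sub>2 g\<^sub>2) (S(g\<^sub>3) S(h\<^sub>3))\<close> collapses from the right to \<open>S(hg)\<close> and from the left
  to \<open>S(g) S(h)\<close>.
\<close>

lemma ant_mul:
  "Op Ant \<bullet> Op Mul \<simeq> Op Mul \<bullet> swapHH \<bullet> (Op Ant \<parallel> Op Ant)"
proof -
  have
    "Op Ant \<bullet> Op Mul \<simeq>
      Op Mul \<bullet>
      ((Op Mul \<bullet> (Op Ant \<parallel> idH) \<bullet> Op Com \<bullet> Op Mul) \<parallel>
      (Op Mul \<bullet> swapHH \<bullet> (Op Ant \<parallel> Op Ant))) \<bullet>
      (idH \<parallel> swapHH \<parallel> idH) \<bullet> (Op Com \<parallel> Op Com)"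
    by (rule derivation[OF laws_7[OF com_counit_right mul_unit_right ant_right ant_right_mul
        com_assoc mul_assoc com_mul],
        where ms = "[4,5,18,19,7,9,13,3,10,12,15,16,11]" and
        cs = "[(0,bw,[1],[],[4,5]), (0,bw,[0],[],[6,7]), (1,bw,[3],[],[8,9]),
          (2,bw,[7],[8],[10,11,12,13]), (3,bw,[5,12],[],[8,14,15,16,17]),
          (4,bw,[1],[4,5,8,14],[18,19,20,21]), (4,bw,[0],[6,7,10,11],[4,5,8,14]),
          (5,bw,[14,21,16],[17,13],[6,7]), (5,bw,[3,6,16],[7,9],[10,11]),
          (6,bw,[4,18],[8,14,20,21,2,6],[7,9,13])]"]) code_simp
  also have
    "\<dots> \<simeq> Op Mul \<bullet> swapHH \<bullet> (Op Ant \<parallel> Op Ant)"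
    by (rule derivation[OF laws_4[OF ant_left counit_mul mul_unit_left com_counit_left],
        where ms = "[11,12,13]" and
        cs = "[(0,fw,[6],[7,8,9,10],[15]), (1,fw,[2,4],[6],[]), (2,fw,[13],[15,14],[]),
          (3,fw,[0],[2,3],[]), (3,fw,[1],[4,5],[])]"]) code_simp
  finally show ?thesis .
qed

text \<open>
  The dual argument: \<open>\<Delta>(S(h\<^sub>1)) \<Delta>(h\<^sub>2) (S(h\<^sub>4) \<otimes> S(h\<^sub>3))\<close> is computed in two ways.
\<close>

lemma com_ant:
  "Op Com \<bullet> Op Ant \<simeq> swapHH \<bullet> (Op Ant \<parallel> Op Ant) \<bullet> Op Com"
proof -
  have
    "Op Com \<bullet> Op Ant \<simeq>
      (Op Mul \<parallel> Op Mul) \<bullet> (idH \<parallel> swapHH \<parallel> idH) \<bullet>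
      ((Op Com \<bullet> Op Mul \<bullet> (Op Ant \<parallel> idH) \<bullet> Op Com) \<parallel>
      (swapHH \<bullet> (Op Ant \<parallel> Op Ant) \<bullet> Op Com)) \<bullet>
      Op Com"
    by (rule derivation[OF laws_7[OF com_counit_right mul_unit_right ant_right ant_right_com
        com_assoc mul_assoc com_mul],
        where ms = "[6,10,11,14,1,7,13,18,15,16,17,12,9,5]" and
        cs = "[(0,bw,[0],[],[4,5]), (1,bw,[2],[],[6,7]), (1,bw,[3],[],[8,9]),
          (2,bw,[5],[6],[10,11,12,13]), (3,bw,[11],[8],[6,14,15,16,17,18]),
          (4,bw,[5],[10,11,6,14],[8,19,20,21]), (4,bw,[0],[4,5,8,19],[6,10,11,14]),
          (5,bw,[3,21,17],[18,9],[4,5]), (5,bw,[2,20,12],[13,7],[8,9]),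
          (6,bw,[1,14],[2,3,20,21,8,4],[7,13,18])]"]) code_simp
  also have
    "\<dots> \<simeq> swapHH \<bullet> (Op Ant \<parallel> Op Ant) \<bullet> Op Com"
    by (rule derivation[OF laws_4[OF ant_left com_unit mul_unit_left com_counit_left],
        where ms = "[9,10,11,12]" and
        cs = "[(0,fw,[1],[3,4,5,6],[15]), (1,fw,[],[15,7,8],[3,4]), (2,fw,[12],[3,13],[]),
          (2,fw,[11],[4,14],[]), (3,fw,[0],[1,2],[])]"]) code_simp
  finally show ?thesis .
qed

section \<open>Evaluation, coevaluation and the structure of the dual\<close>

text \<open>
  \<open>\<langle>xy, h\<rangle> = \<langle>x, h\<^sub>1\<rangle>\<langle>y, h\<^sub>2\<rangle>\<close>: this law and the following ones restate the definition of the
  transposes without coevaluations.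
\<close>

lemma eva_mulA:
  "Op Eva \<bullet> (Op MulA \<parallel> idH) \<simeq> Op Eva \<bullet> (idA \<parallel> Op Eva \<parallel> idH) \<bullet> (swapAA \<parallel> Op Com)"
  by (rule derivation[OF laws_2[OF mulA_def snake],
      where ms = "[6,7]" and
      cs = "[(0,fw,[0,1],[3],[4,5,6,7]), (1,fw,[2],[4,5],[])]"]) code_simp

lemma eva_unitA:
  "Op Eva \<bullet> (Op UniA \<parallel> idH) \<simeq> Op Cou"
  by (rule derivation[OF laws_2[OF unitA_def snake],
      where ms = "[]" and
      cs = "[(0,fw,[],[1],[2,3]), (1,fw,[0],[2,3],[])]"]) code_simp

text \<open>
  \<open>\<langle>x\<^sub>1, g\<rangle>\<langle>x\<^sub>2, h\<rangle> = \<langle>x, hg\<rangle>\<close>: the comultiplication of \<open>A\<close> is co-opposite to the usual one because the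
  dual of \<open>H \<otimes> H\<close> is formed by nesting evaluations.
\<close>

lemma eva_comA:
  "(Op Eva \<parallel> Op Eva) \<bullet> (idA \<parallel> Swap [Dua, Alg] [Alg]) \<bullet> (Op ComA \<parallel> idH \<parallel> idH) \<simeq>
    Op Eva \<bullet> (idA \<parallel> Op Mul)"
  by (rule derivation[OF laws_2[OF comA_def snake],
      where ms = "[9]" and
      cs = "[(0,fw,[0],[3,4],[5,6,7,8,9]), (1,fw,[1],[5,6],[]), (1,fw,[2],[7,8],[])]"]) code_simp

text \<open>
  \<open>e\<^sub>i\<^sub>1 \<otimes> e\<^sub>i\<^sub>2 \<otimes> e\<^sup>i = e\<^sub>i \<otimes> e\<^sub>j \<otimes> e\<^sup>i e\<^sup>j\<close>.
\<close>

lemma coe_com: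
  "(Op Com \<parallel> idA) \<bullet> Op Coe \<simeq>
    (idH \<parallel> idH \<parallel> Op MulA) \<bullet> (idH \<parallel> swapAH \<parallel> idA) \<bullet> (Op Coe \<parallel> Op Coe)"
  by (rule derivation[OF laws_2[OF snake mulA_def],
      where ms = "[6,7,4,5,8]" and
      cs = "[(0,bw,[3],[],[4,5]), (0,bw,[2],[],[6,7]), (1,bw,[7,5],[0,1,2,3],[8])]"]) code_simp

text \<open>
  \<open>e\<^sub>i \<otimes> e\<^sup>i\<^sub>1 \<otimes> e\<^sup>i\<^sub>2 = e\<^sub>i e\<^sub>j \<otimes> e\<^sup>j \<otimes> e\<^sup>i\<close>.
\<close>

lemma coe_comA:
  "(idH \<parallel> Op ComA) \<bullet> Op Coe \<simeq> (Op Mul \<parallel> idA \<parallel> idA) \<bullet> (idH \<parallel> Op Coe \<parallel> idA) \<bullet> Op Coe"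
  by (rule derivation[OF laws_2[OF comA_def snake],
      where ms = "[4,5,6,7,8]" and
      cs = "[(0,fw,[1],[2,3],[4,5,6,7,8]), (1,fw,[8],[0,1],[])]"]) code_simp

lemma coe_cou:
  "(Op Cou \<parallel> idA) \<bullet> Op Coe \<simeq> Op UniA"
  by (rule derivation[OF laws_1[OF unitA_def],
      where ms = "[2]" and
      cs = "[(0,bw,[],[0,1],[2])]"]) code_simp

section \<open>The opposite dual bialgebra\<close>

text \<open>
  After unfolding the transposes, each axiom of \<open>A\<close> reduces by the snake identities to the dual axiom
  of \<open>H\<close>.
\<close>

lemma mulA_assoc:
  "Op MulA \<bullet> (Op MulA \<parallel> idA) \<simeq> Op MulA \<bullet> (idA \<parallel> Op MulA)"
  by (rule derivation[OF laws_3[OF mulA_def snake com_assoc],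
      where ms = "[3,10]" and
      cs = "[(0,fw,[0,1],[3],[5,6,7,8]), (0,fw,[6,2],[4],[3,9,10,11]), (1,fw,[10],[5,6],[]),
        (2,fw,[3],[10,11,7,8],[4,5,6,12]), (1,bw,[5],[],[7,8]), (0,bw,[0,8],[3,9,4,5],[10]),
        (0,bw,[1,2],[7,8,6,12],[3])]"]) code_simp

lemma mulA_unit_left:
  "Op MulA \<bullet> (Op UniA \<parallel> idA) \<simeq> idA"
  by (rule derivation[OF laws_5[OF mulA_def unitA_def snake com_counit_left snake_dual],
      where ms = "[]" and
      cs = "[(0,fw,[1,0],[2],[3,4,5,6]), (1,fw,[],[1],[2,7]), (2,fw,[5],[2,7],[]),
        (3,fw,[3],[5,6],[]), (4,fw,[0],[3,4],[])]"]) code_simp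

lemma mulA_unit_right:
  "Op MulA \<bullet> (idA \<parallel> Op UniA) \<simeq> idA"
  by (rule derivation[OF laws_5[OF mulA_def unitA_def snake com_counit_right snake_dual],
      where ms = "[]" and
      cs = "[(0,fw,[0,1],[2],[3,4,5,6]), (1,fw,[],[1],[2,7]), (2,fw,[6],[2,7],[]),
        (3,fw,[3],[5,6],[]), (4,fw,[0],[3,4],[])]"]) code_simp

lemma comA_assoc:
  "(Op ComA \<parallel> idA) \<bullet> Op ComA \<simeq> (idA \<parallel> Op ComA) \<bullet> Op ComA"
  by (rule derivation[OF laws_3[OF comA_def snake mul_assoc],
      where ms = "[1,2,9,12]" and
      cs = "[(0,fw,[0],[1,2],[5,6,7,8,9]), (0,fw,[8],[3,4],[1,2,10,11,12]), (1,fw,[12],[7,8],[]),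
        (2,bw,[5,1,10],[12,9],[3,4]), (1,bw,[3],[],[7,8]), (0,bw,[8],[5,6,1,2,3],[9,12]),
        (0,bw,[0],[7,8,10,11,4],[1,2])]"]) code_simp

lemma comA_counit_left:
  "(Op CouA \<parallel> idA) \<bullet> Op ComA \<simeq> idA"
  by (rule derivation[OF laws_5[OF comA_def counitA_def snake mul_unit_right snake_dual],
      where ms = "[]" and
      cs = "[(0,fw,[0],[1,2],[3,4,5,6,7]), (1,fw,[6],[],[1]), (2,fw,[1],[5,6],[]),
        (3,fw,[3],[1,7],[]), (4,fw,[0],[3,4],[])]"]) code_simp

lemma comA_counit_right:
  "(idA \<parallel> Op CouA) \<bullet> Op ComA \<simeq> idA"
  by (rule derivation[OF laws_5[OF comA_def counitA_def snake mul_unit_left snake_dual],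
      where ms = "[]" and
      cs = "[(0,fw,[0],[1,2],[3,4,5,6,7]), (1,fw,[4],[],[1]), (2,fw,[1],[3,4],[]),
        (3,fw,[5],[1,7],[]), (4,fw,[0],[5,6],[])]"]) code_simp

lemma comA_mulA:
  "Op ComA \<bullet> Op MulA \<simeq> (Op MulA \<parallel> Op MulA) \<bullet> (idA \<parallel> swapAA \<parallel> idA) \<bullet> (Op ComA \<parallel> Op ComA)"
  by (rule derivation[OF laws_4[OF mulA_def comA_def snake com_mul],
      where ms = "[7,8,20,21,2,12]" and
      cs = "[(0,fw,[0,1],[2],[5,6,7,8]), (1,fw,[6],[3,4],[2,9,10,11,12]), (2,fw,[12],[5,6],[]),
        (3,fw,[2,10],[12,7,8],[3,4,5,6,13,14]), (2,bw,[6],[],[7,8]), (2,bw,[4],[],[12,15]),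
        (2,bw,[5],[],[16,17]), (2,bw,[3],[],[18,19]), (1,bw,[1],[12,15,7,8,14],[20,21]),
        (1,bw,[0],[18,19,16,17,13],[7,8]), (0,bw,[8,21],[2,9,3,4],[12]),
        (0,bw,[7,20],[10,11,5,6],[2])]"]) code_simp

lemma comA_unitA:
  "Op ComA \<bullet> Op UniA \<simeq> Op UniA \<parallel> Op UniA"
  by (rule derivation[OF laws_4[OF unitA_def comA_def snake counit_mul],
      where ms = "[0,1]" and
      cs = "[(0,fw,[],[0],[3,4]), (1,fw,[4],[1,2],[0,5,6,7,8]), (2,fw,[8],[3,4],[]),
        (3,fw,[0,6],[8],[]), (0,bw,[],[0,5],[1]), (0,bw,[],[6,7],[0])]"]) code_simp

lemma counitA_mulA:
  "Op CouA \<bullet> Op MulA \<simeq> Op CouA \<parallel> Op CouA"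
  by (rule derivation[OF laws_4[OF mulA_def counitA_def snake com_unit],
      where ms = "[]" and
      cs = "[(0,fw,[0,1],[2],[3,4,5,6]), (1,fw,[4],[],[2]), (2,fw,[2],[3,4],[]),
        (3,fw,[],[2,5,6],[3,4]), (1,bw,[1],[4],[]), (1,bw,[0],[3],[])]"]) code_simp

lemma counitA_unitA:
  "Op CouA \<bullet> Op UniA \<simeq> Idt []"
  by (rule derivation[OF laws_4[OF unitA_def counitA_def snake counit_unit],
      where ms = "[]" and
      cs = "[(0,fw,[],[0],[1,2]), (1,fw,[2],[],[0]), (2,fw,[0],[1,2],[]), (3,fw,[],[0],[])]"])
        code_simp

section \<open>The dual Hopf algebra\<close>

lemma star_assoc:
  "mulStar \<bullet> (mulStar \<parallel> idA) \<simeq> mulStar \<bullet> (idA \<parallel> mulStar)"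
  by (rule derivation[OF laws_1[OF mulA_assoc],
      where ms = "[5,6]" and
      cs = "[(0,bw,[2,1,0],[3,4],[5,6])]"]) code_simp

lemma star_unit_left:
  "mulStar \<bullet> (Op UniA \<parallel> idA) \<simeq> idA"
  by (rule derivation[OF laws_1[OF mulA_unit_right],
      where ms = "[]" and
      cs = "[(0,fw,[0],[1,2],[])]"]) code_simp

lemma star_unit_right:
  "mulStar \<bullet> (idA \<parallel> Op UniA) \<simeq> idA"
  by (rule derivation[OF laws_1[OF mulA_unit_left],
      where ms = "[]" and
      cs = "[(0,fw,[0],[1,2],[])]"]) code_simp

lemma comA_star:
  "Op ComA \<bullet> mulStar \<simeq> ((mulStar \<parallel> mulStar) \<bullet> (idA \<parallel> swapAA \<parallel> idA)) \<bullet> (Op ComA \<parallel> Op ComA)"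
  by (rule derivation[OF laws_1[OF comA_mulA],
      where ms = "[7,8,5,6,9,10]" and
      cs = "[(0,fw,[1,0],[2,3,4],[5,6,7,8,9,10])]"]) code_simp

lemma counitA_star:
  "Op CouA \<bullet> mulStar \<simeq> Op CouA \<parallel> Op CouA"
  by (rule derivation[OF laws_1[OF counitA_mulA],
      where ms = "[]" and
      cs = "[(0,fw,[1,0],[2],[])]"]) code_simp

text \<open>
  The opposite multiplication exchanges the two sides: the left axiom of the transposed antipode comes
  from the right axiom of \<open>S\<close>.
\<close>

lemma star_ant_left:
  "mulStar \<bullet> (ant_transpose \<parallel> idA) \<bullet> Op ComA \<simeq> Op UniA \<bullet> Op CouA"
  by (rule derivation[OF laws_6[OF mulA_def comA_def snake ant_right counitA_def unitA_def],
      where ms = "[1]" and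
      cs = "[(0,fw,[2,4],[6],[7,8,9,10]), (1,fw,[0],[1,2],[6,11,12,13,14]), (2,fw,[10],[3,4],[]),
        (2,fw,[9],[6,11],[]), (2,fw,[5],[12,13],[]), (3,fw,[7],[9,10,5,14],[1]),
        (4,bw,[0],[1],[]), (5,bw,[],[7,8],[1])]"]) code_simp

lemma star_ant_right:
  "mulStar \<bullet> (idA \<parallel> ant_transpose) \<bullet> Op ComA \<simeq> Op UniA \<bullet> Op CouA"
  by (rule derivation[OF laws_6[OF mulA_def comA_def snake ant_left counitA_def unitA_def],
      where ms = "[1]" and
      cs = "[(0,fw,[4,1],[6],[7,8,9,10]), (1,fw,[0],[1,2],[6,11,12,13,14]), (2,fw,[9],[3,4],[]),
        (2,fw,[5],[6,11],[]), (2,fw,[10],[12,13],[]), (3,fw,[7],[9,10,5,14],[1]),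
        (4,bw,[0],[1],[]), (5,bw,[],[7,8],[1])]"]) code_simp

section \<open>The projection onto integrals\<close>

text \<open>
  \<open>y\<^sub>1 \<otimes> y\<^sub>2 S(g) = (y S(g\<^sub>1))\<^sub>1 g\<^sub>2 \<otimes> (y S(g\<^sub>1))\<^sub>2\<close>. This is the compatibility of action and coaction of the
  Hopf module \<open>H\<^sup>*\<close>, transposed to \<open>H\<close>.
\<close>

lemma shift_ant:
  "(idH \<parallel> Op Mul) \<bullet> (Op Com \<parallel> Op Ant) \<simeq>
    (Op Mul \<parallel> idH) \<bullet> (idH \<parallel> swapHH) \<bullet> ((Op Com \<bullet> Op Mul \<bullet> (idH \<parallel> Op Ant)) \<parallel> idH) \<bullet>
    (idH \<parallel> Op Com)"
  by (rule derivation[OF laws_7[OF com_counit_right mul_unit_right ant_left com_assoc mul_assoc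
      com_ant com_mul],
      where ms = "[8,14,9,4,12,13,7]" and
      cs = "[(0,bw,[1],[],[6,7]), (1,bw,[2],[],[8,9]), (2,bw,[7],[8],[10,11,12,13]),
        (3,bw,[1],[6,7,10,11],[8,14,15,16]), (4,bw,[2,12,14],[13,9],[6,7]),
        (5,bw,[8],[15,16,4,12],[9,10,11]), (6,bw,[0,9],[2,3,10,11,6,5],[4,12,13])]"]) code_simp

lemma ant_ant_left:
  "Op Mul \<bullet> ((Op Ant \<bullet> Op Ant) \<parallel> Op Ant) \<bullet> swapHH \<bullet> Op Com \<simeq> Op Uni \<bullet> Op Cou"
  by (rule derivation[OF laws_3[OF ant_mul ant_right ant_unit],
      where ms = "[1]" and
      cs = "[(0,bw,[1,3],[5,4,6],[7,8]), (1,fw,[0],[1,2,3,7],[4]), (2,fw,[],[4,8],[1])]"])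
        code_simp

text \<open>
  The projection annihilates the action. With \<open>w = x S\<^sup>2(e\<^sub>i) S(h\<^sub>1)\<close>, \<open>shift_ant\<close> gives
  \<open>Q(x) S(h) = \<langle>e\<^sup>i, w\<^sub>1 h\<^sub>2\<rangle> w\<^sub>2\<close>. The factor \<open>h\<^sub>2\<close> moves through the dual bases from \<open>e\<^sup>i\<close> to \<open>e\<^sub>i\<close>, where
  it meets \<open>S(h\<^sub>1)\<close> in \<open>S\<^sup>2(h\<^sub>2) S(h\<^sub>1) = \<epsilon>(h)\<close>.
\<close>

lemma projection_ant:
  "Op Mul \<bullet> (projection \<parallel> Op Ant) \<simeq> projection \<parallel> Op Cou"
  by (rule derivation[OF laws_8[OF shift_ant eva_comA coe_comA snake ant_mul mul_assoc
      ant_ant_left mul_unit_right],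
      where ms = "[9,10,2,8,7,15,16]" and
      cs = "[(0,fw,[6,1],[7,8,9,10],[11,12,13,14,15,16,17]), (1,bw,[3,15,12],[17],[7,8]),
        (2,fw,[],[2,3,7,8],[9,10,17,18,19]), (3,fw,[12],[17,18],[]), (4,fw,[9,12],[19,4],[2,3,7]),
        (4,fw,[3,2],[7,5],[4,8,17]), (5,fw,[0,17,13],[6,14],[5,7]), (5,fw,[8,4,13],[17,5],[6,14]),
        (6,fw,[1],[11,12,3,4,13,6],[5]), (7,fw,[8],[5,14],[])]"]) code_simp

text \<open>
  The image of the projection is coinvariant: \<open>x\<^sub>1 \<otimes> Q(x\<^sub>2) = 1 \<otimes> Q(x)\<close>. By \<open>shift_ant\<close> with \<open>g = S(e\<^sub>i)\<close>,
  and moving the coproduct of \<open>e\<^sub>i\<close> through the dual bases, the first leg becomes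
  \<open>w\<^sub>1 S(w\<^sub>2)\<close> for \<open>w = x S\<^sup>2(e\<^sub>j)\<close>.
\<close>

lemma com_projection:
  "(idH \<parallel> projection) \<bullet> Op Com \<simeq> Op Uni \<parallel> projection"
  by (rule derivation[OF laws_7[OF shift_ant com_ant coe_com eva_mulA snake com_assoc
      ant_right_com],
      where ms = "[1,11,17,7,12,13,5,10]" and
      cs = "[(0,fw,[0,5],[1,2,6,7],[10,11,12,13,14,15,16]), (1,fw,[3],[5,10,11],[1,2,6,7]),
        (2,fw,[],[3,4,1,2],[5,10,11,17,18]), (3,fw,[10,17,8],[18],[1,2]), (4,fw,[1],[5,10],[]),
        (5,fw,[15],[8,9,1,2],[3,4,5,10]), (6,fw,[13],[14,15,3,4,6,16],[1])]"]) code_simp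

text \<open>
  In \<open>Q(Q(x)) = \<langle>e\<^sup>i, w\<^sub>1\<rangle> Q(w\<^sub>2)\<close> coinvariance replaces \<open>w\<^sub>1\<close> by \<open>1\<close>, hence \<open>e\<^sub>i\<close> by \<open>1\<close>.
\<close>

lemma projection_idem:
  "projection \<bullet> projection \<simeq> projection"
  by (rule derivation[OF laws_4[OF com_projection snake ant_unit mul_unit_right],
      where ms = "[16,17,18,19,20,21,22]" and
      cs = "[(0,fw,[5],[6,7,8,9,10,11,12,13,14],[15,16,17,18,19,20,21,22]), (1,fw,[15],[1,2],[]),
        (2,fw,[],[15,3],[1]), (2,fw,[],[1,4],[2]), (3,fw,[0],[2,5],[])]"]) code_simp

text \<open>
  \<open>\<Sum> \<langle>e\<^sup>i, Q(S(e\<^sub>i))\<rangle> = 1\<close>, the normalisation that makes \<open>Q\<close> usable: the trace is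
  \<open>\<langle>e\<^sup>j e\<^sup>i, S(S(e\<^sub>j) e\<^sub>i)\<rangle>\<close>, and gathering the two dual bases into one gives
  \<open>\<langle>e\<^sup>k, S(S(e\<^sub>k\<^sub>1) e\<^sub>k\<^sub>2)\<rangle> = \<langle>e\<^sup>k, 1\<rangle> \<epsilon>(e\<^sub>k) = 1\<close>.
\<close>

lemma projection_trace:
  "Op Eva \<bullet> (idA \<parallel> projection) \<bullet> (idA \<parallel> Op Ant) \<bullet> swapHA \<bullet> Op Coe \<simeq> Idt []"
  by (rule derivation[OF laws_8[OF ant_mul eva_mulA coe_com ant_left ant_unit coe_cou eva_unitA
      counit_unit],
      where ms = "[]" and
      cs = "[(0,bw,[5,0],[6,2,7],[10,11]), (1,bw,[4,1,11],[8,9],[2]),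
        (2,bw,[],[3,4,0,1,2],[6,7,8,9]), (3,fw,[6],[8,9,5,10],[0]), (4,fw,[],[0,11],[1]),
        (5,fw,[],[6,7],[0]), (6,fw,[1],[0],[]), (7,fw,[],[1],[])]"]) code_simp

text \<open>
  With \<open>r = Q(S(e\<^sub>i))\<close>, \<open>shift_ant\<close> and \<open>projection_ant\<close> give \<open>r\<^sub>1 \<otimes> r\<^sub>2 S(h) = r\<^sub>1 h \<otimes> r\<^sub>2\<close>. Applying \<open>Q\<close> to the
  second leg leaves \<open>h \<otimes> Q(r)\<close>, and the remaining scalar is \<open>tr(Q Q S) = tr(Q S) = 1\<close>.
\<close>

lemma retract_ant:
  "retract \<bullet> Op Ant \<simeq> idH"
  by (rule derivation[OF laws_7[OF shift_ant projection_ant com_projection projection_idem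
      projection_trace com_counit_left mul_unit_left],
      where ms = "[]" and
      cs = "[(0,fw,[11,0],[12,13,1,14],[22,23,24,25,26,27,28]),
        (1,fw,[4,22],[5,6,7,8,9,10,11,24,25],[1,12,13,14,29,30,31]),
        (2,fw,[31],[26,27,15,16,17,18,19,20,21],[5,6,7,8,9,10,11,24]),
        (3,fw,[4],[1,12,13,14,29,30,31,6,7,8,9,10,11,24],[15,16,17,18,19,20,21]),
        (4,fw,[],[2,3,4,15,16,17,18,19,20,21],[]), (5,fw,[0],[22,23],[]), (6,fw,[0],[5,28],[])]"])
        code_simp

section \<open>The antipode is invertible\<close>

text \<open>
  \<open>H\<close> is a left dual of \<open>H\<^sup>*\<close>, with evaluation and coevaluation composed with the symmetry.
\<close>

lemma snake_reversed:
  "((Op Eva \<bullet> swapHA) \<parallel> idH) \<bullet> (idH \<parallel> (swapHA \<bullet> Op Coe)) \<simeq> idH"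
  by (rule derivation[OF laws_1[OF snake],
      where ms = "[]" and
      cs = "[(0,fw,[0],[1,2],[])]"]) code_simp

lemma snake_dual_reversed:
  "(idA \<parallel> (Op Eva \<bullet> swapHA)) \<bullet> ((swapHA \<bullet> Op Coe) \<parallel> idA) \<simeq> idA"
  by (rule derivation[OF laws_1[OF snake_dual],
      where ms = "[]" and
      cs = "[(0,fw,[0],[1,2],[])]"]) code_simp

lemma retraction_antipode: "retraction \<C> (carr K) S \<cdot> S = \<one> (carr K)"
proof -
  have "well_typed arity retract" "src arity retract = [Alg]" "tgt arity retract = [Alg]"
    by code_simp+
  then have "eval retract \<in> Hom (carr K) (carr K)"
    using arr_eval[of retract] by (simp add: unit_simps)
  moreover have "eval retract \<cdot> S = \<one> (carr K)"
    using retract_ant by (simp add: eval_simps)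
  ultimately show ?thesis by (rule retraction_hom(2)[OF K_ob(1)])
qed

lemma mult_dual: "mult A \<cdot> \<chi> K' K' = mult (dual_bialg \<C> K K' d b)"
proof -
  have "mult A = mult (dual_bialg \<C> K K' d b) \<cdot> \<chi> K' K'"
    by (simp add: opposite_def dual_bialg_def)
  then show ?thesis
    using words.assoc[OF words_arr(8,8) arr_A(5)] symmetric[of Dua Dua] words.comp_ident[OF arr_A(5)]
    by (simp add: unit_simps)
qed

text \<open>
  \<open>H\<^sup>*\<close>, with its own multiplication and with the transpose of \<open>S\<close> as antipode, satisfies the assumptions made on \<open>H\<close>. Its
  antipode has a left inverse for the same reason.
\<close>

lemma dual_finite_hopf:
  "finite_hopf \<C> (dual_bialg \<C> K K' d b) (carr K) (d \<cdot> \<chi> (carr K) K') (\<chi> (carr K) K' \<cdot> b) S_dual"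
proof (intro finite_hopf.intro finite_hopf_axioms.intro)
  show "strict_braided_category \<C>" by unfold_locales
  let ?D = "dual_bialg \<C> K K' d b"
  have D: "carr ?D = K'" "unit ?D = unit A" "comult ?D = comult A" "counit ?D = counit A"
    "mult A \<cdot> \<chi> K' K' = mult ?D"
    using mult_dual by (simp_all add: opposite_def dual_bialg_def)
  have hom: "mult ?D \<in> Hom (K' \<odot> K') K'" "unit A \<in> Hom \<I> K'"
    "comult A \<in> Hom K' (K' \<odot> K')" "counit A \<in> Hom K' \<I>"
    using words.arr_comp[OF words_arr(8) arr_A(1)] arr_A by (simp_all add: words.arr_def unit_simps D(5))
  show "bialgebra \<C> ?D"
    unfolding bialgebra_def algebra_def coalgebra_def tensor_mult_def D(1-4)
    using hom K_ob star_assoc star_unit_left star_unit_right comA_assoc comA_counit_left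
      comA_counit_right comA_star comA_unitA counitA_star counitA_unitA
    by (simp add: eval_simps D(5))
  have "S_dual \<in> Hom K' K'"
    using arr_eval[of ant_transpose] by (simp add: S_dual_def ant_transpose_def eval_simps)
  then show "antipode \<C> ?D S_dual"
    unfolding antipode_def D(1-4) using star_ant_left star_ant_right
    by (simp add: eval_simps D(5) S_dual_def ant_transpose_def)
  show "left_dual \<C> (carr ?D) (carr K) (d \<cdot> \<chi> (carr K) K') (\<chi> (carr K) K' \<cdot> b)"
    unfolding left_dual_def D(1) using K_ob words.arr_comp[OF words_arr(9,6)] words.arr_comp[OF words_arr(7,9)]
      snake_reversed snake_dual_reversed
    by (simp add: eval_simps words.arr_def)
  show "\<chi> (carr ?D) (carr ?D) \<cdot> \<chi> (carr ?D) (carr ?D) = \<one> (carr ?D \<odot> carr ?D)"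
    using symmetric[of Dua Dua] by (simp add: D(1))
qed

lemma inv_ant: "Op Inv \<bullet> Op Ant \<simeq> idH"
  using retraction_antipode by (simp add: eval_simps)

lemma antA_transpose: "Op AntA \<bullet> ant_transpose \<simeq> idA"
proof -
  have "carr (dual_bialg \<C> K K' d b) = K'" by (simp add: dual_bialg_def)
  then show ?thesis
    using finite_hopf.retraction_antipode[OF dual_finite_hopf]
    by (simp add: eval_simps S_dual_def ant_transpose_def)
qed

lemma pai_def: "Op Pai \<simeq> Op Eva \<bullet> Swap [Alg] [Dua]"
  by (simp add: eval_simps double_pairing_def)

lemma paiInv_def: "Op PaiInv \<simeq> Op Pai \<bullet> (Op Inv \<parallel> idA)"
  by (simp add: eval_simps)

lemma cro_def: "Op Cro \<simeq> (Op Pai \<parallel> idA \<parallel> idH \<parallel> Op PaiInv) \<bullet>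
  (idH \<parallel> Swap [Alg, Alg] [Dua, Dua] \<parallel> idA) \<bullet>
  (((idH \<parallel> Op Com) \<bullet> Op Com) \<parallel> ((idA \<parallel> Op ComA) \<bullet> Op ComA))"
  by (simp add: eval_simps)

text \<open>
  If \<open>U\<close> is a left inverse of the transpose of \<open>S\<close>, then the transpose of \<open>U\<close> is a right inverse of \<open>S\<close>.
\<close>

lemma ant_section:
  "Op Ant \<bullet> (idH \<parallel> Op Eva) \<bullet> (idH \<parallel> Op AntA \<parallel> idH) \<bullet> (Op Coe \<parallel> idH) \<simeq> idH"
proof -
  have
    "Op Ant \<bullet> (idH \<parallel> Op Eva) \<bullet> (idH \<parallel> Op AntA \<parallel> idH) \<bullet> (Op Coe \<parallel> idH) \<simeq>
      (idH \<parallel> Op Eva) \<bullet> (idH \<parallel> (Op AntA \<bullet> ant_transpose) \<parallel> idH) \<bullet> (Op Coe \<parallel> idH)"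
    by (rule derivation[OF laws_1[OF snake],
        where ms = "[5,6,1,2,4,3]" and
        cs = "[(0,bw,[4],[],[5,6])]"]) code_simp
  also have
    "\<dots> \<simeq> idH"
    by (rule derivation[OF laws_2[OF antA_transpose snake],
        where ms = "[]" and
        cs = "[(0,fw,[2],[3,4,5,6],[]), (1,fw,[0],[1,2],[])]"]) code_simp
  finally show ?thesis .
qed

text \<open>
  A left inverse and a right inverse agree.
\<close>

lemma ant_inv:
  "Op Ant \<bullet> Op Inv \<simeq> idH"
proof -
  have
    "Op Ant \<bullet> Op Inv \<simeq>
      Op Ant \<bullet> Op Inv \<bullet> Op Ant \<bullet> (idH \<parallel> Op Eva) \<bullet> (idH \<parallel> Op AntA \<parallel> idH) \<bullet> (Op Coe \<parallel> idH)"
    by (rule derivation[OF laws_1[OF ant_section],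
        where ms = "[3,4,5,6,1,2]" and
        cs = "[(0,bw,[0],[],[3,4,5,6])]"]) code_simp
  also have
    "\<dots> \<simeq> idH"
    by (rule derivation[OF laws_2[OF inv_ant ant_section],
        where ms = "[]" and
        cs = "[(0,fw,[1],[4,5],[]), (1,fw,[0],[1,2,3,6],[])]"]) code_simp
  finally show ?thesis .
qed

text \<open>
  The chosen left inverse of the transpose of \<open>S\<close> is the transpose of \<open>S\<^sup>-\<^sup>1\<close>, as the latter is
  a right inverse.
\<close>

lemma antA_eq:
  "Op AntA \<simeq> (Op Eva \<parallel> idA) \<bullet> (idA \<parallel> Op Inv \<parallel> idA) \<bullet> (idA \<parallel> Op Coe)"
proof -
  have
    "Op AntA \<simeq>
      Op AntA \<bullet> ant_transpose \<bullet> (Op Eva \<parallel> idA) \<bullet> (idA \<parallel> Op Inv \<parallel> idA) \<bullet> (idA \<parallel> Op Coe)"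
    by (rule derivation[OF laws_3[OF snake_dual inv_ant snake],
        where ms = "[6,7,5,2,3,4,1]" and
        cs = "[(0,bw,[0],[],[2,3]), (1,bw,[2],[],[4,5]), (2,bw,[4],[],[6,7])]"]) code_simp
  also have
    "\<dots> \<simeq> (Op Eva \<parallel> idA) \<bullet> (idA \<parallel> Op Inv \<parallel> idA) \<bullet> (idA \<parallel> Op Coe)"
    by (rule derivation[OF laws_1[OF antA_transpose],
        where ms = "[1,2,3]" and
        cs = "[(0,fw,[2],[4,5,6,7],[])]"]) code_simp
  finally show ?thesis .
qed

lemma eva_antA:
  "Op Eva \<bullet> (Op AntA \<parallel> idH) \<simeq> Op Eva \<bullet> (idA \<parallel> Op Inv)"
  by (rule derivation[OF laws_2[OF antA_eq snake],
      where ms = "[5]" and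
      cs = "[(0,fw,[0],[2],[3,4,5]), (1,fw,[1],[3,4],[])]"]) code_simp

section \<open>The skew antipode\<close>

lemma inv_mul:
  "Op Inv \<bullet> Op Mul \<simeq> Op Mul \<bullet> swapHH \<bullet> (Op Inv \<parallel> Op Inv)"
proof -
  have
    "Op Inv \<bullet> Op Mul \<simeq> Op Inv \<bullet> Op Mul \<bullet> (Op Ant \<parallel> Op Ant) \<bullet> (Op Inv \<parallel> Op Inv)"
    by (rule derivation[OF laws_1[OF ant_inv],
        where ms = "[6,4,7,5,2,3]" and
        cs = "[(0,bw,[1],[],[4,5]), (0,bw,[0],[],[6,7])]"]) code_simp
  also have
    "\<dots> \<simeq> Op Mul \<bullet> swapHH \<bullet> (Op Inv \<parallel> Op Inv)"
    by (rule derivation[OF laws_2[OF ant_mul inv_ant],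
        where ms = "[2,3,8]" and
        cs = "[(0,bw,[3,2],[5,4,6],[8,9]), (1,fw,[8],[9,7],[])]"]) code_simp
  finally show ?thesis .
qed

lemma com_inv:
  "Op Com \<bullet> Op Inv \<simeq> swapHH \<bullet> (Op Inv \<parallel> Op Inv) \<bullet> Op Com"
proof -
  have
    "Op Com \<bullet> Op Inv \<simeq> (Op Inv \<parallel> Op Inv) \<bullet> (Op Ant \<parallel> Op Ant) \<bullet> Op Com \<bullet> Op Inv"
    by (rule derivation[OF laws_1[OF inv_ant],
        where ms = "[1,2,3,6,4,7,5]" and
        cs = "[(0,bw,[3],[],[4,5]), (0,bw,[2],[],[6,7])]"]) code_simp
  also have
    "\<dots> \<simeq> swapHH \<bullet> (Op Inv \<parallel> Op Inv) \<bullet> Op Com"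
    by (rule derivation[OF laws_2[OF com_ant ant_inv],
        where ms = "[9,10,7,6]" and
        cs = "[(0,bw,[1],[2,3,4,5],[8,9,10]), (1,fw,[0],[1,8],[])]"]) code_simp
  finally show ?thesis .
qed

lemma inv_unit:
  "Op Inv \<bullet> Op Uni \<simeq> Op Uni"
  by (rule derivation[OF laws_2[OF ant_unit inv_ant],
      where ms = "[2]" and
      cs = "[(0,bw,[],[0],[2,3]), (1,fw,[2],[3,1],[])]"]) code_simp

lemma counit_inv:
  "Op Cou \<bullet> Op Inv \<simeq> Op Cou"
  by (rule derivation[OF laws_2[OF counit_ant ant_inv],
      where ms = "[]" and
      cs = "[(0,bw,[1],[],[2]), (1,fw,[0],[1,2],[])]"]) code_simp

text \<open>
  \<open>S\<^sup>-\<^sup>1(h\<^sub>2) h\<^sub>1 = \<epsilon>(h)\<close>, by applying \<open>S\<close>.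
\<close>

lemma inv_left:
  "Op Mul \<bullet> (Op Inv \<parallel> idH) \<bullet> swapHH \<bullet> Op Com \<simeq> Op Uni \<bullet> Op Cou"
proof -
  have
    "Op Mul \<bullet> (Op Inv \<parallel> idH) \<bullet> swapHH \<bullet> Op Com \<simeq>
      Op Inv \<bullet> Op Ant \<bullet> Op Mul \<bullet> (Op Inv \<parallel> idH) \<bullet> swapHH \<bullet> Op Com"
    by (rule derivation[OF laws_1[OF inv_ant],
        where ms = "[1,2,3,4,5,6]" and
        cs = "[(0,bw,[4],[],[5,6])]"]) code_simp
  also have
    "\<dots> \<simeq> Op Uni \<bullet> Op Cou"
    by (rule derivation[OF laws_4[OF ant_mul ant_inv ant_left inv_unit],
        where ms = "[1]" and
        cs = "[(0,fw,[3,1],[4,5],[7,8,9]), (1,fw,[2],[3,7],[]), (2,fw,[0],[1,2,8,9],[3]),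
          (3,fw,[],[3,6],[1])]"]) code_simp
  finally show ?thesis .
qed

lemma inv_right:
  "Op Mul \<bullet> (idH \<parallel> Op Inv) \<bullet> swapHH \<bullet> Op Com \<simeq> Op Uni \<bullet> Op Cou"
proof -
  have
    "Op Mul \<bullet> (idH \<parallel> Op Inv) \<bullet> swapHH \<bullet> Op Com \<simeq>
      Op Inv \<bullet> Op Ant \<bullet> Op Mul \<bullet> (idH \<parallel> Op Inv) \<bullet> swapHH \<bullet> Op Com"
    by (rule derivation[OF laws_1[OF inv_ant],
        where ms = "[1,2,3,4,5,6]" and
        cs = "[(0,bw,[4],[],[5,6])]"]) code_simp
  also have
    "\<dots> \<simeq> Op Uni \<bullet> Op Cou"
    by (rule derivation[OF laws_4[OF ant_mul ant_inv ant_right inv_unit],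
        where ms = "[1]" and
        cs = "[(0,fw,[2,3],[4,5],[7,8,9]), (1,fw,[1],[3,8],[]), (2,fw,[0],[1,2,7,9],[3]),
          (3,fw,[],[3,6],[1])]"]) code_simp
  finally show ?thesis .
qed

section \<open>The antipode of the opposite dual\<close>

text \<open>
  \<open>\<langle>S\<^sub>A(x\<^sub>1) x\<^sub>2, h\<rangle> = \<langle>x, h\<^sub>2 S\<^sup>-\<^sup>1(h\<^sub>1)\<rangle>\<close>: the opposite dual has the transpose of the inverse as antipode.
\<close>

lemma antA_left:
  "Op MulA \<bullet> (Op AntA \<parallel> idA) \<bullet> Op ComA \<simeq> Op UniA \<bullet> Op CouA"
  by (rule derivation[OF laws_7[OF mulA_def comA_def antA_eq snake inv_right counitA_def
      unitA_def],
      where ms = "[1]" and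
      cs = "[(0,fw,[3,2],[4],[5,6,7,8]), (1,fw,[0],[1,2],[4,9,10,11,12]),
        (2,fw,[11],[3],[1,2,13]), (3,fw,[8],[4,9],[]), (3,fw,[13],[10,11],[]),
        (3,fw,[7],[1,2],[]), (4,fw,[5],[7,8,13,12],[1]), (5,bw,[0],[1],[]),
        (6,bw,[],[5,6],[1])]"]) code_simp

lemma antA_right:
  "Op MulA \<bullet> (idA \<parallel> Op AntA) \<bullet> Op ComA \<simeq> Op UniA \<bullet> Op CouA"
  by (rule derivation[OF laws_7[OF mulA_def comA_def antA_eq snake inv_left counitA_def
      unitA_def],
      where ms = "[1]" and
      cs = "[(0,fw,[1,3],[4],[5,6,7,8]), (1,fw,[0],[1,2],[4,9,10,11,12]), (2,fw,[9],[3],[1,2,13]),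
        (3,fw,[13],[4,9],[]), (3,fw,[7],[10,11],[]), (3,fw,[8],[1,2],[]),
        (4,fw,[5],[7,8,13,12],[1]), (5,bw,[0],[1],[]), (6,bw,[],[5,6],[1])]"]) code_simp

section \<open>The pairing and its inverse\<close>

text \<open>
  \<open>\<tau>(hg, x) = \<tau>(g, x\<^sub>1) \<tau>(h, x\<^sub>2)\<close> and \<open>\<tau>(h, xy) = \<tau>(h\<^sub>1, x) \<tau>(h\<^sub>2, y)\<close>.
\<close>

lemma pai_mul:
  "Op Pai \<bullet> (Op Mul \<parallel> idA) \<simeq> Op Pai \<bullet> (idH \<parallel> Op Pai \<parallel> idA) \<bullet> (idH \<parallel> idH \<parallel> Op ComA)"
  by (rule derivation[OF laws_2[OF pai_def eva_comA],
      where ms = "[4,5]" and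
      cs = "[(0,fw,[3,2],[],[]), (1,bw,[2,0,1],[3],[4,5]), (0,bw,[0,5],[],[]),
        (0,bw,[1,4],[],[])]"]) code_simp

lemma pai_mulA:
  "Op Pai \<bullet> (idH \<parallel> Op MulA) \<simeq>
    (Op Pai \<parallel> Op Pai) \<bullet> (idH \<parallel> swapHA \<parallel> idA) \<bullet> (Op Com \<parallel> idA \<parallel> idA)"
  by (rule derivation[OF laws_2[OF pai_def eva_mulA],
      where ms = "[4,5]" and
      cs = "[(0,fw,[0,3],[],[]), (1,fw,[1,2,0],[3],[4,5]), (0,bw,[5,2],[],[]),
        (0,bw,[4,1],[],[])]"]) code_simp

lemma pai_unit:
  "Op Pai \<bullet> (Op Uni \<parallel> idA) \<simeq> Op CouA"
  by (rule derivation[OF laws_2[OF pai_def counitA_def],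
      where ms = "[]" and
      cs = "[(0,fw,[1,0],[],[]), (1,bw,[0],[1],[])]"]) code_simp

lemma pai_unitA:
  "Op Pai \<bullet> (idH \<parallel> Op UniA) \<simeq> Op Cou"
  by (rule derivation[OF laws_2[OF pai_def eva_unitA],
      where ms = "[]" and
      cs = "[(0,fw,[0,1],[],[]), (1,fw,[0],[1],[])]"]) code_simp

text \<open>
  \<open>S\<^sup>-\<^sup>1\<close> reverses orders, so \<open>\<tau>'(hg, x) = \<tau>'(h, x\<^sub>1) \<tau>'(g, x\<^sub>2)\<close> and
  \<open>\<tau>'(h, xy) = \<tau>'(h\<^sub>1, y) \<tau>'(h\<^sub>2, x)\<close>.
\<close>

lemma paiInv_mul:
  "Op PaiInv \<bullet> (Op Mul \<parallel> idA) \<simeq>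
    (Op PaiInv \<parallel> Op PaiInv) \<bullet> (idH \<parallel> swapHA \<parallel> idA) \<bullet> (idH \<parallel> idH \<parallel> Op ComA)"
  by (rule derivation[OF laws_3[OF paiInv_def inv_mul pai_mul],
      where ms = "[3,4]" and
      cs = "[(0,fw,[3,2],[],[4]), (1,fw,[0,1],[3,4],[5,6,7]), (2,fw,[6,5,2],[7],[3,4]),
        (0,bw,[1,4],[6],[]), (0,bw,[0,3],[5],[])]"]) code_simp

lemma paiInv_mulA:
  "Op PaiInv \<bullet> (idH \<parallel> Op MulA) \<simeq> Op PaiInv \<bullet> (idH \<parallel> Op PaiInv \<parallel> idA) \<bullet> (Op Com \<parallel> idA \<parallel> idA)"
  by (rule derivation[OF laws_3[OF paiInv_def pai_mulA com_inv],
      where ms = "[3,7]" and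
      cs = "[(0,fw,[0,3],[],[4]), (1,fw,[4,1,2],[3],[5,6]), (2,fw,[0],[4,5,6],[3,7,8,9]),
        (0,bw,[3,2],[8],[]), (0,bw,[7,1],[9],[])]"]) code_simp

lemma paiInv_unit:
  "Op PaiInv \<bullet> (Op Uni \<parallel> idA) \<simeq> Op CouA"
  by (rule derivation[OF laws_3[OF paiInv_def inv_unit pai_unit],
      where ms = "[]" and
      cs = "[(0,fw,[1,0],[],[2]), (1,fw,[],[1,2],[3]), (2,fw,[0],[3],[])]"]) code_simp

lemma paiInv_unitA:
  "Op PaiInv \<bullet> (idH \<parallel> Op UniA) \<simeq> Op Cou"
  by (rule derivation[OF laws_3[OF paiInv_def pai_unitA counit_inv],
      where ms = "[]" and
      cs = "[(0,fw,[0,1],[],[2]), (1,fw,[2],[1],[]), (2,fw,[0],[2],[])]"]) code_simp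

text \<open>
  \<open>\<tau>(h\<^sub>1, x\<^sub>1) \<tau>'(h\<^sub>2, x\<^sub>2) = \<langle>x, S\<^sup>-\<^sup>1(h\<^sub>2) h\<^sub>1\<rangle>\<close>.
\<close>

lemma pai_paiInv:
  "(Op Pai \<parallel> Op PaiInv) \<bullet> comHA \<simeq> Op Cou \<parallel> Op CouA"
  by (rule derivation[OF laws_4[OF paiInv_def pai_mul inv_left pai_unit],
      where ms = "[]" and
      cs = "[(0,fw,[3,5],[],[6]), (1,bw,[6,2,1],[4,5],[7]), (2,fw,[0],[2,3,6,7],[4]),
        (3,fw,[1],[4],[])]"]) code_simp

lemma paiInv_pai:
  "(Op PaiInv \<parallel> Op Pai) \<bullet> comHA \<simeq> Op Cou \<parallel> Op CouA"
  by (rule derivation[OF laws_4[OF paiInv_def pai_mul inv_right pai_unit],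
      where ms = "[]" and
      cs = "[(0,fw,[2,4],[],[6]), (1,bw,[3,6,1],[4,5],[7]), (2,fw,[0],[2,3,6,7],[4]),
        (3,fw,[1],[4],[])]"]) code_simp

lemma comHA_assoc:
  "(comHA \<parallel> idH \<parallel> idA) \<bullet> comHA \<simeq> (idH \<parallel> idA \<parallel> comHA) \<bullet> comHA"
  by (rule derivation[OF laws_2[OF com_assoc comA_assoc],
      where ms = "[10,11,2,3,12,13,6,7]" and
      cs = "[(0,fw,[0],[2,3,6,7],[10,11,12,13]), (1,fw,[1],[4,5,8,9],[2,3,6,7])]"]) code_simp

lemma comHA_counit_left:
  "(Op Cou \<parallel> Op CouA \<parallel> idH \<parallel> idA) \<bullet> comHA \<simeq> Idt [Alg, Dua]"
  by (rule derivation[OF laws_2[OF com_counit_left comA_counit_left],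
      where ms = "[]" and
      cs = "[(0,fw,[0],[2,3],[]), (1,fw,[1],[4,5],[])]"]) code_simp

lemma comHA_counit_right:
  "(idH \<parallel> idA \<parallel> Op Cou \<parallel> Op CouA) \<bullet> comHA \<simeq> Idt [Alg, Dua]"
  by (rule derivation[OF laws_2[OF com_counit_right comA_counit_right],
      where ms = "[]" and
      cs = "[(0,fw,[0],[2,3],[]), (1,fw,[1],[4,5],[])]"]) code_simp

section \<open>The cross relation\<close>

text \<open>
  The same cancellation when both coproducts continue.
\<close>

lemma paiInv_pai_com_comA:
  "(Op PaiInv \<parallel> Op Pai \<parallel> Idt [Alg, Dua]) \<bullet> (idH \<parallel> idA \<parallel> idH \<parallel> swapHA \<parallel> idA) \<bullet>
    (idH \<parallel> Swap [Alg, Alg] [Dua] \<parallel> idA \<parallel> idA) \<bullet>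
    (((idH \<parallel> Op Com) \<bullet> Op Com) \<parallel> ((idA \<parallel> Op ComA) \<bullet> Op ComA)) \<simeq>
    idH \<parallel> idA"
  by (rule derivation[OF laws_5[OF com_assoc comA_assoc paiInv_pai com_counit_left
      comA_counit_left],
      where ms = "[]" and
      cs = "[(0,bw,[0],[2,3,4,5],[10,11,12,13]), (1,bw,[1],[6,7,8,9],[2,3,4,5]),
        (2,fw,[10,2],[12,13,4,5],[]), (3,fw,[0],[10,11],[]), (4,fw,[1],[2,3],[])]"]) code_simp

text \<open>
  Both sides are \<open>\<tau>(g\<^sub>1, x\<^sub>1) \<tau>(h\<^sub>1, x\<^sub>2) x\<^sub>3 \<otimes> h\<^sub>2 g\<^sub>2 \<tau>'(h\<^sub>3, x\<^sub>4) \<tau>'(g\<^sub>3, x\<^sub>5)\<close>.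
\<close>

lemma cro_mul:
  "Op Cro \<bullet> (Op Mul \<parallel> idA) \<simeq> (idA \<parallel> Op Mul) \<bullet> (Op Cro \<parallel> idH) \<bullet> (idH \<parallel> Op Cro)"
  by (rule derivation[OF laws_5[OF cro_def com_mul pai_mul paiInv_mul comA_assoc],
      where ms = "[4,5,3,6,20]" and
      cs = "[(0,fw,[3,2],[4,5],[6,7,8,9,10,11,12,13]), (1,fw,[0,1],[3,6,7],[4,5,14,15,16,17]),
        (2,fw,[4,14,10],[16],[3,6]), (1,fw,[5,15],[17,8,9],[7,16,18,19,20,21]),
        (3,fw,[16,19,13],[21],[8,9]), (4,fw,[2],[10,11,3,6],[17,21,22,23]),
        (4,bw,[23],[12,13,8,9],[3,6,10,11]), (4,bw,[21],[22,23,3,6],[8,9,12,13]),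
        (0,bw,[0,8],[4,5,7,16,12,13,10,11],[3,6]), (0,bw,[1,2],[14,15,18,19,17,21,8,9],[4,5])]"])
        code_simp

text \<open>
  Both sides are \<open>\<tau>(h\<^sub>1, x\<^sub>1) \<tau>(h\<^sub>2, y\<^sub>1) x\<^sub>2 y\<^sub>2 \<otimes> h\<^sub>3 \<tau>'(h\<^sub>4, y\<^sub>3) \<tau>'(h\<^sub>5, x\<^sub>3)\<close>.
\<close>

lemma cro_mulA:
  "Op Cro \<bullet> (idH \<parallel> Op MulA) \<simeq> (Op MulA \<parallel> idH) \<bullet> (idA \<parallel> Op Cro) \<bullet> (Op Cro \<parallel> idA)"
  by (rule derivation[OF laws_5[OF cro_def comA_mulA pai_mulA paiInv_mulA com_assoc],
      where ms = "[7,10,3,6,20]" and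
      cs = "[(0,fw,[0,3],[4,5],[6,7,8,9,10,11,12,13]), (1,fw,[1,2],[3,10,11],[4,5,14,15,16,17]),
        (2,fw,[6,4,14],[16],[3,10]), (1,fw,[5,15],[17,12,13],[11,16,18,19,20,21]),
        (3,fw,[9,16,19],[21],[12,13]), (4,fw,[0],[6,7,3,10],[17,21,22,23]),
        (4,bw,[23],[8,9,12,13],[3,6,7,10]), (4,bw,[21],[22,23,3,6],[8,9,12,13]),
        (0,bw,[8,2],[12,13,7,10,14,15,18,19],[3,6]), (0,bw,[0,1],[17,21,8,9,4,5,11,16],[7,10])]"])
        code_simp

lemma cro_unit:
  "Op Cro \<bullet> (Op Uni \<parallel> idA) \<simeq> idA \<parallel> Op Uni"
  by (rule derivation[OF laws_6[OF cro_def com_unit pai_unit paiInv_unit comA_counit_left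
      comA_counit_right],
      where ms = "[1]" and
      cs = "[(0,fw,[1,0],[2,3],[4,5,6,7,8,9,10,11]), (1,fw,[],[1,4,5],[2,3]), (2,fw,[8],[2],[]),
        (1,fw,[],[3,6,7],[1,2]), (3,fw,[11],[2],[]), (4,fw,[0],[8,9],[]),
        (5,fw,[0],[10,11],[])]"]) code_simp

lemma cro_unitA:
  "Op Cro \<bullet> (idH \<parallel> Op UniA) \<simeq> Op UniA \<parallel> idH"
  by (rule derivation[OF laws_6[OF cro_def comA_unitA pai_unitA paiInv_unitA com_counit_left
      com_counit_right],
      where ms = "[1]" and
      cs = "[(0,fw,[0,1],[2,3],[4,5,6,7,8,9,10,11]), (1,fw,[],[1,8,9],[2,3]), (2,fw,[4],[2],[]),
        (1,fw,[],[3,10,11],[1,2]), (3,fw,[7],[2],[]), (4,fw,[0],[4,5],[]), (5,fw,[0],[6,7],[])]"])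
        code_simp

text \<open>
  In \<open>X(h\<^sub>1 \<otimes> x\<^sub>1) \<otimes> X(h\<^sub>2 \<otimes> x\<^sub>2)\<close> the factor \<open>\<tau>'\<close> of the first cross map cancels against the factor \<open>\<tau>\<close> of
  the second.
\<close>

lemma com_cro:
  "(idA \<parallel> swapAH \<parallel> idH) \<bullet> (Op ComA \<parallel> Op Com) \<bullet> Op Cro \<simeq> (Op Cro \<parallel> Op Cro) \<bullet> comHA"
  by (rule derivation[OF laws_4[OF cro_def com_assoc comA_assoc paiInv_pai_com_comA],
      where ms = "[2,3,6,7,10,11,8,9]" and
      cs = "[(0,fw,[0,1],[2,3],[8,9,10,11,12,13,14,15]), (1,fw,[9],[10,11,6,7],[2,3,16,17]),
        (2,fw,[13],[14,15,4,5],[6,7,10,11]), (3,bw,[3,7],[],[4,5,14,15,18,19,20,21]),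
        (2,bw,[13],[6,7,18,19],[22,23,24,25]), (2,bw,[1],[12,13,22,23],[6,7,18,19]),
        (1,bw,[9],[2,3,4,5],[12,13,22,23]), (1,bw,[0],[8,9,12,13],[2,3,4,5]),
        (0,bw,[3,7],[14,15,16,17,20,21,10,11],[8,9]),
        (0,bw,[2,6],[4,5,22,23,18,19,24,25],[10,11])]"]) code_simp

lemma counit_cro:
  "(Op CouA \<parallel> Op Cou) \<bullet> Op Cro \<simeq> Op Cou \<parallel> Op CouA"
  by (rule derivation[OF laws_4[OF cro_def com_counit_left comA_counit_left pai_paiInv],
      where ms = "[]" and
      cs = "[(0,fw,[0,1],[2,3],[4,5,6,7,8,9,10,11]), (1,fw,[5],[6,7],[]), (2,fw,[9],[10,11],[]),
        (3,fw,[0,1],[4,5,8,9],[])]"]) code_simp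

text \<open>
  The same cancellation identifies the cross map with the pair of actions in the definition of the
  double cross product.
\<close>

lemma cro_eq:
  "(alpha \<parallel> beta) \<bullet> comHA \<simeq> Op Cro"
  by (rule derivation[OF laws_4[OF com_assoc comA_assoc paiInv_pai_com_comA cro_def],
      where ms = "[2,3]" and
      cs = "[(0,fw,[0],[2,3,6,7],[18,19,20,21]), (0,fw,[21],[12,13,16,17],[2,3,6,7]),
        (1,fw,[1],[4,5,8,9],[12,13,16,17]), (1,fw,[13],[16,17,10,11],[4,5,8,9]),
        (2,fw,[19,5],[20,21,2,3,8,9,14,15],[]), (3,bw,[0,1],[18,19,6,7,12,13,4,5],[2,3])]"])
        code_simp

section \<open>The double is a bialgebra\<close>

lemma mulD_eq:
  "(Op MulA \<parallel> Op Mul) \<bullet> (idA \<parallel> alpha \<parallel> beta \<parallel> idH) \<bullet> (idA \<parallel> idH \<parallel> swapHA \<parallel> idA \<parallel> idH) \<bullet>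
    (idA \<parallel> Op Com \<parallel> Op ComA \<parallel> idH) \<simeq>
    mulD"
  by (rule derivation[OF laws_1[OF cro_eq],
      where ms = "[22,23,20,21]" and
      cs = "[(0,fw,[1,2],[4,5,6,7,8,9,10,11,12,13,14,15,16,17,18,19],[22,23])]"]) code_simp

text \<open>
  For a distributive law the axioms of the double reduce to those of \<open>A\<close> and \<open>H\<close>.
\<close>

lemma mulD_assoc:
  "mulD \<bullet> (mulD \<parallel> idD) \<simeq> mulD \<bullet> (idD \<parallel> mulD)"
  by (rule derivation[OF laws_4[OF cro_mul mul_assoc mulA_assoc cro_mulA],
      where ms = "[14,15,8,9,12,18,13,10]" and
      cs = "[(0,fw,[7,3,4],[9,10,11],[14,15,16,17,18]), (1,fw,[17,15,5],[18,13],[9,10]),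
        (2,fw,[0,6,16],[8,12],[11,13]), (3,bw,[1,2,14],[6,7,16,17,11],[8,12,18])]"]) code_simp

lemma mulD_unit_left:
  "mulD \<bullet> (unitD \<parallel> idD) \<simeq> idD"
  by (rule derivation[OF laws_3[OF cro_unit mul_unit_left mulA_unit_left],
      where ms = "[]" and
      cs = "[(0,fw,[0],[3,4,5],[8]), (1,fw,[1],[8,7],[]), (2,fw,[0],[2,6],[])]"]) code_simp

lemma mulD_unit_right:
  "mulD \<bullet> (idD \<parallel> unitD) \<simeq> idD"
  by (rule derivation[OF laws_3[OF cro_unitA mul_unit_right mulA_unit_right],
      where ms = "[]" and
      cs = "[(0,fw,[1],[2,4,5],[8]), (1,fw,[1],[3,7],[]), (2,fw,[0],[8,6],[])]"]) code_simp

lemma comD_assoc: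
  "(comD \<parallel> idD) \<bullet> comD \<simeq> (idD \<parallel> comD) \<bullet> comD"
  by (rule derivation[OF laws_2[OF com_assoc comA_assoc],
      where ms = "[4,5,10,11,8,9,12,13]" and
      cs = "[(0,fw,[1],[4,5,8,9],[10,11,12,13]), (1,fw,[0],[2,3,6,7],[4,5,8,9])]"]) code_simp

lemma comD_counit_left:
  "(counitD \<parallel> idD) \<bullet> comD \<simeq> idD"
  by (rule derivation[OF laws_2[OF com_counit_left comA_counit_left],
      where ms = "[]" and
      cs = "[(0,fw,[1],[4,5],[]), (1,fw,[0],[2,3],[])]"]) code_simp

lemma comD_counit_right:
  "(idD \<parallel> counitD) \<bullet> comD \<simeq> idD"
  by (rule derivation[OF laws_2[OF com_counit_right comA_counit_right],
      where ms = "[]" and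
      cs = "[(0,fw,[1],[4,5],[]), (1,fw,[0],[2,3],[])]"]) code_simp

lemma comD_mulD:
  "comD \<bullet> mulD \<simeq> mulDD \<bullet> (comD \<parallel> comD)"
  by (rule derivation[OF laws_3[OF com_mul comA_mulA com_cro],
      where ms = "[7,10,6,8,9,21,14,15,22,23,19,16,24,25,20,17]" and
      cs = "[(0,fw,[5,3],[7,10,11],[12,13,14,15,16,17]), (1,fw,[0,4],[6,8,9],[7,10,11,18,19,20]),
        (2,fw,[1,2],[4,5,11,18,12,13],[6,8,9,21,22,23,24,25])]"]) code_simp

lemma comD_unitD:
  "comD \<bullet> unitD \<simeq> unitD \<parallel> unitD"
  by (rule derivation[OF laws_2[OF com_unit comA_unitA],
      where ms = "[1,6,4,7]" and
      cs = "[(0,fw,[],[1,4,5],[6,7]), (1,fw,[],[0,2,3],[1,4])]"]) code_simp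

lemma counitD_mulD:
  "counitD \<bullet> mulD \<simeq> counitD \<parallel> counitD"
  by (rule derivation[OF laws_3[OF counit_mul counitA_mulA counit_cro],
      where ms = "[]" and
      cs = "[(0,fw,[5,3],[7],[]), (1,fw,[0,4],[6],[]), (2,fw,[1,2],[4,5],[])]"]) code_simp

lemma counitD_unitD:
  "counitD \<bullet> unitD \<simeq> Idt []"
  by (rule derivation[OF laws_2[OF counit_unit counitA_unitA],
      where ms = "[]" and
      cs = "[(0,fw,[],[1],[]), (1,fw,[],[0],[])]"]) code_simp

section \<open>The antipode of the double\<close>

text \<open>
  \<open>S\<^sub>D(x\<^sub>1 \<otimes> h\<^sub>1) (x\<^sub>2 \<otimes> h\<^sub>2) = X(S(h\<^sub>1) \<otimes> S\<^sub>A(x\<^sub>1) x\<^sub>2) h\<^sub>2\<close> by compatibility of \<open>X\<close> with the multiplication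
  of \<open>A\<close>, and symmetrically for the other side.
\<close>

lemma antD_left:
  "mulD \<bullet> (antD \<parallel> idD) \<bullet> comD \<simeq> unitD \<bullet> counitD"
  by (rule derivation[OF laws_4[OF cro_mulA antA_left cro_unitA ant_left],
      where ms = "[2,3]" and
      cs = "[(0,bw,[6,7,3],[8,9,10,11,12],[14,15,16]), (1,fw,[0],[2,3,7,14],[8]),
        (2,fw,[6],[8,15,16],[2]), (3,fw,[1],[4,5,6,13],[3])]"]) code_simp

lemma antD_right:
  "mulD \<bullet> (idD \<parallel> antD) \<bullet> comD \<simeq> unitD \<bullet> counitD"
  by (rule derivation[OF laws_4[OF cro_mul ant_right cro_unit antA_right],
      where ms = "[5,4]" and
      cs = "[(0,bw,[4,6,7],[8,9,10,11,13],[14,15,16]), (1,fw,[1],[4,5,6,14],[8]),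
        (2,fw,[7],[8,15,16],[4]), (3,fw,[0],[2,3,7,12],[5])]"]) code_simp

section \<open>The universal R-matrix\<close>

text \<open>
  \<open>e\<^sub>i S(e\<^sub>j) \<otimes> e\<^sup>i e\<^sup>j = e\<^sub>k\<^sub>1 S(e\<^sub>k\<^sub>2) \<otimes> e\<^sup>k\<close>.
\<close>

lemma matrixD_right_inverse:
  "mulDD \<bullet> (matrixD \<parallel> matrixD_inv) \<simeq> unitD \<parallel> unitD"
  by (rule derivation[OF laws_7[OF cro_unit cro_unitA mul_unit_left mulA_unit_left coe_com
      ant_right coe_cou],
      where ms = "[3,1,2,8]" and
      cs = "[(0,fw,[6],[3,13,14],[17]), (1,fw,[1],[4,9,10],[3]), (2,fw,[8],[17,16],[]),
        (3,fw,[3],[0,11],[]), (4,bw,[],[1,2,5,6,15],[0,4,9,10]), (5,fw,[0],[9,10,7,12],[1]),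
        (6,fw,[],[0,4],[2])]"]) code_simp

lemma matrixD_left_inverse:
  "mulDD \<bullet> (matrixD_inv \<parallel> matrixD) \<simeq> unitD \<parallel> unitD"
  by (rule derivation[OF laws_7[OF cro_unit cro_unitA mul_unit_left mulA_unit_left coe_com
      ant_left coe_cou],
      where ms = "[4,1,2,8]" and
      cs = "[(0,fw,[7],[4,13,14],[17]), (1,fw,[3],[5,9,10],[4]), (2,fw,[8],[17,16],[]),
        (3,fw,[4],[0,11],[]), (4,bw,[],[1,2,6,7,15],[0,5,9,10]), (5,fw,[0],[9,10,3,12],[1]),
        (6,fw,[],[0,5],[2])]"]) code_simp

lemma copD_assoc:
  "(copD \<parallel> idD) \<bullet> copD \<simeq> (idD \<parallel> copD) \<bullet> copD"
  by (rule derivation[OF laws_2[OF comA_assoc com_assoc],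
      where ms = "[10,11,2,3,12,13,6,7]" and
      cs = "[(0,bw,[0],[2,3,6,7],[10,11,12,13]), (1,bw,[1],[4,5,8,9],[2,3,6,7])]"]) code_simp

lemma copD_counit_left:
  "(counitD \<parallel> idD) \<bullet> copD \<simeq> idD"
  by (rule derivation[OF laws_2[OF com_counit_right comA_counit_right],
      where ms = "[]" and
      cs = "[(0,fw,[1],[4,5],[]), (1,fw,[0],[2,3],[])]"]) code_simp

lemma copD_counit_right:
  "(idD \<parallel> counitD) \<bullet> copD \<simeq> idD"
  by (rule derivation[OF laws_2[OF com_counit_left comA_counit_left],
      where ms = "[]" and
      cs = "[(0,fw,[1],[4,5],[]), (1,fw,[0],[2,3],[])]"]) code_simp

text \<open>
  Both sides are \<open>e\<^sub>j \<otimes> e\<^sub>i \<otimes> e\<^sup>i e\<^sup>j\<close> up to units.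
\<close>

lemma matrixD_cop:
  "(copD \<parallel> idD) \<bullet> matrixD \<simeq> (idD \<parallel> idD \<parallel> mulD) \<bullet> (idD \<parallel> matrixD \<parallel> idD) \<bullet> matrixD"
  by (rule derivation[OF laws_4[OF comA_unitA coe_com mul_unit_left cro_unit],
      where ms = "[9,5,10,3,8,0,4,6,7,12,11,2]" and
      cs = "[(0,fw,[],[0,4,5],[8,9]), (1,fw,[],[1,2,6,7],[0,4,5,10,11]), (2,bw,[3],[],[1,2]),
        (3,bw,[10],[1],[6,7,12])]"]) code_simp

text \<open>
  Both sides are \<open>e\<^sub>i e\<^sub>j \<otimes> e\<^sup>j \<otimes> e\<^sup>i\<close> up to units.
\<close>

lemma matrixD_com:
  "(idD \<parallel> comD) \<bullet> matrixD \<simeq> (mulD \<parallel> idD \<parallel> idD) \<bullet> (idD \<parallel> matrixD \<parallel> idD) \<bullet> matrixD"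
  by (rule derivation[OF laws_4[OF com_unit coe_comA mulA_unit_left cro_unitA],
      where ms = "[1,3,6,9,4,7,10,8,5,12,2,11]" and
      cs = "[(0,fw,[],[3,6,7],[8,9]), (1,fw,[],[1,2,4,5],[3,6,7,10,11]), (2,bw,[0],[],[1,2]),
        (3,bw,[3],[0],[4,5,12])]"]) code_simp

lemma inv_right_mul:
  "Op Mul \<bullet> (idH \<parallel> Op Mul) \<bullet> (idH \<parallel> Op Inv \<parallel> idH) \<bullet> (swapHH \<parallel> idH) \<bullet> (Op Com \<parallel> idH) \<simeq>
    Op Cou \<parallel> idH"
  by (rule derivation[OF laws_3[OF mul_assoc inv_right mul_unit_left],
      where ms = "[]" and
      cs = "[(0,bw,[3,4,1],[5,6],[7,8]), (1,fw,[0],[2,3,4,7],[5]), (2,fw,[1],[5,8],[])]"])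
        code_simp

text \<open>
  The third axiom on \<open>H\<close>: \<open>h\<^sub>2 e\<^sub>i \<otimes> X(h\<^sub>1 \<otimes> e\<^sup>i) = e\<^sub>i h\<^sub>1 \<otimes> e\<^sup>i \<otimes> h\<^sub>2\<close>. Splitting \<open>e\<^sup>i\<close> into three parts splits
  \<open>e\<^sub>i\<close> into three factors, two of which are evaluated by \<open>\<tau>\<close> and \<open>\<tau>'\<close>; the left leg becomes
  \<open>h\<^sub>4 S\<^sup>-\<^sup>1(h\<^sub>3) e\<^sub>i h\<^sub>1\<close>.
\<close>

lemma twist_alg:
  "(Op Mul \<parallel> Op Cro) \<bullet> (idH \<parallel> swapHH \<parallel> idA) \<bullet> ((swapHH \<bullet> Op Com) \<parallel> Op Coe) \<simeq>
    (Op Mul \<parallel> idA \<parallel> idH) \<bullet> (idH \<parallel> swapAH \<parallel> idH) \<bullet> (Op Coe \<parallel> Op Com)"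
  by (rule derivation[OF laws_9[OF cro_def com_assoc coe_comA pai_def paiInv_def snake mul_assoc
      inv_right_mul com_counit_right],
      where ms = "[12,13,6,7,3]" and
      cs = "[(0,fw,[1,4],[6,7],[8,9,10,11,12,13,14,15]), (1,fw,[0],[1,2,8,9],[6,7,16,17]),
        (1,fw,[7],[16,17,10,11],[1,2,8,9]), (2,fw,[],[3,4,12,13],[10,11,16,17,18]),
        (2,fw,[],[10,11,14,15],[3,4,12,13,19]), (3,fw,[6,17],[],[]), (4,fw,[8,4],[],[10]),
        (3,fw,[10,4],[],[]), (5,fw,[6],[16,17],[]), (5,fw,[10],[3,4],[]),
        (6,fw,[10,12,6],[19,18],[3,4]), (7,fw,[2,3],[8,9,10,4,5],[]), (8,fw,[7],[1,2],[])]"])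
        code_simp

text \<open>
  The third axiom on \<open>A\<close>: \<open>X(e\<^sub>i \<otimes> x\<^sub>1) \<otimes> e\<^sup>i x\<^sub>2 = x\<^sub>2 \<otimes> e\<^sub>i \<otimes> x\<^sub>1 e\<^sup>i\<close>. Now \<open>e\<^sub>i\<close> is split, and the last leg
  becomes \<open>x\<^sub>1 e\<^sup>i S\<^sub>A(x\<^sub>3) x\<^sub>4\<close>.
\<close>

lemma twist_dual:
  "(Op Cro \<parallel> Op MulA) \<bullet> (idH \<parallel> swapAA \<parallel> idA) \<bullet> (Op Coe \<parallel> Op ComA) \<simeq>
    (idA \<parallel> idH \<parallel> Op MulA) \<bullet> (idA \<parallel> swapAH \<parallel> idA) \<bullet> ((swapAA \<bullet> Op ComA) \<parallel> Op Coe)"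
  by (rule derivation[OF laws_11[OF cro_def comA_assoc coe_com pai_def paiInv_def eva_antA
      snake_dual mulA_assoc antA_left mulA_unit_right comA_counit_right],
      where ms = "[5,6,1,2,9]" and
      cs = "[(0,fw,[1,3],[5,6],[8,9,10,11,12,13,14,15]), (1,fw,[0],[3,4,12,13],[5,6,16,17]),
        (1,fw,[6],[16,17,14,15],[3,4,12,13]), (2,fw,[],[1,2,8,9],[14,15,16,17,18]),
        (2,fw,[],[16,17,10,11],[1,2,8,9,19]), (3,fw,[14,5],[],[]), (4,fw,[8,12],[],[10]),
        (3,fw,[10,12],[],[]), (5,bw,[12,8],[10],[11]), (6,fw,[5],[14,15],[]),
        (6,fw,[11],[8,9],[]), (7,fw,[5,19,13],[18,7],[8,9]), (7,fw,[2,11,13],[19,8],[7,10]),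
        (8,fw,[4],[12,13,11,7],[8]), (9,fw,[2],[8,10],[]), (10,fw,[6],[3,4],[])]"]) code_simp

text \<open>
  Up to units, and with \<open>x \<otimes> h\<close> as the argument, the left side is
  \<open>x\<^sub>2 \<otimes> h\<^sub>2 e\<^sub>i \<otimes> x\<^sub>1 X(h\<^sub>1 \<otimes> e\<^sup>i)\<close> and the right side is \<open>X(e\<^sub>i \<otimes> x\<^sub>1) h\<^sub>1 \<otimes> e\<^sup>i x\<^sub>2 \<otimes> h\<^sub>2\<close>; by the
  preceding two laws both are \<open>x\<^sub>2 \<otimes> e\<^sub>i h\<^sub>1 \<otimes> x\<^sub>1 e\<^sup>i \<otimes> h\<^sub>2\<close>.
\<close>

lemma matrixD_twist:
  "mulDD \<bullet> (copD \<parallel> matrixD) \<simeq> mulDD \<bullet> (matrixD \<parallel> comD)"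
  by (rule derivation[OF laws_8[OF cro_unitA mul_unit_right mulA_unit_right twist_alg twist_dual
      mulA_unit_left mul_unit_left cro_unit],
      where ms = "[2,4,5,16,7,8,10,11,13,14,3,12,17,18,15,9]" and
      cs = "[(0,fw,[5],[6,10,11],[18]), (1,fw,[15],[9,17],[]), (2,fw,[3],[18,12],[]),
        (3,fw,[1],[4,5,7,8,13,14,15],[6,9,10,11,12]), (4,bw,[0],[2,3,6,9,16],[4,5,7,8,13,14,15]),
        (5,bw,[13],[],[2,3]), (6,bw,[11],[],[6,9]), (7,bw,[8],[6],[16,17,18])]"]) code_simp

section \<open>The Drinfeld double\<close>

lemma carr_A: "carr A = K'"
  by (simp add: opposite_def dual_bialg_def)

lemma eval_comHA: "eval comHA = tensor_comult \<C> (carr K) (comult K) K' (comult A)"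
  by (simp add: comHA_def tensor_comult_def unit_simps)

lemma typing:
  "eval comHA \<in> Hom (carr K \<odot> K') ((carr K \<odot> K') \<odot> carr K \<odot> K')"
  "counit K \<otimes> counit A \<in> Hom (carr K \<odot> K') \<I>"
  "mor Pai \<in> Hom (carr K \<odot> K') \<I>" "mor PaiInv \<in> Hom (carr K \<odot> K') \<I>"
  "eval mulD \<in> Hom ((K' \<odot> carr K) \<odot> K' \<odot> carr K) (K' \<odot> carr K)"
  "eval comD \<in> Hom (K' \<odot> carr K) ((K' \<odot> carr K) \<odot> K' \<odot> carr K)"
  "unit A \<otimes> unit K \<in> Hom \<I> (K' \<odot> carr K)" "counit A \<otimes> counit K \<in> Hom (K' \<odot> carr K) \<I>"
  "eval antD \<in> Hom (K' \<odot> carr K) (K' \<odot> carr K)"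
  "eval matrixD \<in> Hom \<I> ((K' \<odot> carr K) \<odot> K' \<odot> carr K)"
  "eval matrixD_inv \<in> Hom \<I> ((K' \<odot> carr K) \<odot> K' \<odot> carr K)"
proof -
  have "well_typed arity comHA" "well_typed arity (Op Cou \<parallel> Op CouA)" "well_typed arity (Op Pai)"
    "well_typed arity (Op PaiInv)" "well_typed arity mulD" "well_typed arity comD"
    "well_typed arity (Op UniA \<parallel> Op Uni)" "well_typed arity (Op CouA \<parallel> Op Cou)"
    "well_typed arity antD" "well_typed arity matrixD" "well_typed arity matrixD_inv"
    by code_simp+
  note this[THEN arr_eval]
  moreover have "src arity comHA = [Alg, Dua]" "tgt arity comHA = [Alg, Dua, Alg, Dua]"
    "src arity mulD = [Dua, Alg, Dua, Alg]" "tgt arity mulD = [Dua, Alg]"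
    "src arity comD = [Dua, Alg]" "tgt arity comD = [Dua, Alg, Dua, Alg]"
    "src arity antD = [Dua, Alg]" "tgt arity antD = [Dua, Alg]"
    "src arity matrixD = []" "tgt arity matrixD = [Dua, Alg, Dua, Alg]"
    "src arity matrixD_inv = []" "tgt arity matrixD_inv = [Dua, Alg, Dua, Alg]"
    by code_simp+
  ultimately show 
    "eval comHA \<in> Hom (carr K \<odot> K') ((carr K \<odot> K') \<odot> carr K \<odot> K')"
    "counit K \<otimes> counit A \<in> Hom (carr K \<odot> K') \<I>"
    "mor Pai \<in> Hom (carr K \<odot> K') \<I>" "mor PaiInv \<in> Hom (carr K \<odot> K') \<I>"
    "eval mulD \<in> Hom ((K' \<odot> carr K) \<odot> K' \<odot> carr K) (K' \<odot> carr K)"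
    "eval comD \<in> Hom (K' \<odot> carr K) ((K' \<odot> carr K) \<odot> K' \<odot> carr K)"
    "unit A \<otimes> unit K \<in> Hom \<I> (K' \<odot> carr K)" "counit A \<otimes> counit K \<in> Hom (K' \<odot> carr K) \<I>"
    "eval antD \<in> Hom (K' \<odot> carr K) (K' \<odot> carr K)"
    "eval matrixD \<in> Hom \<I> ((K' \<odot> carr K) \<odot> K' \<odot> carr K)"
    "eval matrixD_inv \<in> Hom \<I> ((K' \<odot> carr K) \<odot> K' \<odot> carr K)"
    by (simp_all add: unit_simps tensor_obj_assoc K_ob tensor_ob)
qed

lemma coalgebra_HA: "coalgebra \<C> (carr K \<odot> K') (eval comHA) (counit K \<otimes> counit A)"
proof -
  have "(eval comHA \<otimes> \<one> (carr K \<odot> K')) \<cdot> eval comHA = (\<one> (carr K \<odot> K') \<otimes> eval comHA) \<cdot> eval comHA"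
    using comHA_assoc tensor_mor_assoc[OF id_hom[OF K_ob(1)] id_hom[OF K_ob(2)] typing(1)]
    by (simp add: eval_simps)
  moreover have "((counit K \<otimes> counit A) \<otimes> \<one> (carr K \<odot> K')) \<cdot> eval comHA = \<one> (carr K \<odot> K')"
    using comHA_counit_left
      tensor_mor_assoc[OF structure_hom(4) arr_A(4)[unfolded words.arr_def] id_hom[OF tensor_ob[OF K_ob]]]
    by (simp add: eval_simps)
  moreover have "(\<one> (carr K \<odot> K') \<otimes> counit K \<otimes> counit A) \<cdot> eval comHA = \<one> (carr K \<odot> K')"
    using comHA_counit_right tensor_mor_assoc[OF id_hom[OF K_ob(1)] id_hom[OF K_ob(2)] typing(2)]
    by (simp add: eval_simps)
  ultimately show ?thesis
    unfolding coalgebra_def using typing(1,2) K_ob tensor_ob by simp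
qed

text \<open>
  Uniqueness is needed as well as existence, since the double is defined by the unique convolution inverse of the pairing.
\<close>

lemma pairing_inverse_iff: "pairing_inverse \<C> A K (double_pairing \<C> K K' d) t \<longleftrightarrow> t = mor PaiInv"
proof -
  have "(mor Pai \<otimes> mor PaiInv) \<cdot> eval comHA = counit K \<otimes> counit A"
    "(mor PaiInv \<otimes> mor Pai) \<cdot> eval comHA = counit K \<otimes> counit A"
    using pai_paiInv paiInv_pai unfolding equation_def eval.simps mor.simps(4,12) by blast+
  moreover have "\<one> \<I> \<cdot> ((mor Pai \<otimes> mor PaiInv) \<cdot> eval comHA) = (mor Pai \<otimes> mor PaiInv) \<cdot> eval comHA"
    "\<one> \<I> \<cdot> ((mor PaiInv \<otimes> mor Pai) \<cdot> eval comHA) = (mor PaiInv \<otimes> mor Pai) \<cdot> eval comHA"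
    using comp_hom[OF typing(1) tensor_hom[OF typing(3,4)]] comp_hom[OF typing(1) tensor_hom[OF typing(4,3)]]
    by (simp_all add: id_comp unit_simps)
  ultimately have inv: "pairing_inverse \<C> A K (mor Pai) (mor PaiInv)"
    unfolding pairing_inverse_def convolution_inverse_def carr_A eval_comHA[symmetric]
    using typing(2,3,4) by (simp add: id_comp)
  show ?thesis
  proof
    assume "pairing_inverse \<C> A K (double_pairing \<C> K K' d) t"
    then show "t = mor PaiInv"
      using convolution_inverse_unique[OF coalgebra_HA] inv
      unfolding pairing_inverse_def carr_A eval_comHA mor.simps(14) by blast
  qed (use inv in simp)
qed

lemma drinfeld_double_eq:
  "drinfeld_double \<C> K K' d b =
    \<lparr>carr = K' \<odot> carr K, mult = eval mulD, unit = unit A \<otimes> unit K,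
      comult = eval comD, counit = counit A \<otimes> counit K\<rparr>"
proof -
  have "(THE t. pairing_inverse \<C> A K (double_pairing \<C> K K' d) t) = mor PaiInv"
    by (simp add: pairing_inverse_iff)
  moreover have "eval comD = tensor_comult \<C> K' (comult A) (carr K) (comult K)"
    by (simp add: comD_def tensor_comult_def unit_simps)
  ultimately show ?thesis
    unfolding drinfeld_double_def double_cross_product_def
    using mulD_eq by (simp add: carr_A Let_def eval_simps)
qed

abbreviation double :: "('o, 'm) bialg" where
  "double \<equiv> drinfeld_double \<C> K K' d b"

lemma double_bialgebra: "bialgebra \<C> double"
  unfolding bialgebra_def algebra_def coalgebra_def tensor_mult_def drinfeld_double_eq
  using typing(5-8) tensor_ob[OF K_ob(2,1)] mulD_assoc mulD_unit_left mulD_unit_right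
    comD_assoc comD_counit_left comD_counit_right comD_mulD comD_unitD counitD_mulD counitD_unitD
  by (simp add: eval_simps)

lemma double_antipode: "antipode \<C> double (eval antD)"
  unfolding antipode_def drinfeld_double_eq using typing(9) antD_left antD_right
  by (simp add: eval_simps)

lemma double_R_eq: "double_R \<C> K K' d b = eval matrixD"
  by (simp add: double_R_def matrixD_def)

lemma double_quasi_triangular: "quasi_triangular \<C> double (eval matrixD)"
proof -
  note equations = copD_assoc copD_counit_left copD_counit_right matrixD_cop matrixD_com matrixD_twist
  have D: "\<chi> (K' \<odot> carr K) (K' \<odot> carr K) \<cdot> eval comD
      \<in> Hom (K' \<odot> carr K) ((K' \<odot> carr K) \<odot> K' \<odot> carr K)"
    using comp_hom[OF typing(6) braiding_hom] tensor_ob[OF K_ob(2,1)] by blast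
  have "convolution_inverse \<C> \<I> (\<one> \<I>) (\<one> \<I>) ((K' \<odot> carr K) \<odot> K' \<odot> carr K)
      (tensor_mult \<C> (K' \<odot> carr K) (eval mulD) (K' \<odot> carr K) (eval mulD))
      ((unit A \<otimes> unit K) \<otimes> unit A \<otimes> unit K) (eval matrixD) (eval matrixD_inv)"
    (is "?invertible (eval matrixD_inv)")
    unfolding convolution_inverse_def tensor_mult_def
    using typing(10,11) matrixD_right_inverse matrixD_left_inverse
      comp_id[OF tensor_hom[OF typing(10,11)]] comp_id[OF tensor_hom[OF typing(11,10)]]
      comp_id[OF tensor_hom[OF typing(7,7)]]
    by (simp add: eval_simps)
  then have "\<exists>R'. ?invertible R'" by blast
  then show ?thesis
    using double_bialgebra typing(8,10) D tensor_ob[OF K_ob(2,1)]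
      equations[THEN equationD]
    unfolding quasi_triangular_def quasi_triangular_bialgebra_def drinfeld_double_eq coalgebra_def
    by (simp add: eval_simps Let_def)
qed

end

theorem theorem3p2:
  fixes \<C> :: "('o, 'm) btc"
    and H :: "('o, 'm) bialg"
    and H' :: 'o and d b :: 'm
  assumes "strict_braided_category \<C>"
    and "hopf_algebra \<C> H"
    and "left_dual \<C> (carr H) H' d b"
    and "inverse_morphisms \<C>
           (carr H \<odot>\<^bsub>\<C>\<^esub> carr H) (carr H \<odot>\<^bsub>\<C>\<^esub> carr H)
           (\<chi>\<^bsub>\<C>\<^esub> (carr H) (carr H)) (\<chi>\<^bsub>\<C>\<^esub> (carr H) (carr H))"
  shows "(\<exists>\<tau>'. pairing_inverse \<C> (opposite \<C> (dual_bialg \<C> H H' d b)) H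
                 (double_pairing \<C> H H' d) \<tau>') \<and>
         quasi_triangular_hopf_algebra \<C>
           (drinfeld_double \<C> H H' d b) (double_R \<C> H H' d b)"
proof -
  obtain S where S: "antipode \<C> H S" and "bialgebra \<C> H"
    using assms(2) unfolding hopf_algebra_def by blast
  then interpret finite_hopf \<C> H H' d b S
    using assms unfolding inverse_morphisms_def
    by (intro finite_hopf.intro finite_hopf_axioms.intro) auto
  show ?thesis
    using pairing_inverse_iff double_bialgebra double_antipode double_quasi_triangular
    unfolding quasi_triangular_hopf_algebra_def hopf_algebra_def double_R_eq by blast
qed

end
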